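(* Let $1 \le n < d$ be integers and let $E \subset \mathbb{R}^d$ be an $n$-ADR set. Suppose that there exist constants $\kappa > 0$ and $C < \infty$ such that the following holds. For every $x \in E$ and $r \in (0,\operatorname{diam}(E)]$, there is an $\mathcal{H}^n$-measurable subset $E_{x,r} \subset E \cap B(x,r)$ and a subspace $V_{x,r} \in G(d,n)$ with the following properties: (1) $\mathcal{H}^n(E_{x,r}) \ge \kappa r^n$; (2) $\pi_{V\sharp}\mathcal{H}^n|_{E_{x,r}} \in L^2(V)$ for $\gamma_{d,n}$-almost every $V \in B(V_{x,r},\kappa)$, and $$\int_{B(V_{x,r},\kappa)} \|\pi_{V\sharp}\mathcal{H}^n|_{E_{x,r}}\|_{L^2(V)}^2 \, d\gamma_{d,n}(V) \le C r^n.$$ Then $E$ has big pieces of Lipschitz graphs (BPLG). In particular, $E$ is $n$-uniformly rectifiable ($n$-UR).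
   Context: $\mathcal{H}^n$ is $n$-dimensional Hausdorff measure and $B(x,r)$ is the closed ball in $\mathbb{R}^d$. Radii $r$ are always finite real numbers. $n$-ADR: a set $E\subset\mathbb{R}^d$ is $n$-Ahlfors-David regular ($n$-ADR) if there are constants $0<C_1\le C_2<\infty$ (the ADR constants of $E$) such that $C_1 r^n \le \mathcal{H}^n(E\cap B(x,r)) \le C_2 r^n$ for all $x\in E$ and all $r\in(0,\operatorname{diam}(E)]$. Lipschitz graph: an $n$-dimensional Lipschitz graph in $\mathbb{R}^d$ is a set $\Gamma=\{p+A(p): p\in P\}$, where $P\subset\mathbb{R}^d$ is an $n$-dimensional linear subspace and $A:P\to P^\perp$ is Lipschitz; the Lipschitz constant of $\Gamma$ is that of $A$. BPLG: an $n$-ADR set $E\subset\mathbb{R}^d$ has big pieces of Lipschitz graphs if there exist $M<\infty$ and $\delta>0$ such that for every $x\in E$ and $r\in(0,\operatorname{diam}(E)]$ there is an $n$-dimensional Lipschitz graph $\Gamma_{x,r}$ with Lipschitz constant at most $M$ such that $\mathcal{H}^n(E\cap\Gamma_{x,r}\cap B(x,r))\ge\delta r^n$. $n$-UR: a closed set $E\subset\mathbb{R}^d$ is $n$-uniformly rectifiable if it is $n$-ADR and there exist $\delta>0$ and $M<\infty$ such that for every $x\in E$ and $r\in(0,\operatorname{diam}(E)]$ there is a Lipschitz map $g:B_{\mathbb{R}^n}(0,r)\to\mathbb{R}^d$ with $\operatorname{Lip}(g)\le M$ and $\mathcal{H}^n(E\cap B(x,r)\cap g(B_{\mathbb{R}^n}(0,r)))\ge\delta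 r^n$. Grassmannian: for $1\le k<d$, $G(d,k)$ is the set of $k$-dimensional linear subspaces of $\mathbb{R}^d$, with metric $\|V-W\|_{G(d,k)}=\|\pi_V-\pi_W\|$ (operator norm), where $\pi_V$ is orthogonal projection onto $V$. $\gamma_{d,k}$ is the natural (orthogonally invariant) Borel probability measure on $G(d,k)$. $B(V,r)$, for $V\in G(d,k)$, is the closed metric ball in $G(d,k)$. $\pi_{V\sharp}\mathcal{H}^n|_{E'}$ denotes the push-forward under $\pi_V$ of the restriction of $\mathcal{H}^n$ to $E'$. Writing that it belongs to $L^2(V)$ means it is absolutely continuous with respect to $\mathcal{H}^n$ on $V$ with density in $L^2(V)=L^2(V,\mathcal{H}^n)$, and its $L^2(V)$-norm is the norm of this density.
   Formalization: The conclusion that E is n-uniformly rectifiable is stated for closed E only, since n-UR is defined for closed sets and an n-ADR set need not be closed (e.g. an n-plane minus a point); BPLG is proved for every E. *)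

theory Defs
  imports "HOL-Analysis.Analysis" "HOL-Probability.Probability_Measure"
begin

section \<open>Hausdorff measure\<close>

text \<open>
  Unlike the library's real-valued \<open>diameter\<close>, which is a junk value on unbounded sets,
  this diameter takes the value \<open>\<infinity>\<close> there.
\<close>

definition ediam :: "'a::metric_space set \<Rightarrow> ennreal" where
  "ediam S = (SUP x\<in>S. SUP y\<in>S. ennreal (dist x y))"

definition hausdorff_cost :: "nat \<Rightarrow> 'a::metric_space set \<Rightarrow> ennreal" where
  "hausdorff_cost n U =
     (if U = {} then 0 else ennreal (unit_ball_vol (real n) / 2 ^ n) * ediam U ^ n)"

definition hausdorff_content :: "nat \<Rightarrow> ennreal \<Rightarrow> 'a::metric_space set \<Rightarrow> ennreal" where
  "hausdorff_content n \<delta> A =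
     (INF U\<in>{U :: nat \<Rightarrow> 'a set. A \<subseteq> (\<Union>i. U i) \<and> (\<forall>i. ediam (U i) \<le> \<delta>)}.
        \<Sum>i. hausdorff_cost n (U i))"

text \<open>
  The normalisation is the one for which the \<open>n\<close>-dimensional measure on an \<open>n\<close>-dimensional
  Euclidean space is Lebesgue measure.  As an outer measure it is defined on all sets; the
  Ahlfors-David condition below is applied to sets that are not assumed to be measurable.
\<close>

definition hausdorff_outer :: "nat \<Rightarrow> 'a::metric_space set \<Rightarrow> ennreal" where
  "hausdorff_outer n A = (SUP \<delta>\<in>{0<..}. hausdorff_content n \<delta> A)"

text \<open>The restriction of the outer measure to the Caratheodory measurable sets.\<close>

definition hausdorff_measure :: "nat \<Rightarrow> 'a::metric_space measure" where
  "hausdorff_measure n =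
     measure_of UNIV (lambda_system UNIV UNIV (hausdorff_outer n)) (hausdorff_outer n)"

lemma ediam_mono: "A \<subseteq> B \<Longrightarrow> ediam A \<le> ediam B"
  unfolding ediam_def by (intro SUP_subset_mono) (auto intro!: SUP_subset_mono)

lemma ediam_empty [simp]: "ediam {} = 0"
  by (simp add: ediam_def bot_ennreal)

lemma hausdorff_content_empty: "hausdorff_content n \<delta> ({} :: 'a::metric_space set) = 0"
proof -
  have "hausdorff_content n \<delta> {} \<le> (\<Sum>i::nat. hausdorff_cost n ({} :: 'a set))"
    unfolding hausdorff_content_def by (rule INF_lower2[of "\<lambda>_. {}"]) (auto simp: hausdorff_cost_def)
  then show ?thesis by (simp add: hausdorff_cost_def)
qed

lemma hausdorff_content_mono: "A \<subseteq> B \<Longrightarrow> hausdorff_content n \<delta> A \<le> hausdorff_content n \<delta> B"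
  unfolding hausdorff_content_def by (intro INF_superset_mono) auto

lemma hausdorff_content_subadditive:
  fixes A :: "nat \<Rightarrow> 'a::metric_space set"
  shows "hausdorff_content n \<delta> (\<Union>i. A i) \<le> (\<Sum>i. hausdorff_content n \<delta> (A i))"
proof (rule ennreal_le_epsilon)
  fix e :: real
  assume fin: "(\<Sum>i. hausdorff_content n \<delta> (A i)) < top" and e: "0 < e"
  have "\<exists>U. A i \<subseteq> (\<Union>j. U j) \<and> (\<forall>j. ediam (U j) \<le> \<delta>) \<and>
            (\<Sum>j. hausdorff_cost n (U j)) \<le> hausdorff_content n \<delta> (A i) + ennreal (e * (1/2)^Suc i)"
    for i
  proof -
    have "hausdorff_content n \<delta> (A i) < top"
      using fin ennreal_suminf_lessD by blast
    then have "hausdorff_content n \<delta> (A i) <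
               hausdorff_content n \<delta> (A i) + ennreal (e * (1/2)^Suc i)"
      using e ennreal_add_left_cancel_less[of "hausdorff_content n \<delta> (A i)" 0]
      by (simp add: ennreal_zero_less_top less_top)
    then show ?thesis
      unfolding hausdorff_content_def[of n \<delta> "A i"] INF_less_iff
      by (auto intro: less_imp_le)
  qed
  then obtain U where U: "\<And>i. A i \<subseteq> (\<Union>j. U i j)" "\<And>i j. ediam (U i j) \<le> \<delta>"
    and cost: "\<And>i. (\<Sum>j. hausdorff_cost n (U i j))
                 \<le> hausdorff_content n \<delta> (A i) + ennreal (e * (1/2)^Suc i)"
    by metis
  define W where "W k = (case prod_decode k of (i, j) \<Rightarrow> U i j)" for k
  have cover: "(\<Union>i. A i) \<subseteq> (\<Union>k. W k)"
  proof
    fix x assume "x \<in> (\<Union>i. A i)"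
    then obtain i j where "x \<in> U i j" using U(1) by blast
    then have "x \<in> W (prod_encode (i, j))" by (simp add: W_def)
    then show "x \<in> (\<Union>k. W k)" by blast
  qed
  have "hausdorff_content n \<delta> (\<Union>i. A i) \<le> (\<Sum>k. hausdorff_cost n (W k))"
    unfolding hausdorff_content_def using cover U(2)
    by (intro INF_lower) (auto simp: W_def split: prod.splits)
  also have "\<dots> = (\<Sum>i. \<Sum>j. hausdorff_cost n (U i j))"
    using suminf_ennreal_2dimen[where f = "\<lambda>(i, j). hausdorff_cost n (U i j)"
        and g = "\<lambda>i. \<Sum>j. hausdorff_cost n (U i j)"]
    by (simp add: W_def o_def case_prod_unfold)
  also have "\<dots> \<le> (\<Sum>i. hausdorff_content n \<delta> (A i) + ennreal (e * (1/2)^Suc i))"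
    by (intro suminf_le cost) auto
  also have "\<dots> = (\<Sum>i. hausdorff_content n \<delta> (A i)) + (\<Sum>i. ennreal (e * (1/2)^Suc i))"
    by (rule suminf_add[symmetric]) auto
  also have "(\<Sum>i. ennreal (e * (1/2)^Suc i)) = ennreal e"
    using e sums_mult[OF power_half_series, of e]
    by (intro suminf_ennreal_eq) auto
  finally show "hausdorff_content n \<delta> (\<Union>i. A i) \<le> (\<Sum>i. hausdorff_content n \<delta> (A i)) + ennreal e" .
qed

lemma outer_measure_space_hausdorff_outer:
  "outer_measure_space UNIV (hausdorff_outer n :: 'a::metric_space set \<Rightarrow> ennreal)"
  unfolding outer_measure_space_def
proof (intro conjI)
  show "positive UNIV (hausdorff_outer n :: 'a set \<Rightarrow> ennreal)"
    unfolding positive_def hausdorff_outer_def hausdorff_content_empty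
    by (auto simp: SUP_constant bot_ennreal)
  show "increasing UNIV (hausdorff_outer n :: 'a set \<Rightarrow> ennreal)"
    unfolding increasing_def hausdorff_outer_def
    by (auto intro!: SUP_mono hausdorff_content_mono)
  show "countably_subadditive UNIV (hausdorff_outer n :: 'a set \<Rightarrow> ennreal)"
    unfolding countably_subadditive_def
  proof (intro allI impI)
    fix A :: "nat \<Rightarrow> 'a set"
    show "hausdorff_outer n (\<Union>i. A i) \<le> (\<Sum>i. hausdorff_outer n (A i))"
      unfolding hausdorff_outer_def[of n "\<Union>i. A i"]
    proof (rule SUP_least)
      fix \<delta> :: ennreal assume "\<delta> \<in> {0<..}"
      then have "(\<Sum>i. hausdorff_content n \<delta> (A i)) \<le> (\<Sum>i. hausdorff_outer n (A i))"
        unfolding hausdorff_outer_def by (intro suminf_le SUP_upper) auto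
      with hausdorff_content_subadditive
      show "hausdorff_content n \<delta> (\<Union>i. A i) \<le> (\<Sum>i. hausdorff_outer n (A i))"
        by (rule order_trans)
    qed
  qed
qed

lemma measure_space_hausdorff:
  "measure_space UNIV (lambda_system UNIV UNIV (hausdorff_outer n)) (hausdorff_outer n)"
  using sigma_algebra.caratheodory_lemma[OF sigma_algebra_Pow outer_measure_space_hausdorff_outer[unfolded Pow_UNIV[symmetric]]]
  by simp

lemma space_hausdorff_measure [simp]: "space (hausdorff_measure n) = UNIV"
  by (simp add: hausdorff_measure_def space_measure_of_conv)

lemma sets_hausdorff_measure:
  "sets (hausdorff_measure n :: 'a::metric_space measure) =
     lambda_system UNIV UNIV (hausdorff_outer n)"
  using measure_space_hausdorff[of n, where 'a = 'a]
  by (simp add: hausdorff_measure_def measure_space_def sets_measure_of_conv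
      sigma_algebra.sigma_sets_eq)

lemma emeasure_hausdorff_measure:
  fixes A :: "'a::metric_space set"
  shows "A \<in> sets (hausdorff_measure n) \<Longrightarrow>
    emeasure (hausdorff_measure n) A = hausdorff_outer n A"
  using measure_space_hausdorff[of n, where 'a = 'a] unfolding sets_hausdorff_measure
  by (simp add: hausdorff_measure_def measure_space_def emeasure_measure_of_sigma)


section \<open>Regularity and rectifiability of sets\<close>

definition ADR :: "nat \<Rightarrow> 'a::euclidean_space set \<Rightarrow> bool" where
  "ADR n E \<longleftrightarrow>
     (\<exists>C1 C2. 0 < C1 \<and> C1 \<le> C2 \<and>
       (\<forall>x\<in>E. \<forall>r. 0 < r \<and> ennreal r \<le> ediam E \<longrightarrow>
          ennreal (C1 * r ^ n) \<le> hausdorff_outer n (E \<inter> cball x r) \<and>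
          hausdorff_outer n (E \<inter> cball x r) \<le> ennreal (C2 * r ^ n)))"

definition lipschitz_graph :: "nat \<Rightarrow> real \<Rightarrow> 'a::euclidean_space set \<Rightarrow> bool" where
  "lipschitz_graph n M \<Gamma> \<longleftrightarrow>
     (\<exists>P A. subspace P \<and> dim P = n \<and> A ` P \<subseteq> P\<^sup>\<bottom> \<and> lipschitz_on M P A \<and>
            \<Gamma> = (\<lambda>p. p + A p) ` P)"

definition BPLG :: "nat \<Rightarrow> 'a::euclidean_space set \<Rightarrow> bool" where
  "BPLG n E \<longleftrightarrow> ADR n E \<and>
     (\<exists>M \<delta>. 0 < \<delta> \<and>
       (\<forall>x\<in>E. \<forall>r. 0 < r \<and> ennreal r \<le> ediam E \<longrightarrow>
          (\<exists>\<Gamma>. lipschitz_graph n M \<Gamma> \<and>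
               ennreal (\<delta> * r ^ n) \<le> hausdorff_outer n (E \<inter> \<Gamma> \<inter> cball x r))))"

text \<open>
  Since the dimension \<open>n\<close> is a natural number, points of \<open>\<real>\<^sup>n\<close> are represented by sequences
  that vanish from index \<open>n\<close> on.
\<close>

definition Rn_dist :: "nat \<Rightarrow> (nat \<Rightarrow> real) \<Rightarrow> (nat \<Rightarrow> real) \<Rightarrow> real" where
  "Rn_dist n u v = L2_set (\<lambda>i. u i - v i) {..<n}"

definition Rn_cball0 :: "nat \<Rightarrow> real \<Rightarrow> (nat \<Rightarrow> real) set" where
  "Rn_cball0 n r = {u. (\<forall>i\<ge>n. u i = 0) \<and> Rn_dist n (\<lambda>_. 0) u \<le> r}"

definition uniformly_rectifiable :: "nat \<Rightarrow> 'a::euclidean_space set \<Rightarrow> bool" where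
  "uniformly_rectifiable n E \<longleftrightarrow> closed E \<and> ADR n E \<and>
     (\<exists>\<delta> M. 0 < \<delta> \<and>
       (\<forall>x\<in>E. \<forall>r. 0 < r \<and> ennreal r \<le> ediam E \<longrightarrow>
          (\<exists>g. (\<forall>u\<in>Rn_cball0 n r. \<forall>v\<in>Rn_cball0 n r. dist (g u) (g v) \<le> M * Rn_dist n u v) \<and>
               ennreal (\<delta> * r ^ n) \<le> hausdorff_outer n (E \<inter> cball x r \<inter> g ` Rn_cball0 n r))))"


section \<open>The Grassmannian\<close>

text \<open>
  Using \<open>span V\<close>, which is \<open>V\<close> itself for a subspace, makes the projection well defined, and the
  distance between projections a metric in the sense of the library, for every set \<open>V\<close>.
\<close>

definition orth_proj :: "'a::euclidean_space set \<Rightarrow> 'a \<Rightarrow> 'a" where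
  "orth_proj V x = (THE y. y \<in> span V \<and> (\<forall>w\<in>span V. orthogonal (x - y) w))"

definition Grassmannian :: "nat \<Rightarrow> 'a::euclidean_space set set" where
  "Grassmannian k = {V. subspace V \<and> dim V = k}"

definition grassmann_dist :: "'a::euclidean_space set \<Rightarrow> 'a set \<Rightarrow> real" where
  "grassmann_dist V W = onorm (\<lambda>x. orth_proj V x - orth_proj W x)"

abbreviation grassmann_cball :: "nat \<Rightarrow> 'a::euclidean_space set \<Rightarrow> real \<Rightarrow> 'a set set" where
  "grassmann_cball k \<equiv> Metric_space.mcball (Grassmannian k) grassmann_dist"

definition grassmann_borel :: "nat \<Rightarrow> 'a::euclidean_space set measure" where
  "grassmann_borel k =
     sigma (Grassmannian k)
       {U. openin (Metric_space.mtopology (Grassmannian k) grassmann_dist) U}"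

text \<open>
  There is exactly one measure with this property (for each \<open>k\<close> up to the dimension of the
  space), so that a statement about all of them is a statement about the natural measure on
  the Grassmannian.
\<close>

definition is_grassmann_measure :: "nat \<Rightarrow> 'a::euclidean_space set measure \<Rightarrow> bool" where
  "is_grassmann_measure k \<gamma> \<longleftrightarrow>
     prob_space \<gamma> \<and> space \<gamma> = Grassmannian k \<and> sets \<gamma> = sets (grassmann_borel k) \<and>
     (\<forall>T. orthogonal_transformation T \<longrightarrow>
        (\<forall>A\<in>sets \<gamma>. emeasure \<gamma> ((`) T ` A) = emeasure \<gamma> A))"

lemma orth_proj_unique:
  assumes "y \<in> span V" "\<And>w. w \<in> span V \<Longrightarrow> orthogonal (x - y) w"
  shows "orth_proj V x = y"
  unfolding orth_proj_def
proof (rule the_equality)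
  fix z assume z: "z \<in> span V \<and> (\<forall>w\<in>span V. orthogonal (x - z) w)"
  have "z - y \<in> span V" using z assms(1) by (simp add: span_diff)
  then have "(x - y) \<bullet> (z - y) = 0" "(x - z) \<bullet> (z - y) = 0"
    using z assms(2) by (auto simp: orthogonal_def)
  then have "(z - y) \<bullet> (z - y) = 0" by (simp add: inner_diff_left)
  then show "z = y" by simp
qed (use assms in auto)

lemma orth_proj:
  shows orth_proj_in_span: "orth_proj V x \<in> span V"
    and orth_proj_orthogonal: "w \<in> span V \<Longrightarrow> orthogonal (x - orth_proj V x) w"
proof -
  obtain y z where "y \<in> span V" "\<And>w. w \<in> span V \<Longrightarrow> orthogonal z w" "x = y + z"
    using orthogonal_subspace_decomp_exists[of V x] by blast
  moreover from this have "orth_proj V x = y" by (intro orth_proj_unique) auto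
  ultimately show "orth_proj V x \<in> span V"
    "w \<in> span V \<Longrightarrow> orthogonal (x - orth_proj V x) w" by auto
qed

lemma linear_orth_proj: "linear (orth_proj V)"
proof
  show "orth_proj V (x + y) = orth_proj V x + orth_proj V y" for x y
  proof (rule orth_proj_unique)
    fix w assume "w \<in> span V"
    then show "orthogonal (x + y - (orth_proj V x + orth_proj V y)) w"
      using orth_proj_orthogonal[of w V x] orth_proj_orthogonal[of w V y]
      by (simp add: orthogonal_def inner_diff_left inner_add_left)
  qed (simp add: orth_proj_in_span span_add)
  show "orth_proj V (c *\<^sub>R x) = c *\<^sub>R orth_proj V x" for c x
  proof (rule orth_proj_unique)
    fix w assume "w \<in> span V"
    then show "orthogonal (c *\<^sub>R x - c *\<^sub>R orth_proj V x) w"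
      using orth_proj_orthogonal[of w V x]
      by (simp add: orthogonal_def inner_diff_left flip: scaleR_diff_right)
  qed (simp add: orth_proj_in_span span_scale)
qed

lemma orth_proj_id: "x \<in> span V \<Longrightarrow> orth_proj V x = x"
  by (rule orth_proj_unique) (auto simp: orthogonal_def)

lemma Metric_space_Grassmannian: "Metric_space (Grassmannian k) grassmann_dist"
proof
  have bl: "bounded_linear (\<lambda>x. orth_proj V x - orth_proj W x)" for V W :: "'a set"
    by (intro bounded_linear_sub linear_conv_bounded_linear[THEN iffD1] linear_orth_proj)
  show "0 \<le> grassmann_dist V W" for V W :: "'a set"
    unfolding grassmann_dist_def by (rule onorm_pos_le[OF bl])
  show "grassmann_dist V W = grassmann_dist W V" for V W :: "'a set"
    unfolding grassmann_dist_def onorm_def by (simp add: norm_minus_commute)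
  show "grassmann_dist V W = 0 \<longleftrightarrow> V = W"
    if "V \<in> Grassmannian k" "W \<in> Grassmannian k" for V W :: "'a set"
  proof
    assume "grassmann_dist V W = 0"
    then have eq: "orth_proj V x = orth_proj W x" for x
      using onorm_eq_0[OF bl] by (auto simp: grassmann_dist_def)
    have "span V = span W"
      using eq orth_proj_id orth_proj_in_span by (metis subsetI subset_antisym)
    then show "V = W" using that by (metis (mono_tags, lifting) Grassmannian_def mem_Collect_eq span_eq_iff)
  next
    assume "V = W" then show "grassmann_dist V W = 0"
      by (simp add: grassmann_dist_def onorm_zero)
  qed
  show "grassmann_dist U W \<le> grassmann_dist U V + grassmann_dist V W" for U V W :: "'a set"
    unfolding grassmann_dist_def using onorm_triangle[OF bl[of U V] bl[of V W]] by simp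
qed


section \<open>Projected measures\<close>

text \<open>
  Measures on the plane \<open>V\<close> live on its Borel sets: projections need not be measurable with
  respect to the Caratheodory measurable subsets of \<open>V\<close>.
\<close>

definition plane_measure :: "nat \<Rightarrow> 'a::euclidean_space set \<Rightarrow> 'a measure" where
  "plane_measure n V =
     distr (restrict_space (hausdorff_measure n) V) (restrict_space borel V) (\<lambda>y. y)"

definition proj_measure :: "nat \<Rightarrow> 'a::euclidean_space set \<Rightarrow> 'a set \<Rightarrow> 'a measure" where
  "proj_measure n A V =
     distr (restrict_space (hausdorff_measure n) A) (restrict_space borel V) (orth_proj V)"

definition L2_norm_sq :: "'a measure \<Rightarrow> 'a measure \<Rightarrow> ennreal" where
  "L2_norm_sq M \<nu> =
     (if absolutely_continuous M \<nu> then \<integral>\<^sup>+ y. (RN_deriv M \<nu> y)\<^sup>2 \<partial>M else \<infinity>)"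

definition in_L2 :: "'a measure \<Rightarrow> 'a measure \<Rightarrow> bool" where
  "in_L2 M \<nu> \<longleftrightarrow> absolutely_continuous M \<nu> \<and> (\<integral>\<^sup>+ y. (RN_deriv M \<nu> y)\<^sup>2 \<partial>M) < \<infinity>"

end

(*
  Let mu be Hausdorff measure restricted to E_{x,r}. If the push-forward of mu to V has a density f in
  L^2(V), then f(z) f(w) <= f(z)^2 + f(w)^2 shows that the mu x mu measure of the pairs whose difference
  projects to within delta of 0 is at most a constant times delta^n |f|^2. Invariance of gamma gives
  gamma {V in B(V0, kappa) : |pi_V w| <= delta} >= c (delta / |w|)^n for w in a narrow cone around the
  orthogonal complement of V0. Integrating over B(V0, kappa) and letting delta tend to 0 bounds the
  conical energy, the integral of |x - y|^(-n) over the pairs with x - y in the cone, by C r^n.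

  On a large part F of E_{x,r}, mu has lower density bounded below at all scales up to r (by a Vitali
  covering) and the energy at each point is bounded (by Markov's inequality). Each scale at which some
  y in F lies in the cone of x contributes a fixed amount to the energy at x, so x has at most N such bad
  scales. At each scale colour the points by their grid cube modulo a bounded number, so that no two
  points of one colour form a bad pair at that scale. Keeping, at each scale, only one suitable colour
  among the points that are bad there leaves a fixed proportion of F and no bad pair at all; the points
  that remain form a Lipschitz graph over a subset of V0, and McShane's theorem extends it to V0.
*)

theory Submission
  imports Defs
begin

section \<open>Borel sets are measurable for Hausdorff measure\<close>

text \<open>The exponent \<open>n\<close> of the kernel is critical: a ball of radius about s and
  mass about s^n, seen from a distance about s, contributes an amount that does not depend on s.
  Energy of order r^n on mass of order r^n therefore bounds the number of bad scales of most points,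
  but cannot make it zero. The bad pairs that are left have to be removed by selection, and the loss
  may depend only on the number N of bad scales of a point, although different points have different
  bad scales and infinitely many scales occur altogether. Hence the averaging over colours, which
  costs a factor \<open>card C\<close> per bad scale of a point and nothing at its other scales. Bad
  pairs are taken in a cone of aperture \<beta>/2, so that a whole ball about y, not just y itself,
  lies in the cone of aperture \<beta> whose energy is bounded: a single point carries no mass. The
  set E is not assumed measurable. Its Hausdorff measure is treated as an outer measure, and
  additivity on E is used only over disjoint Borel pieces, by the Caratheodory condition.\<close>

lemma hausdorff_outer_mono: "A \<subseteq> B \<Longrightarrow> hausdorff_outer n A \<le> hausdorff_outer n B"
  unfolding hausdorff_outer_def by (auto intro!: SUP_mono hausdorff_content_mono)

lemma hausdorff_outer_empty [simp]: "hausdorff_outer n ({} :: 'a::metric_space set) = 0"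
  using outer_measure_space_hausdorff_outer[of n, where 'a='a]
  by (simp add: outer_measure_space_def positive_def)

lemma hausdorff_outer_countable_subadditive:
  "hausdorff_outer n (\<Union>i::nat. A i) \<le> (\<Sum>i. hausdorff_outer n (A i :: 'a::metric_space set))"
  unfolding hausdorff_outer_def[of n "\<Union>i. A i"]
proof (rule SUP_least)
  fix \<delta> :: ennreal assume "\<delta> \<in> {0<..}"
  then have "(\<Sum>i. hausdorff_content n \<delta> (A i)) \<le> (\<Sum>i. hausdorff_outer n (A i))"
    unfolding hausdorff_outer_def by (intro suminf_le SUP_upper) auto
  with hausdorff_content_subadditive
  show "hausdorff_content n \<delta> (\<Union>i. A i) \<le> (\<Sum>i. hausdorff_outer n (A i))"
    by (rule order_trans)
qed

lemma hausdorff_outer_Un_le: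
  "hausdorff_outer n (A \<union> B) \<le> hausdorff_outer n A + hausdorff_outer n (B :: 'a::metric_space set)"
proof -
  have "hausdorff_outer n (\<Union>i. binaryset A B i) \<le> (\<Sum>i. hausdorff_outer n (binaryset A B i))"
    by (rule hausdorff_outer_countable_subadditive)
  then show ?thesis
    by (simp add: UN_binaryset_eq suminf_binaryset_eq)
qed

text \<open>A covering set of diameter less than \<eta> cannot meet both A and B, so a fine cover of
  the union splits into a cover of A and a cover of B. Independent scales \<open>d1\<close> and
  \<open>d2\<close> allow the two suprema to be taken one after the other.\<close>

lemma hausdorff_outer_Un_separated:
  fixes A B :: "'a::metric_space set"
  assumes "0 < \<eta>" and sep: "\<And>a b. a \<in> A \<Longrightarrow> b \<in> B \<Longrightarrow> \<eta> \<le> dist a b"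
  shows "hausdorff_outer n A + hausdorff_outer n B \<le> hausdorff_outer n (A \<union> B)"
proof -
  have key: "hausdorff_content n d1 A + hausdorff_content n d2 B \<le> hausdorff_outer n (A \<union> B)"
    if "0 < d1" "0 < d2" for d1 d2
  proof -
    \<comment> \<open>The separation is only \<open>\<eta> \<le> dist a b\<close>, so the diameters
      must stay strictly below \<eta>; hence the half.\<close>
    define d where "d = min (min d1 d2) (ennreal (\<eta> / 2))"
    have d: "0 < d" "d \<le> d1" "d \<le> d2" "d < ennreal \<eta>"
      using that assms(1) by (auto simp: d_def min_less_iff_disj ennreal_less_iff intro: min.coboundedI1)
    have "hausdorff_content n d1 A + hausdorff_content n d2 B \<le> hausdorff_content n d (A \<union> B)"
      unfolding hausdorff_content_def[of n d "A \<union> B"]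
    proof (rule INF_greatest)
      fix U :: "nat \<Rightarrow> 'a set"
      assume "U \<in> {U. A \<union> B \<subseteq> (\<Union>i. U i) \<and> (\<forall>i. ediam (U i) \<le> d)}"
      then have U: "A \<union> B \<subseteq> (\<Union>i. U i)" "\<And>i. ediam (U i) \<le> d" by auto
      define UA where "UA i = (if U i \<inter> A = {} then {} else U i)" for i
      define UB where "UB i = (if U i \<inter> B = {} then {} else U i)" for i
      have not_both: "U i \<inter> A = {} \<or> U i \<inter> B = {}" for i
      proof (rule ccontr)
        assume "\<not> (U i \<inter> A = {} \<or> U i \<inter> B = {})"
        then obtain a b where ab: "a \<in> U i" "a \<in> A" "b \<in> U i" "b \<in> B" by blast
        have "ennreal \<eta> \<le> ennreal (dist a b)" using sep ab by (intro ennreal_leI) auto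
        also have "\<dots> \<le> ediam (U i)"
          unfolding ediam_def using ab by (intro SUP_upper2[of a] SUP_upper2[of b]) auto
        also have "\<dots> \<le> d" by (rule U)
        finally show False using d by simp
      qed
      have "hausdorff_content n d1 A \<le> (\<Sum>i. hausdorff_cost n (UA i))"
        unfolding hausdorff_content_def
      proof (intro INF_lower CollectI conjI allI)
        show "A \<subseteq> (\<Union>i. UA i)"
        proof
          fix x assume "x \<in> A"
          with U(1) obtain i where "x \<in> U i" by auto
          with \<open>x \<in> A\<close> have "x \<in> UA i" by (auto simp: UA_def)
          then show "x \<in> (\<Union>i. UA i)" by blast
        qed
        show "ediam (UA i) \<le> d1" for i
          using U(2)[of i] d by (auto simp: UA_def)
      qed
      moreover have "hausdorff_content n d2 B \<le> (\<Sum>i. hausdorff_cost n (UB i))"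
        unfolding hausdorff_content_def
      proof (intro INF_lower CollectI conjI allI)
        show "B \<subseteq> (\<Union>i. UB i)"
        proof
          fix x assume "x \<in> B"
          with U(1) obtain i where "x \<in> U i" by auto
          with \<open>x \<in> B\<close> have "x \<in> UB i" by (auto simp: UB_def)
          then show "x \<in> (\<Union>i. UB i)" by blast
        qed
        show "ediam (UB i) \<le> d2" for i
          using U(2)[of i] d by (auto simp: UB_def)
      qed
      ultimately have "hausdorff_content n d1 A + hausdorff_content n d2 B
        \<le> (\<Sum>i. hausdorff_cost n (UA i)) + (\<Sum>i. hausdorff_cost n (UB i))"
        by (rule add_mono)
      also have "\<dots> = (\<Sum>i. hausdorff_cost n (UA i) + hausdorff_cost n (UB i))"
        by (rule suminf_add) auto
      also have "\<dots> \<le> (\<Sum>i. hausdorff_cost n (U i))"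
        using not_both by (intro suminf_le) (auto simp: UA_def UB_def hausdorff_cost_def)
      finally show "hausdorff_content n d1 A + hausdorff_content n d2 B \<le> (\<Sum>i. hausdorff_cost n (U i))" .
    qed
    also have "\<dots> \<le> hausdorff_outer n (A \<union> B)"
      unfolding hausdorff_outer_def using d by (intro SUP_upper) auto
    finally show ?thesis .
  qed
  have ne: "{0::ennreal<..} \<noteq> {}"
    using greaterThan_iff[of 1 "0::ennreal"] zero_less_one by blast
  have "hausdorff_outer n A + hausdorff_content n d2 B \<le> hausdorff_outer n (A \<union> B)" if "0 < d2" for d2
    unfolding hausdorff_outer_def[of n A] using key that ne
    by (subst ennreal_SUP_add_left[symmetric]) (auto intro!: SUP_least)
  then show ?thesis
    unfolding hausdorff_outer_def[of n B]
    by (subst ennreal_SUP_add_right[OF ne]) (auto intro!: SUP_least)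
qed

text \<open>Caratheodory's criterion for metric outer measures. The part of T - C far from C is
  separated from C; the rest is cut into layers \<open>R k\<close> by distance to C. Layers of equal
  parity are separated from each other, so the measures of all layers have a finite sum and the
  layers close to C are negligible.\<close>

lemma closed_sets_hausdorff_measure:
  fixes C :: "'a::metric_space set"
  assumes "closed C"
  shows "C \<in> sets (hausdorff_measure n)"
proof (cases "C = {}")
  case False
  let ?H = "hausdorff_outer n :: 'a set \<Rightarrow> ennreal"
  have main: "?H (C \<inter> T) + ?H (T - C) \<le> ?H T" for T
  proof (cases "?H T = \<infinity>")
    case fin: False
    define S where "S k = {x \<in> T. 1 / real (Suc k) \<le> infdist x C}" for k
    define R where "R k = {x \<in> T. 1 / real (Suc (Suc k)) \<le> infdist x C \<and> infdist x C < 1 / real (Suc k)}" for k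
    have separated: "?H A + ?H B \<le> ?H (A \<union> B)"
      if "\<And>x. x \<in> A \<Longrightarrow> a \<le> infdist x C" "\<And>x. x \<in> B \<Longrightarrow> infdist x C \<le> b" "b < a" for A B a b
    proof (rule hausdorff_outer_Un_separated[of "a - b"])
      fix x y assume "x \<in> A" "y \<in> B"
      with that have "a \<le> infdist x C" "infdist y C \<le> b" by auto
      moreover have "infdist x C \<le> infdist y C + dist x y"
        by (rule infdist_triangle)
      ultimately show "a - b \<le> dist x y" by simp
    qed (use that in auto)
    have parity: "(\<Sum>i<m. ?H (R (2 * i + p))) \<le> ?H T" for m p
    proof -
      have "(\<Sum>i<m. ?H (R (2 * i + p))) \<le> ?H (\<Union>i<m. R (2 * i + p))"
      proof (induction m)
        case (Suc m)
        have "(\<Sum>i<Suc m. ?H (R (2 * i + p))) \<le> ?H (\<Union>i<m. R (2 * i + p)) + ?H (R (2 * m + p))"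
          using Suc by (simp add: add_mono)
        also have "\<dots> \<le> ?H ((\<Union>i<m. R (2 * i + p)) \<union> R (2 * m + p))"
        proof (rule separated)
          fix x assume "x \<in> (\<Union>i<m. R (2 * i + p))"
          then obtain i where i: "i < m" "x \<in> R (2 * i + p)" by auto
          then have "1 / real (Suc (Suc (2 * i + p))) \<le> infdist x C" by (simp add: R_def)
          moreover have "1 / real (2 * m + p) \<le> 1 / real (Suc (Suc (2 * i + p)))"
            using i(1) by (intro divide_left_mono) auto
          \<comment> \<open>For m = 0 the union is empty and 1 / (2m + p) may be 1 / 0 = 0. The
            value 2 merely keeps the strict inequality of the last goal true.\<close>
          ultimately show "(if m = 0 then 2 else 1 / real (2 * m + p)) \<le> infdist x C"
            using i by simp
        next
          fix x assume "x \<in> R (2 * m + p)"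
          then show "infdist x C \<le> 1 / real (Suc (2 * m + p))" by (simp add: R_def)
        next
          show "1 / real (Suc (2 * m + p)) < (if m = 0 then 2 else 1 / real (2 * m + p))"
            by (cases "m = 0") (auto intro!: divide_strict_left_mono simp: divide_less_eq)
        qed
        also have "(\<Union>i<m. R (2 * i + p)) \<union> R (2 * m + p) = (\<Union>i<Suc m. R (2 * i + p))"
          by (auto simp: less_Suc_eq)
        finally show ?case .
      qed simp
      also have "\<dots> \<le> ?H T"
        by (rule hausdorff_outer_mono) (auto simp: R_def)
      finally show ?thesis .
    qed
    have "(\<Sum>i. ?H (R i)) \<le> ?H T + ?H T"
    proof (rule suminf_le_const)
      fix m
      have "(\<Sum>i<m. ?H (R i)) \<le> (\<Sum>i<2 * m. ?H (R i))"
        by (rule sum_mono2) auto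
      also have "\<dots> = (\<Sum>i<m. ?H (R (2 * i + 0))) + (\<Sum>i<m. ?H (R (2 * i + 1)))"
      proof (induction m)
        case (Suc m)
        have "2 * Suc m = Suc (Suc (2 * m))" by simp
        then show ?case by (simp only: sum.lessThan_Suc Suc.IH) (simp add: ac_simps)
      qed simp
      also have "\<dots> \<le> ?H T + ?H T"
        by (intro add_mono parity)
      finally show "(\<Sum>i<m. ?H (R i)) \<le> ?H T + ?H T" .
    qed auto
    then have finR: "(\<Sum>i. ?H (R i)) < \<infinity>"
      using fin by (metis ennreal_add_eq_top infinity_ennreal_def le_less_trans less_top)
    have pos: "0 < infdist x C" if "x \<in> T - C" for x
      using that assms False by (metis Diff_iff in_closed_iff_infdist_zero infdist_nonneg less_le)
    \<comment> \<open>The estimate with the tail of the series as error is stated with the partial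
      sum added on both sides. This avoids subtraction in \<open>ennreal\<close>: the supremum over
      k gives the whole series on both sides, and being finite it cancels.\<close>
    have step: "?H (C \<inter> T) + ?H (T - C) + (\<Sum>i<k. ?H (R i)) \<le> ?H T + (\<Sum>i. ?H (R i))" for k
    proof -
      have "T - C \<subseteq> S k \<union> (\<Union>i. R (i + k))"
      proof
        fix x assume x: "x \<in> T - C"
        let ?P = "\<lambda>j. 1 / real (Suc j) \<le> infdist x C"
        obtain j0 where "?P j0"
          using pos[OF x] by (metis less_eq_real_def real_arch_inverse[of "infdist x C"] inverse_eq_divide not0_implies_Suc)
        define j where "j = (LEAST j. ?P j)"
        have j: "?P j" "\<And>i. i < j \<Longrightarrow> \<not> ?P i"
          using LeastI[of ?P, OF \<open>?P j0\<close>] not_less_Least[of _ ?P] by (auto simp: j_def)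
        show "x \<in> S k \<union> (\<Union>i. R (i + k))"
        proof (cases "j \<le> k")
          case True
          then have "1 / real (Suc k) \<le> 1 / real (Suc j)" by (intro divide_left_mono) auto
          with j x have "x \<in> S k" by (auto simp: S_def)
          then show ?thesis ..
        next
          case False
          then obtain i where i: "j = Suc (i + k)"
            by (metis add.commute add_Suc less_imp_Suc_add not_le)
          have "x \<in> R (i + k)"
            using j(1) j(2)[of "i + k"] x by (auto simp: R_def i not_le)
          then show ?thesis by blast
        qed
      qed
      then have "?H (T - C) \<le> ?H (S k \<union> (\<Union>i. R (i + k)))" by (rule hausdorff_outer_mono)
      also have "\<dots> \<le> ?H (S k) + ?H (\<Union>i. R (i + k))" by (rule hausdorff_outer_Un_le)
      also have "\<dots> \<le> ?H (S k) + (\<Sum>i. ?H (R (i + k)))"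
        by (intro add_left_mono hausdorff_outer_countable_subadditive)
      finally have 1: "?H (T - C) \<le> ?H (S k) + (\<Sum>i. ?H (R (i + k)))" .
      have "?H (S k) + ?H (C \<inter> T) \<le> ?H (S k \<union> (C \<inter> T))"
        by (rule separated[of _ "1 / real (Suc k)" _ 0]) (auto simp: S_def)
      also have "\<dots> \<le> ?H T" by (rule hausdorff_outer_mono) (auto simp: S_def)
      finally have 2: "?H (S k) + ?H (C \<inter> T) \<le> ?H T" .
      have 3: "(\<Sum>i. ?H (R (i + k))) + (\<Sum>i<k. ?H (R i)) = (\<Sum>i. ?H (R i))"
        using suminf_offset[of "\<lambda>i. ?H (R i)" k] by (simp add: add.commute)
      have "?H (C \<inter> T) + ?H (T - C) + (\<Sum>i<k. ?H (R i))
          \<le> ?H (C \<inter> T) + (?H (S k) + (\<Sum>i. ?H (R (i + k)))) + (\<Sum>i<k. ?H (R i))"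
        by (intro add_mono 1) auto
      also have "\<dots> = (?H (S k) + ?H (C \<inter> T)) + (\<Sum>i. ?H (R i))"
        unfolding 3[symmetric] by (simp add: ac_simps)
      also have "\<dots> \<le> ?H T + (\<Sum>i. ?H (R i))" by (intro add_mono 2) auto
      finally show ?thesis .
    qed
    have "?H (C \<inter> T) + ?H (T - C) + (\<Sum>i. ?H (R i)) \<le> ?H T + (\<Sum>i. ?H (R i))"
    proof -
      have "?H (C \<inter> T) + ?H (T - C) + (\<Sum>i. ?H (R i))
          = (SUP k. ?H (C \<inter> T) + ?H (T - C) + (\<Sum>i<k. ?H (R i)))"
        unfolding suminf_eq_SUP by (rule ennreal_SUP_add_right) simp
      then show ?thesis by (simp only:) (intro SUP_least step)
    qed
    then show ?thesis
      using finR by (metis add.commute ennreal_add_left_cancel_le infinity_ennreal_def less_irrefl)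
  qed auto
  have "?H (C \<inter> T) + ?H (T - C) = ?H T" for T
  proof (rule antisym[OF main])
    have "?H T \<le> ?H ((C \<inter> T) \<union> (T - C))" by (rule hausdorff_outer_mono) auto
    also have "\<dots> \<le> ?H (C \<inter> T) + ?H (T - C)" by (rule hausdorff_outer_Un_le)
    finally show "?H T \<le> ?H (C \<inter> T) + ?H (T - C)" .
  qed
  moreover have "(UNIV - C) \<inter> T = T - C" for T by auto
  ultimately show ?thesis
    by (simp add: sets_hausdorff_measure lambda_system_def)
qed auto

lemma borel_sets_hausdorff_measure:
  "B \<in> sets borel \<Longrightarrow> B \<in> sets (hausdorff_measure n :: 'a::metric_space measure)"
proof -
  assume "B \<in> sets borel"
  then have "B \<in> sigma_sets UNIV (Collect closed)"
    by (simp add: borel_eq_closed)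
  also have "\<dots> \<subseteq> sets (hausdorff_measure n :: 'a measure)"
    using sets.sigma_sets_subset[of "Collect closed" "hausdorff_measure n :: 'a measure"]
    by (auto intro: closed_sets_hausdorff_measure)
  finally show ?thesis .
qed

text \<open>Each A i is Caratheodory measurable, so it splits every test set additively. This gives
  additivity of the outer measure on an arbitrary T.\<close>

lemma sum_hausdorff_outer_disjoint:
  fixes T :: "'a::metric_space set"
  assumes "finite I" "disjoint_family_on A I" "\<And>i. i \<in> I \<Longrightarrow> A i \<in> sets borel"
  shows "(\<Sum>i\<in>I. hausdorff_outer n (T \<inter> A i)) \<le> hausdorff_outer n (T \<inter> (\<Union>i\<in>I. A i))"
  using assms
proof (induction I rule: finite_induct)
  case (insert i I)
  have "A i \<in> lambda_system UNIV UNIV (hausdorff_outer n)"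
    using borel_sets_hausdorff_measure[of "A i" n] insert.prems
    by (simp add: sets_hausdorff_measure)
  then have eq: "hausdorff_outer n (A i \<inter> S) + hausdorff_outer n ((UNIV - A i) \<inter> S) = hausdorff_outer n S" for S
    by (simp add: lambda_system_def)
  let ?S = "T \<inter> (\<Union>j\<in>insert i I. A j)"
  have "(\<Sum>j\<in>insert i I. hausdorff_outer n (T \<inter> A j))
      \<le> hausdorff_outer n (T \<inter> A i) + hausdorff_outer n (T \<inter> (\<Union>j\<in>I. A j))"
    using insert by (auto intro!: add_mono simp: disjoint_family_on_def)
  also have "\<dots> \<le> hausdorff_outer n (A i \<inter> ?S) + hausdorff_outer n ((UNIV - A i) \<inter> ?S)"
    using insert.prems(1) insert.hyps
    by (intro add_mono hausdorff_outer_mono) (auto simp: disjoint_family_on_def)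
  finally show ?case by (simp only: eq)
qed simp

section \<open>Planes and projections\<close>

lemma inner_orth_proj: "orth_proj V x \<bullet> y = x \<bullet> orth_proj V y"
proof -
  have "(x - orth_proj V x) \<bullet> orth_proj V y = 0" "orth_proj V x \<bullet> (y - orth_proj V y) = 0"
    using orth_proj_orthogonal[OF orth_proj_in_span] by (auto simp: orthogonal_def inner_commute)
  then show ?thesis by (simp add: inner_diff_left inner_diff_right)
qed

lemma norm_orth_proj_Pythagorean:
  "(norm x)\<^sup>2 = (norm (orth_proj V x))\<^sup>2 + (norm (x - orth_proj V x))\<^sup>2"
proof -
  have "orthogonal (orth_proj V x) (x - orth_proj V x)"
    using orth_proj_orthogonal[OF orth_proj_in_span] orthogonal_commute by blast
  from norm_add_Pythagorean[OF this] show ?thesis by simp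
qed

lemma norm_orth_proj_le: "norm (orth_proj V x) \<le> norm x"
proof (rule power2_le_imp_le)
  show "(norm (orth_proj V x))\<^sup>2 \<le> (norm x)\<^sup>2"
    unfolding norm_orth_proj_Pythagorean[of x V] by (rule le_add_same_cancel1[THEN iffD2]) simp
qed simp

lemma norm_diff_orth_proj_le: "norm (x - orth_proj V x) \<le> norm x"
proof (rule power2_le_imp_le)
  show "(norm (x - orth_proj V x))\<^sup>2 \<le> (norm x)\<^sup>2"
    unfolding norm_orth_proj_Pythagorean[of x V] by (rule le_add_same_cancel2[THEN iffD2]) simp
qed simp

lemma orth_proj_add: "orth_proj V (x + y) = orth_proj V x + orth_proj V y"
  and orth_proj_diff: "orth_proj V (x - y) = orth_proj V x - orth_proj V y"
  and orth_proj_scaleR: "orth_proj V (c *\<^sub>R x) = c *\<^sub>R orth_proj V x"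
  using linear_orth_proj[of V] by (simp_all add: linear_add linear_diff linear_scale)

lemma orth_proj_eq_0: "orth_proj V x = 0" if "\<And>v. v \<in> span V \<Longrightarrow> v \<bullet> x = 0"
  by (rule orth_proj_unique) (use that in \<open>auto simp: span_zero orthogonal_def inner_commute\<close>)

lemma orth_proj_in_subspace: "subspace V \<Longrightarrow> orth_proj V x \<in> V"
  using orth_proj_in_span[of V x] by (simp only: span_eq_iff[THEN iffD2])

lemma orth_proj_ident: "x \<in> V \<Longrightarrow> orth_proj V x = x"
  by (simp add: orth_proj_id span_base)

lemma bounded_linear_orth_proj_diff: "bounded_linear (\<lambda>x. orth_proj V x - orth_proj W x)"
  by (intro bounded_linear_sub linear_conv_bounded_linear[THEN iffD1] linear_orth_proj)

lemma continuous_on_orth_proj [continuous_intros]: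
  "continuous_on S f \<Longrightarrow> continuous_on S (\<lambda>x. orth_proj V (f x))"
  by (rule continuous_on_compose2[OF linear_continuous_on[of "orth_proj V" UNIV]])
    (auto simp: linear_conv_bounded_linear[symmetric] linear_orth_proj)

lemma orth_proj_measurable [measurable]: "orth_proj V \<in> borel_measurable borel"
  by (intro borel_measurable_continuous_onI continuous_intros)

lemma norm_orth_proj_diff_le:
  "norm (orth_proj V x - orth_proj W x) \<le> grassmann_dist V W * norm x"
  unfolding grassmann_dist_def by (rule onorm[OF bounded_linear_orth_proj_diff])

lemma grassmann_dist_leI:
  "(\<And>x. norm (orth_proj V x - orth_proj W x) \<le> e * norm x) \<Longrightarrow> grassmann_dist V W \<le> e"
  unfolding grassmann_dist_def by (rule onorm_le)

text \<open>With P, Q the projections onto V, W, the difference P - Q equals P(1 - Q) - (1 - P)Q.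
  The second term measures how far W is from V. The first is the adjoint of (1 - Q)P, which measures
  how far V is from W.\<close>

lemma grassmann_dist_le_graph:
  fixes V W :: "'a::euclidean_space set"
  assumes V: "subspace V" and W: "subspace W" and "0 \<le> e"
    and VW: "\<And>v. v \<in> V \<Longrightarrow> \<exists>w\<in>W. norm (v - w) \<le> e * norm v"
    and WV: "\<And>w. w \<in> W \<Longrightarrow> \<exists>v\<in>V. norm (w - v) \<le> e * norm w"
  shows "grassmann_dist V W \<le> 2 * e"
proof (rule grassmann_dist_leI)
  fix x :: 'a
  have gap: "norm (u - orth_proj P u) \<le> e * norm u"
    if ex: "\<exists>p\<in>P. norm (u - p) \<le> e * norm u" for P and u :: 'a
  proof -
    obtain p where p: "p \<in> P" "norm (u - p) \<le> e * norm u" using ex by blast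
    have "u - orth_proj P u = (u - p) - orth_proj P (u - p)"
      using p(1) by (simp add: orth_proj_diff orth_proj_ident)
    then have "norm (u - orth_proj P u) \<le> norm (u - p)"
      using norm_diff_orth_proj_le[of "u - p" P] by (simp only:)
    with p show ?thesis by simp
  qed
  define y where "y = x - orth_proj W x"
  define a where "a = orth_proj V y"
  define b where "b = orth_proj W x - orth_proj V (orth_proj W x)"
  have split: "orth_proj V x - orth_proj W x = a - b"
    by (simp add: a_def b_def y_def orth_proj_diff)
  have aV: "a \<in> V" using V by (simp add: a_def orth_proj_in_subspace)
  have WxW: "orth_proj W x \<in> W" using W by (rule orth_proj_in_subspace)
  have yx: "norm y \<le> norm x"
    unfolding y_def by (rule norm_diff_orth_proj_le)
  have "orthogonal y (orth_proj W a)"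
    using orth_proj_orthogonal[OF orth_proj_in_span] by (simp add: y_def)
  then have y0: "y \<bullet> orth_proj W a = 0" by (simp add: orthogonal_def)
  \<comment> \<open>The adjoint estimate in concrete form: y is perpendicular to W, so subtracting
    the projection of a onto W from a does not change y \<bullet> a.\<close>
  have "(norm a)\<^sup>2 = y \<bullet> a"
    using inner_orth_proj[of V y a] orth_proj_ident[OF aV] by (simp add: a_def power2_norm_eq_inner)
  also have "\<dots> = y \<bullet> (a - orth_proj W a)" by (simp add: inner_diff_right y0)
  also have "\<dots> \<le> norm y * (e * norm a)"
    using norm_cauchy_schwarz[of y "a - orth_proj W a"] gap[OF VW[OF aV]]
    by (meson mult_left_mono norm_ge_zero order_trans)
  finally have "norm a * norm a \<le> (e * norm y) * norm a"
    by (simp add: power2_eq_square ac_simps)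
  then have "norm a \<le> e * norm y"
    using assms(3) by (cases "norm a = 0") auto
  also have "\<dots> \<le> e * norm x" using yx assms(3) by (rule mult_left_mono)
  finally have "norm a \<le> e * norm x" .
  moreover have "norm b \<le> e * norm x"
    using gap[OF WV[OF WxW]] norm_orth_proj_le[of W x] assms(3) unfolding b_def
    by (meson mult_left_mono order_trans)
  ultimately show "norm (orth_proj V x - orth_proj W x) \<le> 2 * e * norm x"
    using norm_triangle_ineq4[of a b] by (simp add: split)
qed

text \<open>V is tilted along the component b of w perpendicular to V until it becomes perpendicular
  to w. Since w is almost perpendicular to V, b is at least half as long as w and the tilt has slope
  at most 2 \<beta>.\<close>

lemma exists_near_perpendicular_plane:
  fixes V :: "'a::euclidean_space set"
  assumes V: "V \<in> Grassmannian n" and "w \<noteq> 0" and "0 \<le> \<beta>" "\<beta> \<le> 1 / 2"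
    and w: "norm (orth_proj V w) \<le> \<beta> * norm w"
  obtains W where "W \<in> Grassmannian n" "\<And>v. v \<in> W \<Longrightarrow> v \<bullet> w = 0" "grassmann_dist V W \<le> 4 * \<beta>"
proof -
  have sV: "subspace V" "dim V = n" "span V = V"
    using V by (auto simp: Grassmannian_def)
  define a where "a = orth_proj V w"
  define b where "b = w - a"
  have bV: "v \<bullet> b = 0" if "v \<in> V" for v
    using orth_proj_orthogonal[of v V w] that sV by (simp add: b_def a_def orthogonal_def inner_commute)
  have aV: "a \<in> V" using sV(1) by (simp add: a_def orth_proj_in_subspace)
  have "norm a \<le> 1 / 2 * norm w"
    using w mult_right_mono[OF assms(4), of "norm w"] by (simp add: a_def)
  then have "(norm a)\<^sup>2 \<le> (1 / 2 * norm w)\<^sup>2"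
    by (intro power_mono) auto
  then have "(norm a)\<^sup>2 \<le> (norm w)\<^sup>2 / 4" by (simp add: power_divide)
  then have "(norm w)\<^sup>2 / 4 \<le> (norm b)\<^sup>2"
    using norm_orth_proj_Pythagorean[of w V] zero_le_power2[of "norm b"]
    unfolding a_def b_def by linarith
  then have bw: "norm w \<le> 2 * norm b"
    using power2_le_imp_le[of "norm w / 2" "norm b"] by (simp add: power_divide)
  then have b0: "b \<noteq> 0" using assms(2) by auto
  have bw2: "b \<bullet> w = b \<bullet> b"
    using bV[OF aV] by (simp add: b_def inner_diff_right inner_commute)
  \<comment> \<open>The tilted plane is the image of V under A. The coefficient is forced by A x
    \<bullet> w = 0, because b \<bullet> w = b \<bullet> b.\<close>
  define A where "A x = x - ((x \<bullet> w) / (b \<bullet> b)) *\<^sub>R b" for x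
  have linA: "linear A"
    by (rule linearI) (auto simp: A_def inner_add_left add_divide_distrib scaleR_add_left scaleR_diff_right)
  have projA: "orth_proj V (A x) = x" if "x \<in> V" for x
  proof (rule orth_proj_unique)
    show "x \<in> span V" using that by (rule span_base)
    fix v assume "v \<in> span V"
    then have "v \<in> V" by (simp only: sV(3))
    then show "orthogonal (A x - x) v"
      using bV[of v] by (simp add: A_def orthogonal_def inner_commute)
  qed
  have near: "norm (A x - x) \<le> 2 * \<beta> * norm x" if "x \<in> V" for x
  proof -
    have "x \<bullet> w = x \<bullet> a" using bV[OF that] by (simp add: b_def inner_diff_right)
    then have "\<bar>x \<bullet> w\<bar> \<le> norm x * (\<beta> * norm w)"
      using Cauchy_Schwarz_ineq2[of x a] w by (simp add: a_def) (meson mult_left_mono norm_ge_zero order_trans)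
    also have "\<dots> \<le> norm x * (\<beta> * (2 * norm b))"
      using bw assms(3) by (intro mult_left_mono) auto
    finally have "\<bar>x \<bullet> w\<bar> / norm b \<le> 2 * \<beta> * norm x"
      using b0 by (simp add: divide_le_eq ac_simps)
    moreover have "norm (A x - x) = \<bar>x \<bullet> w\<bar> / norm b"
      using b0 by (simp add: A_def dot_square_norm power2_eq_square)
    ultimately show ?thesis by simp
  qed
  show ?thesis
  proof
    have "inj_on A (span V)"
      unfolding sV by (rule inj_on_inverseI[of _ "orth_proj V"]) (rule projA)
    then have "dim (A ` V) = n"
      using dim_image_eq[OF linA] sV by blast
    then show "A ` V \<in> Grassmannian n"
      using linear_subspace_image[OF linA sV(1)] by (simp add: Grassmannian_def)
    show "v \<bullet> w = 0" if "v \<in> A ` V" for v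
      using that b0 bw2 by (auto simp: A_def inner_diff_left)
    have "grassmann_dist V (A ` V) \<le> 2 * (2 * \<beta>)"
    proof (rule grassmann_dist_le_graph)
      show "subspace (A ` V)" by (rule linear_subspace_image[OF linA sV(1)])
      show "\<exists>w\<in>A ` V. norm (v - w) \<le> 2 * \<beta> * norm v" if "v \<in> V" for v
        using near[OF that] that by (auto simp: norm_minus_commute)
      show "\<exists>v\<in>V. norm (w - v) \<le> 2 * \<beta> * norm w" if w: "w \<in> A ` V" for w
      proof -
        obtain x where x: "x \<in> V" "w = A x" using w by blast
        have "norm x \<le> norm w" using norm_orth_proj_le[of V "A x"] projA[OF x(1)] x(2) by simp
        then have "2 * \<beta> * norm x \<le> 2 * \<beta> * norm w"
          using assms(3) by (intro mult_left_mono) auto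
        with near[OF x(1)] x show ?thesis
          by (intro bexI[of _ x]) auto
      qed
    qed (use assms sV in auto)
    then show "grassmann_dist V (A ` V) \<le> 4 * \<beta>" by simp
  qed
qed

text \<open>For nearby planes, the projection onto W shrinks vectors of V by at most a factor 2. It
  is therefore injective on V and, the dimensions being equal, maps V onto W; v is the preimage of
  minus the projection of w. That projection has norm at most \<rho>, because w projects to 0 on
  V.\<close>

lemma exists_perpendicular_translate:
  fixes V W :: "'a::euclidean_space set"
  assumes V: "V \<in> Grassmannian n" and W: "W \<in> Grassmannian n"
    and "grassmann_dist V W \<le> \<rho>" "\<rho> \<le> 1 / 2" and w: "norm w = 1" "\<And>v. v \<in> V \<Longrightarrow> v \<bullet> w = 0"
  obtains v where "v \<in> V" "norm v \<le> 2 * \<rho>" "orth_proj W (w + v) = 0"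
proof -
  have sV: "subspace V" "dim V = n" "span V = V" and sW: "subspace W" "dim W = n" "span W = W"
    using V W by (auto simp: Grassmannian_def)
  have pd: "norm (orth_proj V x - orth_proj W x) \<le> \<rho> * norm x" for x
    using norm_orth_proj_diff_le[of V x W] assms(3) by (meson mult_right_mono norm_ge_zero order_trans)
  have half: "norm v \<le> 2 * norm (orth_proj W v)" if "v \<in> V" for v
  proof -
    have "norm v - norm (orth_proj W v) \<le> \<rho> * norm v"
      using pd[of v] norm_triangle_ineq2[of v "orth_proj W v"] that by (simp add: orth_proj_ident)
    also have "\<dots> \<le> 1 / 2 * norm v" using assms(4) by (intro mult_right_mono) auto
    finally show ?thesis by simp
  qed
  have "inj_on (orth_proj W) (span V)"
  proof (rule inj_onI)
    fix x y assume "x \<in> span V" "y \<in> span V" "orth_proj W x = orth_proj W y"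
    then show "x = y" using half[of "x - y"] sV(1,3) by (simp only: orth_proj_diff subspace_diff) simp
  qed
  then have "dim (orth_proj W ` V) = n"
    using dim_image_eq[OF linear_orth_proj] sV by blast
  then have "orth_proj W ` V = W"
    using linear_subspace_image[OF linear_orth_proj sV(1)] sW(1,2) orth_proj_in_subspace[of W]
    by (intro subspace_dim_equal) auto
  moreover have "- orth_proj W w \<in> W"
    using sW(1) by (simp add: orth_proj_in_subspace subspace_neg)
  ultimately obtain v where v: "v \<in> V" "orth_proj W v = - orth_proj W w"
    by (metis imageE)
  have "orth_proj V w = 0" by (intro orth_proj_eq_0 w(2)) (simp only: sV(3))
  with pd[of w] w have "norm (orth_proj W w) \<le> \<rho>" by simp
  with half[OF v(1)] v have "norm v \<le> 2 * \<rho>" by simp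
  with v show ?thesis by (intro that[of v]) (auto simp: orth_proj_add)
qed

section \<open>Orthonormal coordinates and grids in a subspace\<close>

lemma orthonormal_basis_representation:
  fixes B :: "'a::euclidean_space set"
  assumes B: "pairwise orthogonal B" "\<And>b. b \<in> B \<Longrightarrow> norm b = 1" and v: "v \<in> span B"
  shows "v = (\<Sum>b\<in>B. (v \<bullet> b) *\<^sub>R b)"
proof -
  define d where "d = v - (\<Sum>b\<in>B. (b \<bullet> v / (b \<bullet> b)) *\<^sub>R b)"
  have "d \<in> span B"
    using v unfolding d_def by (intro span_diff span_sum span_scale) (auto intro: span_base)
  then have "orthogonal d d"
    using Gram_Schmidt_step[OF B(1), of d v] by (simp add: d_def orthogonal_commute)
  then have "v = (\<Sum>b\<in>B. (b \<bullet> v / (b \<bullet> b)) *\<^sub>R b)"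
    by (simp add: orthogonal_self d_def)
  also have "\<dots> = (\<Sum>b\<in>B. (v \<bullet> b) *\<^sub>R b)"
    by (intro sum.cong refl) (simp add: dot_square_norm B(2) inner_commute)
  finally show ?thesis .
qed

text \<open>The net is a grid of mesh R / k in orthonormal coordinates, and each coordinate is
  rounded down. Its cardinality grows like k^n with n the dimension of P, not of the ambient space;
  both applications need exactly this exponent.\<close>

lemma subspace_net:
  fixes P :: "'a::euclidean_space set"
  assumes P: "subspace P" "dim P = n" and "0 \<le> R" and k: "1 \<le> k"
  obtains N where "finite N" "N \<subseteq> P" "card N \<le> (2 * k + 1) ^ n"
    "\<And>v. v \<in> P \<Longrightarrow> norm v \<le> R \<Longrightarrow> \<exists>u\<in>N. norm (v - u) \<le> real n * R / real k"
proof -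
  obtain B where B: "B \<subseteq> P" "pairwise orthogonal B" "\<And>x. x \<in> B \<Longrightarrow> norm x = 1"
      "independent B" "card B = n" "span B = P"
    using orthonormal_basis_subspace[OF P(1)] P(2) by metis
  have finB: "finite B" using B(4) independent_imp_finite by blast
  define h where "h m = (\<Sum>b\<in>B. (real_of_int (m b) * R / real k) *\<^sub>R b)" for m :: "'a \<Rightarrow> int"
  define M where "M = (B \<rightarrow>\<^sub>E {- int k..int k})"
  have finM: "finite M" unfolding M_def using finB by (intro finite_PiE) auto
  have cardM: "card M = (2 * k + 1) ^ n"
    unfolding M_def using finB B(5) by (simp add: card_PiE nat_add_distrib nat_mult_distrib algebra_simps)
  show ?thesis
  proof
    show "finite (h ` M)" using finM by simp
    show "h ` M \<subseteq> P"
      using B(1) P(1) by (auto simp: h_def intro!: subspace_sum subspace_scale)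
    show "card (h ` M) \<le> (2 * k + 1) ^ n" using card_image_le[OF finM] cardM by metis
    fix v assume v: "v \<in> P" "norm v \<le> R"
    show "\<exists>u\<in>h ` M. norm (v - u) \<le> real n * R / real k"
    \<comment> \<open>The rounding below divides by R.\<close>
    proof (cases "R = 0")
      case True
      have "h (\<lambda>b\<in>B. 0) = 0" unfolding h_def by (intro sum.neutral) auto
      moreover have "(\<lambda>b\<in>B. 0) \<in> M" by (auto simp: M_def)
      ultimately have "0 \<in> h ` M" by (metis image_eqI)
      with v True show ?thesis by (intro bexI[of _ 0]) auto
    next
      case False
      then have R: "0 < R" using assms(3) by simp
      have kpos: "0 < real k" using k by simp
      define m where "m = (\<lambda>b\<in>B. \<lfloor>(v \<bullet> b) * real k / R\<rfloor>)"
      have "m \<in> M"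
      proof -
        have "- int k \<le> \<lfloor>(v \<bullet> b) * real k / R\<rfloor> \<and> \<lfloor>(v \<bullet> b) * real k / R\<rfloor> \<le> int k" if "b \<in> B" for b
        proof -
          have "\<bar>v \<bullet> b\<bar> \<le> R" using Cauchy_Schwarz_ineq2[of v b] B(3)[OF that] v(2) by simp
          then have "\<bar>(v \<bullet> b) * real k / R\<bar> \<le> real k"
            using R kpos by (simp add: abs_mult divide_le_eq mult.commute)
          then have "- real k \<le> (v \<bullet> b) * real k / R" "(v \<bullet> b) * real k / R \<le> real k"
            by linarith+
          then show ?thesis by linarith
        qed
        then show ?thesis unfolding M_def m_def by (auto simp: PiE_def)
      qed
      moreover have "norm (v - h m) \<le> real n * R / real k"
      proof -
        have "v = (\<Sum>b\<in>B. (v \<bullet> b) *\<^sub>R b)"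
          using v(1) B by (intro orthonormal_basis_representation) auto
        then have "v - h m = (\<Sum>b\<in>B. (v \<bullet> b - real_of_int (m b) * R / real k) *\<^sub>R b)"
          by (simp add: h_def scaleR_diff_left sum_subtractf)
        also have "norm \<dots> \<le> (\<Sum>b\<in>B. R / real k)"
        proof (rule sum_norm_le)
          fix b assume b: "b \<in> B"
          define t where "t = (v \<bullet> b) * real k / R"
          have "(v \<bullet> b - real_of_int (m b) * R / real k) = (t - \<lfloor>t\<rfloor>) * (R / real k)"
            using R kpos b by (simp add: m_def t_def field_simps)
          moreover have "\<bar>t - \<lfloor>t\<rfloor>\<bar> \<le> 1" by linarith
          ultimately show "norm ((v \<bullet> b - real_of_int (m b) * R / real k) *\<^sub>R b) \<le> R / real k"
            using R kpos B(3)[OF b] mult_right_mono[of "\<bar>t - \<lfloor>t\<rfloor>\<bar>" 1 "R / real k"]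
            by (simp add: abs_mult)
        qed
        also have "\<dots> = real n * R / real k" using B(5) by simp
        finally show ?thesis .
      qed
      ultimately show ?thesis by blast
    qed
  qed
qed

section \<open>Invariant measures on the Grassmannian\<close>

lemma orth_proj_image:
  fixes T :: "'a::euclidean_space \<Rightarrow> 'a"
  assumes "orthogonal_transformation T"
  shows "orth_proj (T ` V) (T x) = T (orth_proj V x)"
proof (rule orth_proj_unique)
  have lT: "linear T" using assms by (simp add: orthogonal_transformation_def)
  then have eq: "span (T ` V) = T ` span V" by (rule linear_span_image)
  then show "T (orth_proj V x) \<in> span (T ` V)" using orth_proj_in_span by blast
  fix w assume "w \<in> span (T ` V)"
  then obtain v where "v \<in> span V" "w = T v" using eq by blast
  then show "orthogonal (T x - T (orth_proj V x)) w"
    using orth_proj_orthogonal[of v V x] assms lT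
    by (simp add: linear_diff[symmetric] orthogonal_orthogonal_transformation)
qed

lemma grassmann_dist_image:
  fixes T :: "'a::euclidean_space \<Rightarrow> 'a"
  assumes T: "orthogonal_transformation T"
  shows "grassmann_dist (T ` V) (T ` W) = grassmann_dist V W"
proof -
  have lT: "linear T" using T by (simp add: orthogonal_transformation_def)
  have nT: "norm (T x) = norm x" for x using T by (rule orthogonal_transformation_norm)
  have eq: "norm (orth_proj (T ` V) (T x) - orth_proj (T ` W) (T x)) = norm (orth_proj V x - orth_proj W x)" for x
    by (simp add: orth_proj_image[OF T] linear_diff[OF lT, symmetric] nT)
  show ?thesis
  proof (rule antisym; rule grassmann_dist_leI)
    fix x :: 'a
    obtain y where "x = T y" using orthogonal_transformation_surj[OF T] by (metis surjD)
    then show "norm (orth_proj (T ` V) x - orth_proj (T ` W) x) \<le> grassmann_dist V W * norm x"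
      by (simp add: eq nT norm_orth_proj_diff_le)
    show "norm (orth_proj V x - orth_proj W x) \<le> grassmann_dist (T ` V) (T ` W) * norm x"
      by (metis eq nT norm_orth_proj_diff_le)
  qed
qed

lemma Grassmannian_image:
  fixes T :: "'a::euclidean_space \<Rightarrow> 'a"
  assumes "orthogonal_transformation T" "V \<in> Grassmannian n"
  shows "T ` V \<in> Grassmannian n"
proof -
  have lT: "linear T" using assms(1) by (simp add: orthogonal_transformation_def)
  have "inj_on T (span V)"
    using orthogonal_transformation_inj[OF assms(1)] by (rule inj_on_subset) simp
  then have "dim (T ` V) = dim V" by (rule dim_image_eq[OF lT])
  moreover have "subspace (T ` V)" if "subspace V" using linear_subspace_image[OF lT that] .
  ultimately show ?thesis using assms(2) by (simp add: Grassmannian_def)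
qed

text \<open>An isometry from V onto W and one between the orthogonal complements, which have equal
  dimensions, are glued along the orthogonal decomposition.\<close>

lemma orthogonal_transformation_transitive_Grassmannian:
  fixes V W :: "'a::euclidean_space set"
  assumes V: "V \<in> Grassmannian n" and W: "W \<in> Grassmannian n"
  obtains T where "orthogonal_transformation T" "T ` V = W"
proof -
  have sV: "subspace V" "dim V = n" "span V = V" and sW: "subspace W" "dim W = n" "span W = W"
    using V W by (auto simp: Grassmannian_def)
  define V' where "V' = {y. \<forall>x\<in>V. orthogonal x y}"
  define W' where "W' = {y. \<forall>x\<in>W. orthogonal x y}"
  have "dim V' + dim V = DIM('a)" "dim W' + dim W = DIM('a)"
    using dim_subspace_orthogonal_to_vectors[of V UNIV] dim_subspace_orthogonal_to_vectors[of W UNIV] sV sW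
    by (simp_all add: V'_def W'_def)
  then have dim': "dim V' = dim W'" using sV sW by simp
  have sV': "subspace V'" and sW': "subspace W'"
    by (auto simp: V'_def W'_def subspace_orthogonal_to_vectors)
  obtain f where f: "linear f" "f ` V = W" "\<And>x. x \<in> V \<Longrightarrow> norm (f x) = norm x"
    using isometries_subspaces[OF sV(1) sW(1)] sV sW by metis
  obtain g where g: "linear g" "g ` V' = W'" "\<And>x. x \<in> V' \<Longrightarrow> norm (g x) = norm x"
    using isometries_subspaces[OF sV' sW' dim'] by metis
  define T where "T x = f (orth_proj V x) + g (x - orth_proj V x)" for x
  have in': "x - orth_proj V x \<in> V'" for x
    using orth_proj_orthogonal[of _ V x] sV by (auto simp: V'_def orthogonal_commute)
  have "linear T"
    unfolding T_def
    by (intro linear_compose_add linear_compose[OF linear_orth_proj f(1), unfolded o_def]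
        linear_compose[OF linear_compose_sub[OF linear_id linear_orth_proj] g(1), unfolded o_def id_def])
  moreover have "norm (T x) = norm x" for x
  proof -
    have 1: "f (orth_proj V x) \<in> W" using f(2) orth_proj_in_subspace[OF sV(1)] by blast
    have 2: "g (x - orth_proj V x) \<in> W'" using g(2) in'[of x] by auto
    have "(norm (T x))\<^sup>2 = (norm (f (orth_proj V x)))\<^sup>2 + (norm (g (x - orth_proj V x)))\<^sup>2"
      unfolding T_def using 1 2 by (intro norm_add_Pythagorean) (auto simp: W'_def)
    also have "\<dots> = (norm x)\<^sup>2"
      using f(3) g(3)[OF in'] orth_proj_in_subspace[OF sV(1)] norm_orth_proj_Pythagorean[of x V] by simp
    finally show ?thesis by (simp add: power2_eq_iff_nonneg)
  qed
  ultimately have oT: "orthogonal_transformation T" by (simp add: orthogonal_transformation)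
  have "T x = f x" if "x \<in> V" for x
    using that g(1) by (simp add: T_def orth_proj_ident linear_0)
  then have "T ` V = W" using f(2) by (simp cong: image_cong)
  with oT show ?thesis by (rule that)
qed

text \<open>After V has been carried onto W by S, the vectors S v and w are unit vectors
  perpendicular to W. The reflection that exchanges them has its normal u = S v - w perpendicular to
  W, so it fixes W pointwise.\<close>

lemma orthogonal_transformation_transitive_perpendicular:
  fixes V W :: "'a::euclidean_space set"
  assumes V: "V \<in> Grassmannian n" and W: "W \<in> Grassmannian n"
    and v: "norm v = 1" "\<And>x. x \<in> V \<Longrightarrow> x \<bullet> v = 0"
    and w: "norm w = 1" "\<And>x. x \<in> W \<Longrightarrow> x \<bullet> w = 0"
  obtains T where "orthogonal_transformation T" "T ` V = W" "T v = w"
proof -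
  obtain S where S: "orthogonal_transformation S" "S ` V = W"
    using orthogonal_transformation_transitive_Grassmannian[OF V W] .
  define u where "u = S v - w"
  \<comment> \<open>If u = 0 this is the identity, division by zero included, and nothing remains to
    be corrected.\<close>
  define R where "R x = x - (2 * (x \<bullet> u) / (u \<bullet> u)) *\<^sub>R u" for x
  have Sv: "norm (S v) = 1" using S(1) v(1) by (simp add: orthogonal_transformation_norm)
  have uW: "x \<bullet> u = 0" if "x \<in> W" for x
  proof -
    obtain y where "y \<in> V" "x = S y" using \<open>x \<in> W\<close> S(2) by blast
    then have "x \<bullet> S v = 0" using S(1) v(2) by (simp add: orthogonal_transformation_def)
    with w(2)[OF that] show ?thesis by (simp add: u_def inner_diff_right)
  qed
  have "linear R"
    by (rule linearI)
      (auto simp: R_def inner_add_left add_divide_distrib distrib_left scaleR_add_left scaleR_diff_right)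
  moreover have "norm (R x) = norm x" for x
  proof (cases "u = 0")
    case False
    have "R x \<bullet> R x = x \<bullet> x"
      using False by (simp add: R_def inner_diff_left inner_diff_right inner_commute field_simps power2_eq_square)
    then show ?thesis by (simp add: norm_eq_sqrt_inner)
  qed (simp add: R_def)
  ultimately have oR: "orthogonal_transformation R" by (simp add: orthogonal_transformation)
  have RS: "R (S v) = w"
  proof (cases "u = 0")
    case False
    have sq: "S v \<bullet> S v = 1" "w \<bullet> w = 1" using Sv w(1) by (simp_all add: dot_square_norm)
    have "u \<bullet> u = 2 * (S v \<bullet> u)"
      using sq by (simp add: u_def inner_diff_left inner_diff_right inner_commute)
    moreover have "u \<bullet> u \<noteq> 0" using False by simp
    ultimately have "2 * (S v \<bullet> u) / (u \<bullet> u) = 1" by (metis divide_self)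
    then have "R (S v) = S v - u" by (simp only: R_def scaleR_one)
    then show ?thesis by (simp add: u_def)
  qed (simp add: R_def u_def)
  have "R x = x" if "x \<in> W" for x using uW[OF that] by (simp add: R_def)
  then have "R ` W = W" by (simp cong: image_cong)
  then have "(R \<circ> S) ` V = W" using S(2) by (simp only: image_comp[symmetric])
  then show ?thesis
    using that[of "R \<circ> S"] orthogonal_transformation_compose[OF oR S(1)] RS by simp
qed

section \<open>Measurability with respect to the Borel sets of the Grassmannian\<close>

lemma openin_Grassmannian_vimage_orth_proj:
  fixes x :: "'a::euclidean_space"
  assumes "open S"
  shows "openin (Metric_space.mtopology (Grassmannian k) grassmann_dist) {V \<in> Grassmannian k. orth_proj V x \<in> S}"
proof -
  interpret Metric_space "Grassmannian k :: 'a set set" grassmann_dist by (rule Metric_space_Grassmannian)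
  show ?thesis
    unfolding openin_mtopology
  proof (intro conjI allI impI)
    fix V assume V: "V \<in> {V \<in> Grassmannian k. orth_proj V x \<in> S}"
    then obtain e where e: "0 < e" "\<And>y. dist y (orth_proj V x) < e \<Longrightarrow> y \<in> S"
      using assms unfolding open_dist by blast
    show "\<exists>r>0. mball V r \<subseteq> {V \<in> Grassmannian k. orth_proj V x \<in> S}"
    \<comment> \<open>The projection of x depends on the plane with Lipschitz constant
      \<open>norm x\<close>; the added 1 covers x = 0.\<close>
    proof (intro exI[of _ "e / (1 + norm x)"] conjI subsetI)
      show "0 < e / (1 + norm x)" using e(1) by (simp add: add_pos_nonneg)
      fix W assume W: "W \<in> mball V (e / (1 + norm x))"
      have "norm (orth_proj V x - orth_proj W x) \<le> grassmann_dist V W * norm x"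
        by (rule norm_orth_proj_diff_le)
      also have "\<dots> \<le> grassmann_dist V W * (1 + norm x)"
        by (intro mult_left_mono) auto
      also have "\<dots> < e" using W by (simp add: pos_less_divide_eq add_pos_nonneg)
      finally have "orth_proj W x \<in> S" by (intro e(2)) (simp add: dist_norm norm_minus_commute)
      with W show "W \<in> {V \<in> Grassmannian k. orth_proj V x \<in> S}" by simp
    qed
  qed auto
qed

lemma sets_grassmann_borel_openin:
  "openin (Metric_space.mtopology (Grassmannian k) grassmann_dist) U \<Longrightarrow>
    U \<in> sets (grassmann_borel k :: 'a::euclidean_space set measure)"
proof -
  interpret Metric_space "Grassmannian k :: 'a set set" grassmann_dist by (rule Metric_space_Grassmannian)
  assume "openin mtopology U"
  then show ?thesis
    unfolding grassmann_borel_def using openin_subset[of mtopology]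
    by (subst sets_measure_of) auto
qed

lemma space_grassmann_borel [simp]: "space (grassmann_borel k) = Grassmannian k"
  unfolding grassmann_borel_def by (simp add: space_measure_of_conv)

lemma grassmann_cball_sets:
  "grassmann_cball k V r \<in> sets (grassmann_borel k :: 'a::euclidean_space set measure)"
proof -
  interpret Metric_space "Grassmannian k :: 'a set set" grassmann_dist by (rule Metric_space_Grassmannian)
  have "openin mtopology (Grassmannian k - mcball V r)"
    using closedin_mcball[of V r] by (simp add: closedin_def)
  then have "space (grassmann_borel k) - (Grassmannian k - mcball V r) \<in> sets (grassmann_borel k)"
    by (intro sets.compl_sets sets_grassmann_borel_openin)
  moreover have "Grassmannian k - (Grassmannian k - mcball V r) = mcball V r"
    using mcball_subset_mspace by blast
  ultimately show ?thesis by simp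
qed

lemma orth_proj_measurable_Grassmannian:
  fixes x :: "'a::euclidean_space"
  shows "(\<lambda>V. orth_proj V x) \<in> borel_measurable (grassmann_borel k)"
proof (rule borel_measurableI)
  fix S :: "'a set" assume "open S"
  then have "{V \<in> Grassmannian k. orth_proj V x \<in> S} \<in> sets (grassmann_borel k)"
    by (intro sets_grassmann_borel_openin openin_Grassmannian_vimage_orth_proj)
  moreover have "{V \<in> Grassmannian k. orth_proj V x \<in> S} = (\<lambda>V. orth_proj V x) -` S \<inter> space (grassmann_borel k)"
    by auto
  ultimately show "(\<lambda>V. orth_proj V x) -` S \<inter> space (grassmann_borel k) \<in> sets (grassmann_borel k)"
    by simp
qed

text \<open>By linearity the projection of x is a finite sum of coordinates of x times projections
  of basis vectors, so measurability in V alone gives joint measurability. Fubini between planes and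
  pairs of points rests on this.\<close>

lemma orth_proj_pair_measurable:
  assumes "sets \<gamma> = sets (grassmann_borel k)"
  shows "(\<lambda>(V, x). orth_proj V (x :: 'a::euclidean_space)) \<in> borel_measurable (\<gamma> \<Otimes>\<^sub>M borel)"
proof -
  have m: "(\<lambda>V. orth_proj V b) \<in> borel_measurable \<gamma>" for b :: 'a
    using orth_proj_measurable_Grassmannian measurable_cong_sets[OF assms refl] by blast
  have expand: "orth_proj V x = (\<Sum>b\<in>Basis. (x \<bullet> b) *\<^sub>R orth_proj V b)" for V and x :: 'a
  proof -
    have "orth_proj V x = orth_proj V (\<Sum>b\<in>Basis. (x \<bullet> b) *\<^sub>R b)"
      by (simp only: euclidean_representation)
    also have "\<dots> = (\<Sum>b\<in>Basis. (x \<bullet> b) *\<^sub>R orth_proj V b)"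
      by (simp only: linear_sum[OF linear_orth_proj] orth_proj_scaleR)
    finally show ?thesis .
  qed
  have eq: "(\<lambda>(V, x). orth_proj V x) = (\<lambda>p. \<Sum>b\<in>Basis. (snd p \<bullet> b) *\<^sub>R orth_proj (fst p) (b :: 'a))"
    by (rule ext, subst case_prod_beta, rule expand)
  show ?thesis
    unfolding eq
    by (intro borel_measurable_sum borel_measurable_scaleR borel_measurable_inner
        measurable_compose[OF measurable_fst m] measurable_snd borel_measurable_const)
qed

section \<open>Balls and slices of the Grassmannian and lower bounds for their measure\<close>

lemma grassmann_cball_mem:
  "W \<in> grassmann_cball k V r \<longleftrightarrow> V \<in> Grassmannian k \<and> W \<in> Grassmannian k \<and> grassmann_dist V W \<le> r"
  by (rule Metric_space.in_mcball[OF Metric_space_Grassmannian])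

lemma grassmann_dist_triangle:
  "grassmann_dist U W \<le> grassmann_dist U V + grassmann_dist V (W :: 'a::euclidean_space set)"
  unfolding grassmann_dist_def
  using onorm_triangle[OF bounded_linear_orth_proj_diff[of U V] bounded_linear_orth_proj_diff[of V W]] by simp

lemma grassmann_dist_commute: "grassmann_dist U W = grassmann_dist W U"
  unfolding grassmann_dist_def onorm_def by (simp add: norm_minus_commute)

text \<open>A plane is encoded by points of a finite e-net of the unit ball that approximate the
  projections of the basis vectors. There are finitely many codes, and planes with the same code are
  close in operator norm, so one representative per code suffices.\<close>

lemma grassmann_totally_bounded:
  assumes "0 < \<rho>"
  obtains N :: "'a::euclidean_space set set" where "finite N" "N \<subseteq> Grassmannian n"
    "\<And>V. V \<in> Grassmannian n \<Longrightarrow> \<exists>W\<in>N. grassmann_dist W V \<le> \<rho>"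
proof -
  \<comment> \<open>Equal codes give an error 2 e on each basis vector, and the operator norm is
    bounded by the sum of these errors, which is \<rho>.\<close>
  define e where "e = \<rho> / (2 * real DIM('a))"
  have e: "0 < e" using assms by (simp add: e_def)
  have "compact (cball (0::'a) 1)" by simp
  then obtain K where K: "finite K" "cball (0::'a) 1 \<subseteq> (\<Union>x\<in>K. ball x e)"
  proof (rule compactE_image[of "cball (0::'a) 1" "cball 0 1" "\<lambda>x. ball x e"])
    show "cball (0::'a) 1 \<subseteq> (\<Union>x\<in>cball 0 1. ball x e)" using e by fastforce
  qed auto
  have "\<exists>y\<in>K. dist y (orth_proj V b) < e" if "b \<in> Basis" for V and b :: 'a
  proof -
    have "orth_proj V b \<in> cball 0 1" using norm_orth_proj_le[of V b] that by simp
    then have "orth_proj V b \<in> (\<Union>x\<in>K. ball x e)" using K(2) by blast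
    then show ?thesis by auto
  qed
  then have ex: "\<exists>y. y \<in> K \<and> dist y (orth_proj V b) < e" if "b \<in> Basis" for V and b :: 'a
    using that by blast
  define c where "c V b = (SOME y. y \<in> K \<and> dist y (orth_proj V b) < e)" for V and b :: 'a
  have c: "c V b \<in> K \<and> dist (c V b) (orth_proj V b) < e" if "b \<in> Basis" for V b
    unfolding c_def by (rule someI_ex) (rule ex[OF that])
  define F where "F V = restrict (c V) (Basis :: 'a set)" for V
  have "finite (F ` Grassmannian n)"
  proof (rule finite_subset)
    show "F ` Grassmannian n \<subseteq> Basis \<rightarrow>\<^sub>E K" using c by (auto simp: F_def)
    show "finite ((Basis :: 'a set) \<rightarrow>\<^sub>E K)" using K(1) by (intro finite_PiE) auto
  qed
  then obtain N where N: "finite N" "N \<subseteq> Grassmannian n" "F ` Grassmannian n = F ` N"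
    using finite_subset_image[of "F ` Grassmannian n" F "Grassmannian n"] by blast
  show ?thesis
  proof
    show "finite N" "N \<subseteq> Grassmannian n" by fact+
    fix V :: "'a set" assume "V \<in> Grassmannian n"
    then have "F V \<in> F ` N" using N(3) by blast
    then obtain W where W: "W \<in> N" "F W = F V" by force
    have cWV: "c W b = c V b" if "b \<in> Basis" for b
      using W(2) that unfolding F_def by (metis restrict_apply')
    have "norm (orth_proj W b - orth_proj V b) \<le> 2 * e" if "b \<in> Basis" for b
    proof -
      have "dist (c V b) (orth_proj W b) < e" "dist (c V b) (orth_proj V b) < e"
        using c[OF that, of W] c[OF that, of V] cWV[OF that] by auto
      then have "dist (orth_proj W b) (orth_proj V b) \<le> 2 * e"
        using dist_triangle3[of "orth_proj W b" "orth_proj V b" "c V b"] by linarith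
      then show ?thesis by (simp only: dist_norm)
    qed
    then have "(\<Sum>b\<in>Basis. norm (orth_proj W b - orth_proj V b)) \<le> (\<Sum>b\<in>(Basis::'a set). 2 * e)"
      by (rule sum_mono)
    also have "\<dots> = \<rho>" by (simp add: e_def)
    finally have "grassmann_dist W V \<le> \<rho>"
      unfolding grassmann_dist_def
      using onorm_componentwise[OF bounded_linear_orth_proj_diff[of W V]] by simp
    with W(1) show "\<exists>W\<in>N. grassmann_dist W V \<le> \<rho>" by blast
  qed
qed

text \<open>The section, at a pair of points with difference w, of the incidence relation between
  planes and pairs whose projections are \<delta>-close. Its measure is the weight that such a pair
  receives when the planes are integrated out first.\<close>

definition slice :: "nat \<Rightarrow> 'a::euclidean_space set \<Rightarrow> 'a \<Rightarrow> real \<Rightarrow> real \<Rightarrow> 'a set set" where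
  "slice n V w \<rho> \<delta> = {W \<in> grassmann_cball n V \<rho>. norm (orth_proj W w) \<le> \<delta>}"

lemma slice_sets: "slice n V w \<rho> \<delta> \<in> sets (grassmann_borel n)"
proof -
  note [measurable] = orth_proj_measurable_Grassmannian[of w n]
  have "grassmann_cball n V \<rho> \<inter> {W \<in> space (grassmann_borel n). norm (orth_proj W w) \<le> \<delta>} \<in> sets (grassmann_borel n)"
    by (intro sets.Int grassmann_cball_sets) measurable
  moreover have "grassmann_cball n V \<rho> \<inter> {W \<in> space (grassmann_borel n). norm (orth_proj W w) \<le> \<delta>} = slice n V w \<rho> \<delta>"
    by (auto simp: slice_def grassmann_cball_mem)
  ultimately show ?thesis by simp
qed

lemma slice_image:
  fixes T :: "'a::euclidean_space \<Rightarrow> 'a"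
  assumes T: "orthogonal_transformation T"
  shows "(`) T ` slice n V w \<rho> \<delta> = slice n (T ` V) (T w) \<rho> \<delta>"
proof -
  have sub: "(`) S ` slice n U x \<rho> \<delta> \<subseteq> slice n (S ` U) (S x) \<rho> \<delta>"
    if S: "orthogonal_transformation S" for S :: "'a \<Rightarrow> 'a" and U x
    using Grassmannian_image[OF S]
    by (auto simp: slice_def grassmann_cball_mem grassmann_dist_image[OF S] orth_proj_image[OF S]
        orthogonal_transformation_norm[OF S])
  have inv: "inv T ` T ` U = U" "T ` inv T ` U = U" "inv T (T w) = w" for U
    using orthogonal_transformation_inj[OF T] orthogonal_transformation_surj[OF T]
    by (simp_all add: image_image surj_f_inv_f inv_f_f)
  show ?thesis
  proof (rule antisym[OF sub[OF T]], rule subsetI)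
    fix W assume "W \<in> slice n (T ` V) (T w) \<rho> \<delta>"
    then have "inv T ` W \<in> slice n V w \<rho> \<delta>"
      using sub[OF orthogonal_transformation_inv[OF T], of "T ` V" "T w"] by (auto simp: inv)
    then have "T ` inv T ` W \<in> (`) T ` slice n V w \<rho> \<delta>" by blast
    then show "W \<in> (`) T ` slice n V w \<rho> \<delta>" by (simp only: inv)
  qed
qed

text \<open>Invariance and transitivity give all balls of radius \<rho> the same measure, and
  finitely many of them cover a space of measure 1.\<close>

lemma grassmann_measure_cball_lower:
  fixes \<gamma> :: "'a::euclidean_space set measure"
  assumes g: "is_grassmann_measure n \<gamma>" and "0 < \<rho>"
  obtains c where "0 < c" "\<And>V. V \<in> Grassmannian n \<Longrightarrow> c \<le> measure \<gamma> (grassmann_cball n V \<rho>)"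
proof -
  interpret prob_space \<gamma> using g by (simp add: is_grassmann_measure_def)
  have sg: "space \<gamma> = Grassmannian n" "sets \<gamma> = sets (grassmann_borel n)"
    and inv: "\<And>T A. orthogonal_transformation T \<Longrightarrow> A \<in> sets \<gamma> \<Longrightarrow> emeasure \<gamma> ((`) T ` A) = emeasure \<gamma> A"
    using g by (auto simp: is_grassmann_measure_def)
  \<comment> \<open>With w = 0 the slice condition is void, so balls inherit measurability and
    invariance from slices.\<close>
  have cb: "grassmann_cball n V \<rho> = slice n V 0 \<rho> 0" for V :: "'a set"
    by (auto simp: slice_def linear_0[OF linear_orth_proj])
  have same: "measure \<gamma> (grassmann_cball n V \<rho>) = measure \<gamma> (grassmann_cball n W \<rho>)"
    if VW: "V \<in> Grassmannian n" "W \<in> Grassmannian n" for V W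
  proof -
    obtain T where T: "orthogonal_transformation T" "T ` V = W"
      using orthogonal_transformation_transitive_Grassmannian[OF VW] .
    have "T 0 = 0" using T(1) by (simp add: orthogonal_transformation_def linear_0)
    then show ?thesis
      using inv[OF T(1), of "slice n V 0 \<rho> 0"] slice_sets[of n V 0 \<rho> 0]
      by (simp add: slice_image[OF T(1)] T(2) cb sg measure_def)
  qed
  obtain N :: "'a set set" where N: "finite N" "N \<subseteq> Grassmannian n"
    "\<And>V. V \<in> Grassmannian n \<Longrightarrow> \<exists>W\<in>N. grassmann_dist W V \<le> \<rho>"
    using grassmann_totally_bounded[OF assms(2), where n = n] by blast
  have cover: "space \<gamma> \<subseteq> (\<Union>W\<in>N. grassmann_cball n W \<rho>)"
  proof
    fix V assume "V \<in> space \<gamma>"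
    then have V: "V \<in> Grassmannian n" by (simp only: sg)
    then obtain W where "W \<in> N" "grassmann_dist W V \<le> \<rho>" using N(3) by blast
    then show "V \<in> (\<Union>W\<in>N. grassmann_cball n W \<rho>)"
      using V N(2) by (intro UN_I[of W]) (auto simp: grassmann_cball_mem)
  qed
  have "space \<gamma> \<noteq> {}" by (rule not_empty)
  then have Nne: "N \<noteq> {}" using cover by auto
  show ?thesis
  proof
    show "0 < 1 / real (card N)" using N(1) Nne by (simp add: card_gt_0_iff)
    fix V :: "'a set" assume V: "V \<in> Grassmannian n"
    have "1 = measure \<gamma> (space \<gamma>)" by (simp add: prob_space)
    also have "\<dots> \<le> measure \<gamma> (\<Union>W\<in>N. grassmann_cball n W \<rho>)"
      using cover N(1) by (intro finite_measure_mono sets.finite_UN) (auto simp: sg grassmann_cball_sets)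
    also have "\<dots> \<le> (\<Sum>W\<in>N. measure \<gamma> (grassmann_cball n W \<rho>))"
      using N(1) by (intro finite_measure_subadditive_finite) (auto simp: sg grassmann_cball_sets)
    also have "\<dots> = (\<Sum>W\<in>N. measure \<gamma> (grassmann_cball n V \<rho>))"
      using N(2) V by (intro sum.cong same) auto
    also have "\<dots> = real (card N) * measure \<gamma> (grassmann_cball n V \<rho>)" by simp
    finally show "1 / real (card N) \<le> measure \<gamma> (grassmann_cball n V \<rho>)"
      using N(1) Nne by (simp add: divide_le_eq card_gt_0_iff mult.commute)
  qed
qed

text \<open>
  Every plane \<open>U\<close> near \<open>V\<close> is perpendicular to \<open>w + v\<close> for some small \<open>v \<in> V\<close>.  Rounding \<open>v\<close> to a net
  of about \<open>\<delta>\<^sup>-\<^sup>n\<close> points covers a ball of planes by that many slices, and by invariance all of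
  them have the same measure.
\<close>

lemma slice_perpendicular_lower:
  fixes \<gamma> :: "'a::euclidean_space set measure"
  assumes g: "is_grassmann_measure n \<gamma>" and "0 < \<kappa>" "\<kappa> \<le> 1"
  obtains c where "0 < c"
    "\<And>V w \<delta>. V \<in> Grassmannian n \<Longrightarrow> norm w = 1 \<Longrightarrow> (\<And>v. v \<in> V \<Longrightarrow> v \<bullet> w = 0) \<Longrightarrow> 0 < \<delta> \<Longrightarrow> \<delta> \<le> 1
      \<Longrightarrow> c * \<delta> ^ n \<le> measure \<gamma> (slice n V w \<kappa> \<delta>)"
proof -
  interpret prob_space \<gamma> using g by (simp add: is_grassmann_measure_def)
  have sg: "space \<gamma> = Grassmannian n" "sets \<gamma> = sets (grassmann_borel n)"
    and inv: "\<And>T A. orthogonal_transformation T \<Longrightarrow> A \<in> sets \<gamma> \<Longrightarrow> emeasure \<gamma> ((`) T ` A) = emeasure \<gamma> A"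
    using g by (auto simp: is_grassmann_measure_def)
  \<comment> \<open>Chosen so that 2 \<rho> + 2 n \<rho> = \<kappa> / 32: the first term bounds the
    translation v, the second its rounding error, and \<kappa> / 32 is the size allowed in
    \<open>N'\<close>.\<close>
  define \<rho> where "\<rho> = \<kappa> / (64 * (real n + 1))"
  have \<rho>: "0 < \<rho>" using assms(2) by (simp add: \<rho>_def)
  have n\<rho>: "64 * \<rho> + 64 * (real n * \<rho>) = \<kappa>"
  proof -
    have "\<rho> * (64 * (real n + 1)) = \<kappa>"
      unfolding \<rho>_def by (rule nonzero_eq_divide_eq[THEN iffD1]) (auto simp: add_nonneg_pos)
    then show ?thesis by (simp add: algebra_simps)
  qed
  have n\<rho>0: "0 \<le> real n * \<rho>" using \<rho> by simp
  obtain c0 where c0: "0 < c0" "\<And>V. V \<in> Grassmannian n \<Longrightarrow> c0 \<le> measure \<gamma> (grassmann_cball n V \<rho>)"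
    using grassmann_measure_cball_lower[OF g \<rho>] by blast
  show ?thesis
  proof
    show "0 < c0 / 5 ^ n" using c0(1) by simp
    fix V :: "'a set" and w :: 'a and \<delta> :: real
    assume V: "V \<in> Grassmannian n" and w: "norm w = 1" and wV: "\<And>v. v \<in> V \<Longrightarrow> v \<bullet> w = 0"
      and \<delta>: "0 < \<delta>" "\<delta> \<le> 1"
    have sV: "subspace V" "dim V = n" using V by (auto simp: Grassmannian_def)
    \<comment> \<open>With k about 1 / \<delta> the rounding error is at most 2 n \<rho> \<delta>
      \<le> \<delta>, while the net has at most (2 k + 1)^n \<le> (5 / \<delta>)^n points.\<close>
    define k where "k = nat \<lceil>1 / \<delta>\<rceil>"
    have k: "1 / \<delta> \<le> real k" "real k \<le> 2 / \<delta>" "1 \<le> k"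
    proof -
      have "1 \<le> 1 / \<delta>" using \<delta> by simp
      moreover have "2 / \<delta> = 1 / \<delta> + 1 / \<delta>" by simp
      ultimately show "1 / \<delta> \<le> real k" "real k \<le> 2 / \<delta>" "1 \<le> k"
        unfolding k_def by linarith+
    qed
    obtain N where N: "finite N" "N \<subseteq> V" "card N \<le> (2 * k + 1) ^ n"
      "\<And>v. v \<in> V \<Longrightarrow> norm v \<le> 2 * \<rho> \<Longrightarrow> \<exists>u\<in>N. norm (v - u) \<le> real n * (2 * \<rho>) / real k"
      using subspace_net[OF sV, of "2 * \<rho>" k] \<rho> k(3) by (metis less_imp_le mult_pos_pos zero_less_numeral)
    \<comment> \<open>Only small u are kept: for them w + u is still almost perpendicular to V, so
      that a plane near V perpendicular to w + u exists. The points used for rounding satisfy this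
      bound.\<close>
    define N' where "N' = {u \<in> N. norm u \<le> \<kappa> / 32}"
    have w': "1 \<le> norm (w + u)" "norm (orth_proj V (w + u)) = norm u" if "u \<in> V" for u
    proof -
      have "orthogonal w u" using wV[OF that] by (simp add: orthogonal_def inner_commute)
      from norm_add_Pythagorean[OF this] show "1 \<le> norm (w + u)"
        using w by (intro power2_le_imp_le[of 1]) auto
      have "orth_proj V (w + u) = u"
        using that wV by (intro orth_proj_unique) (auto simp: span_base orthogonal_def inner_commute sV span_eq_iff[THEN iffD2])
      then show "norm (orth_proj V (w + u)) = norm u" by simp
    qed
    have "\<exists>W. W \<in> Grassmannian n \<and> (\<forall>v\<in>W. v \<bullet> (w + u) = 0) \<and> grassmann_dist V W \<le> \<kappa> / 8"
      if "u \<in> N'" for u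
    proof -
      have u: "u \<in> V" "norm u \<le> \<kappa> / 32" using that N(2) by (auto simp: N'_def)
      have "\<kappa> / 32 * 1 \<le> \<kappa> / 32 * norm (w + u)"
        using w'(1)[OF u(1)] assms(2) by (intro mult_left_mono) auto
      then have "norm (orth_proj V (w + u)) \<le> \<kappa> / 32 * norm (w + u)"
        unfolding w'(2)[OF u(1)] using u(2) by linarith
      moreover have "w + u \<noteq> 0" using w'(1)[OF u(1)] by auto
      ultimately obtain W where "W \<in> Grassmannian n" "\<And>v. v \<in> W \<Longrightarrow> v \<bullet> (w + u) = 0"
          "grassmann_dist V W \<le> 4 * (\<kappa> / 32)"
        using exists_near_perpendicular_plane[OF V, of "w + u" "\<kappa> / 32"] assms(2,3) by auto
      then show ?thesis by (intro exI[of _ W]) auto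
    qed
    then obtain W where W: "\<And>u. u \<in> N' \<Longrightarrow> W u \<in> Grassmannian n"
        "\<And>u v. u \<in> N' \<Longrightarrow> v \<in> W u \<Longrightarrow> v \<bullet> (w + u) = 0"
        "\<And>u. u \<in> N' \<Longrightarrow> grassmann_dist V (W u) \<le> \<kappa> / 8"
      by metis
    define e where "e u = (1 / norm (w + u)) *\<^sub>R (w + u)" for u
    \<comment> \<open>The configuration (\<open>W u\<close>, \<open>e u\<close>) is a plane with a
      perpendicular unit vector, hence congruent to (V, w).\<close>
    have slice_eq: "measure \<gamma> (slice n (W u) (e u) \<kappa> \<delta>) = measure \<gamma> (slice n V w \<kappa> \<delta>)"
      if u: "u \<in> N'" for u
    proof -
      have "1 \<le> norm (w + u)" using w'(1) u N(2) by (auto simp: N'_def)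
      then have e1: "norm (e u) = 1" by (auto simp: e_def)
      have e0: "\<And>v. v \<in> W u \<Longrightarrow> v \<bullet> e u = 0" using W(2)[OF u] by (simp add: e_def)
      obtain T where T: "orthogonal_transformation T" "T ` V = W u" "T w = e u"
        using orthogonal_transformation_transitive_perpendicular[OF V W(1)[OF u] w wV e1 e0] by blast
      show ?thesis
        using inv[OF T(1), of "slice n V w \<kappa> \<delta>"] slice_sets[of n V w \<kappa> \<delta>]
        by (simp add: slice_image[OF T(1)] T(2,3) sg measure_def)
    qed
    have cover: "grassmann_cball n V \<rho> \<subseteq> (\<Union>u\<in>N'. slice n (W u) (e u) \<kappa> \<delta>)"
    proof
      fix U assume "U \<in> grassmann_cball n V \<rho>"
      then have U: "U \<in> Grassmannian n" "grassmann_dist V U \<le> \<rho>" by (auto simp: grassmann_cball_mem)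
      have "\<rho> \<le> 1 / 2" using n\<rho> n\<rho>0 assms(3) by linarith
      then obtain v where v: "v \<in> V" "norm v \<le> 2 * \<rho>" "orth_proj U (w + v) = 0"
        using exists_perpendicular_translate[OF V U(1) U(2) _ w wV] by blast
      obtain u where u: "u \<in> N" "norm (v - u) \<le> real n * (2 * \<rho>) / real k"
        using N(4)[OF v(1,2)] by blast
      have kpos: "0 < real k" using k(3) by simp
      have "real n * (2 * \<rho>) / real k \<le> real n * (2 * \<rho>) / (1 / \<delta>)"
        using \<rho> \<delta> kpos k(1) by (intro divide_left_mono) auto
      then have vu: "norm (v - u) \<le> 2 * (real n * \<rho>) * \<delta>" using u(2) by (simp add: ac_simps)
      also have "\<dots> \<le> 1 * \<delta>" using n\<rho> \<rho> assms(3) \<delta> by (intro mult_right_mono) auto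
      finally have vu1: "norm (v - u) \<le> \<delta>" by simp
      have "2 * (real n * \<rho>) * \<delta> \<le> 2 * (real n * \<rho>) * 1" using \<delta> n\<rho>0 by (intro mult_left_mono) auto
      then have "norm u \<le> \<kappa> / 32"
        using vu v(2) norm_triangle_ineq2[of u v] n\<rho> n\<rho>0 by (simp add: norm_minus_commute)
      then have uN: "u \<in> N'" using u(1) by (simp add: N'_def)
      have wu: "1 \<le> norm (w + u)" using w'(1) u(1) N(2) by auto
      have "grassmann_dist (W u) U \<le> \<kappa> / 8 + \<rho>"
        using grassmann_dist_triangle[of "W u" U V] W(3)[OF uN] U(2)
        by (simp add: grassmann_dist_commute[of "W u" V])
      then have 1: "U \<in> grassmann_cball n (W u) \<kappa>"
        using n\<rho> n\<rho>0 assms(2) U(1) W(1)[OF uN] by (simp add: grassmann_cball_mem)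
      have "orth_proj U (w + u) = orth_proj U (u - v)"
        using v(3) by (simp add: orth_proj_add orth_proj_diff eq_neg_iff_add_eq_0 add.commute)
      then have "norm (orth_proj U (w + u)) \<le> \<delta>"
        using norm_orth_proj_le[of U "u - v"] vu1 by (simp add: norm_minus_commute)
      also have "\<delta> \<le> \<delta> * norm (w + u)" using \<delta> wu by simp
      finally have "norm (orth_proj U (e u)) \<le> \<delta>"
        using wu \<delta> by (simp add: e_def orth_proj_scaleR divide_le_eq)
      with 1 uN show "U \<in> (\<Union>u\<in>N'. slice n (W u) (e u) \<kappa> \<delta>)" by (auto simp: slice_def)
    qed
    have finN': "finite N'" using N(1) by (simp add: N'_def)
    have "c0 \<le> measure \<gamma> (grassmann_cball n V \<rho>)" by (rule c0(2)[OF V])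
    also have "\<dots> \<le> measure \<gamma> (\<Union>u\<in>N'. slice n (W u) (e u) \<kappa> \<delta>)"
      using cover finN' by (intro finite_measure_mono sets.finite_UN) (auto simp: sg slice_sets)
    also have "\<dots> \<le> (\<Sum>u\<in>N'. measure \<gamma> (slice n (W u) (e u) \<kappa> \<delta>))"
      using finN' by (intro finite_measure_subadditive_finite) (auto simp: sg slice_sets)
    also have "\<dots> = real (card N') * measure \<gamma> (slice n V w \<kappa> \<delta>)"
      by (simp add: slice_eq)
    also have "\<dots> \<le> (5 / \<delta>) ^ n * measure \<gamma> (slice n V w \<kappa> \<delta>)"
    proof (rule mult_right_mono)
      have "card N' \<le> card N" unfolding N'_def using N(1) by (intro card_mono) auto
      then have "card N' \<le> (2 * k + 1) ^ n" using N(3) by (rule order_trans)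
      then have "real (card N') \<le> real ((2 * k + 1) ^ n)" by (rule of_nat_mono)
      also have "\<dots> = (2 * real k + 1) ^ n" by (simp add: add.commute)
      also have "\<dots> \<le> (5 / \<delta>) ^ n"
      proof (rule power_mono)
        have "1 \<le> 1 / \<delta>" using \<delta> by simp
        then show "2 * real k + 1 \<le> 5 / \<delta>" using k(2) by (simp add: field_simps)
      qed auto
      finally show "real (card N') \<le> (5 / \<delta>) ^ n" .
    qed auto
    finally show "c0 / 5 ^ n * \<delta> ^ n \<le> measure \<gamma> (slice n V w \<kappa> \<delta>)"
      using \<delta> by (simp add: power_divide field_simps)
  qed
qed

text \<open>V is replaced by a nearby plane W perpendicular to w, at distance at most k / 2. A slice
  of radius k / 2 about W lies in the slice of radius k \<le> \<kappa> about V, and rescaling makes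
  w a unit vector.\<close>

lemma slice_lower:
  fixes \<gamma> :: "'a::euclidean_space set measure"
  assumes g: "is_grassmann_measure n \<gamma>" and "0 < \<kappa>"
  obtains \<beta> c where "0 < \<beta>" "\<beta> \<le> 1" "0 < c"
    "\<And>V w \<delta>. V \<in> Grassmannian n \<Longrightarrow> norm (orth_proj V w) \<le> \<beta> * norm w \<Longrightarrow> 0 < \<delta> \<Longrightarrow> \<delta> \<le> norm w
      \<Longrightarrow> c * (\<delta> / norm w) ^ n \<le> measure \<gamma> (slice n V w \<kappa> \<delta>)"
proof -
  interpret prob_space \<gamma> using g by (simp add: is_grassmann_measure_def)
  have sg: "sets \<gamma> = sets (grassmann_borel n)"
    using g by (auto simp: is_grassmann_measure_def)
  \<comment> \<open>Truncation at 1 meets the bound on the radius in the perpendicular case and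
    keeps the aperture k / 8 below 1.\<close>
  define k where "k = min \<kappa> 1"
  have k: "0 < k" "k \<le> 1" "k \<le> \<kappa>" using assms(2) by (auto simp: k_def)
  obtain c where c: "0 < c"
    "\<And>V w \<delta>. V \<in> Grassmannian n \<Longrightarrow> norm w = 1 \<Longrightarrow> (\<And>v. v \<in> V \<Longrightarrow> v \<bullet> w = 0) \<Longrightarrow> 0 < \<delta> \<Longrightarrow> \<delta> \<le> 1
      \<Longrightarrow> c * \<delta> ^ n \<le> measure \<gamma> (slice n V w (k / 2) \<delta>)"
    using slice_perpendicular_lower[OF g, of "k / 2"] k by auto
  show ?thesis
  proof
    show "0 < k / 8" "k / 8 \<le> 1" "0 < c" using k c(1) by auto
    fix V :: "'a set" and w :: 'a and \<delta> :: real
    assume V: "V \<in> Grassmannian n" and w: "norm (orth_proj V w) \<le> k / 8 * norm w"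
      and \<delta>: "0 < \<delta>" "\<delta> \<le> norm w"
    then have w0: "w \<noteq> 0" by auto
    obtain W where W: "W \<in> Grassmannian n" "\<And>v. v \<in> W \<Longrightarrow> v \<bullet> w = 0" "grassmann_dist V W \<le> 4 * (k / 8)"
      using exists_near_perpendicular_plane[OF V w0 _ _ w] k by auto
    define e where "e = (1 / norm w) *\<^sub>R w"
    have "norm e = 1" "\<And>v. v \<in> W \<Longrightarrow> v \<bullet> e = 0" using w0 W(2) by (auto simp: e_def)
    then have "c * (\<delta> / norm w) ^ n \<le> measure \<gamma> (slice n W e (k / 2) (\<delta> / norm w))"
      using \<delta> w0 by (intro c(2) W(1)) auto
    also have "\<dots> \<le> measure \<gamma> (slice n V w \<kappa> \<delta>)"
    proof (rule finite_measure_mono)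
      show "slice n W e (k / 2) (\<delta> / norm w) \<subseteq> slice n V w \<kappa> \<delta>"
      proof
        fix U assume "U \<in> slice n W e (k / 2) (\<delta> / norm w)"
        then have U: "U \<in> Grassmannian n" "grassmann_dist W U \<le> k / 2" "norm (orth_proj U e) \<le> \<delta> / norm w"
          by (auto simp: slice_def grassmann_cball_mem)
        have "grassmann_dist V U \<le> \<kappa>"
          using grassmann_dist_triangle[of V U W] W(3) U(2) k by simp
        moreover have "norm (orth_proj U w) \<le> \<delta>"
          using U(3) w0 by (simp add: e_def orth_proj_scaleR divide_le_cancel)
        ultimately show "U \<in> slice n V w \<kappa> \<delta>" using U(1) V by (simp add: slice_def grassmann_cball_mem)
      qed
      show "slice n V w \<kappa> \<delta> \<in> sets \<gamma>" unfolding sg by (rule slice_sets)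
    qed
    finally show "c * (\<delta> / norm w) ^ n \<le> measure \<gamma> (slice n V w \<kappa> \<delta>)" .
  qed
qed

section \<open>Hausdorff measure on planes\<close>

text \<open>A finite cover becomes a sequence by appending empty sets, whose cost is 0 by
  convention.\<close>

lemma hausdorff_content_le_sum:
  fixes A :: "'a::metric_space set"
  assumes "finite I" "A \<subseteq> (\<Union>i\<in>I. U i)" "\<And>i. i \<in> I \<Longrightarrow> ediam (U i) \<le> \<delta>"
  shows "hausdorff_content n \<delta> A \<le> (\<Sum>i\<in>I. hausdorff_cost n (U i))"
proof -
  obtain h where h: "bij_betw h {0..<card I} I"
    using ex_bij_betw_nat_finite[OF assms(1)] by blast
  define W where "W k = (if k < card I then U (h k) else {})" for k
  have "A \<subseteq> (\<Union>k. W k)"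
  proof
    fix x assume "x \<in> A"
    then obtain i where i: "i \<in> I" "x \<in> U i" using assms(2) by blast
    then have "i \<in> h ` {0..<card I}" using h by (simp add: bij_betw_def)
    then obtain k where "k < card I" "h k = i" by auto
    then have "x \<in> W k" using i by (simp add: W_def)
    then show "x \<in> (\<Union>k. W k)" by blast
  qed
  moreover have "ediam (W k) \<le> \<delta>" for k
  proof (cases "k < card I")
    case True
    then have "h k \<in> I" using h by (auto simp: bij_betw_def)
    with True show ?thesis using assms(3) by (simp add: W_def)
  qed (simp add: W_def)
  ultimately have "hausdorff_content n \<delta> A \<le> (\<Sum>k. hausdorff_cost n (W k))"
    unfolding hausdorff_content_def by (intro INF_lower) auto
  also have "\<dots> = (\<Sum>k\<in>{0..<card I}. hausdorff_cost n (W k))"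
    by (rule suminf_finite) (auto simp: W_def hausdorff_cost_def)
  also have "\<dots> = (\<Sum>k\<in>{0..<card I}. hausdorff_cost n (U (h k)))"
    by (rule sum.cong) (auto simp: W_def)
  also have "\<dots> = (\<Sum>i\<in>I. hausdorff_cost n (U i))"
    by (rule sum.reindex_bij_betw[OF h])
  finally show ?thesis .
qed

lemma ediam_cball_le:
  fixes x :: "'a::metric_space"
  shows "ediam (cball x s) \<le> ennreal (2 * s)"
  unfolding ediam_def
proof (intro SUP_least ennreal_leI)
  fix y z assume "y \<in> cball x s" "z \<in> cball x s"
  then show "dist y z \<le> 2 * s" using dist_triangle3[of y z x] by simp
qed

text \<open>The grid gives at most (3 k)^n balls of diameter at most 4 n R / k. The product of
  number and cost does not depend on k, so the diameters may be made arbitrarily small. Only the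
  order R^n matters later. As z need not lie in P, the grid is centred at a point of P in the ball
  and the radius is doubled.\<close>

lemma hausdorff_outer_plane_cball:
  fixes P :: "'a::euclidean_space set"
  assumes P: "subspace P" "dim P = n" and R: "0 < R"
  shows "hausdorff_outer n (P \<inter> cball z R) \<le> ennreal (unit_ball_vol (real n) / 2 ^ n * (12 * real n) ^ n * R ^ n)"
proof (cases "P \<inter> cball z R = {}")
  case False
  then obtain p where p: "p \<in> P" "dist z p \<le> R" by auto
  show ?thesis
    unfolding hausdorff_outer_def
  proof (rule SUP_least)
    fix \<delta> :: ennreal assume "\<delta> \<in> {0<..}"
    then have \<delta>: "0 < \<delta>" by simp
    obtain d where d: "0 < d" "ennreal d \<le> \<delta>"
    proof (cases \<delta>)
      case (real r)
      with \<delta> have "0 < r" by (cases "r = 0") auto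
      with real show ?thesis by (intro that[of r]) auto
    qed (use that[of 1] in auto)
    \<comment> \<open>This makes the diameter bound 2 s = 4 n R / k at most d.\<close>
    obtain k :: nat where k: "4 * real n * R / d < real k" using reals_Archimedean2 by blast
    have k0: "0 < real k" using k d R by (intro le_less_trans[OF _ k]) auto
    then have k1: "1 \<le> k" by simp
    define s where "s = real n * (2 * R) / real k"
    have s0: "0 \<le> s" using R by (simp add: s_def)
    have sd: "2 * s \<le> d" using k k0 d(1) by (simp add: s_def field_simps)
    obtain N where N: "finite N" "N \<subseteq> P" "card N \<le> (2 * k + 1) ^ n"
      "\<And>v. v \<in> P \<Longrightarrow> norm v \<le> 2 * R \<Longrightarrow> \<exists>u\<in>N. norm (v - u) \<le> s"
      using subspace_net[OF P _ k1, of "2 * R"] R unfolding s_def by (metis less_imp_le mult_pos_pos zero_less_numeral)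
    have "hausdorff_content n \<delta> (P \<inter> cball z R) \<le> (\<Sum>u\<in>N. hausdorff_cost n (cball (p + u) s))"
    proof (rule hausdorff_content_le_sum[OF N(1)])
      show "P \<inter> cball z R \<subseteq> (\<Union>u\<in>N. cball (p + u) s)"
      proof
        fix x assume x: "x \<in> P \<inter> cball z R"
        have "x - p \<in> P" using x p P(1) by (auto intro: subspace_diff)
        moreover have "norm (x - p) \<le> 2 * R"
          using x p(2) dist_triangle3[of x p z] by (simp add: dist_norm)
        ultimately obtain u where "u \<in> N" "norm (x - p - u) \<le> s" using N(4) by blast
        then show "x \<in> (\<Union>u\<in>N. cball (p + u) s)"
          by (intro UN_I[of u]) (auto simp: dist_norm norm_minus_commute algebra_simps)
      qed
      show "ediam (cball (p + u) s) \<le> \<delta>" for u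
        using ediam_cball_le[of "p + u" s] ennreal_leI[OF sd] d(2) by (meson order_trans)
    qed
    also have "\<dots> \<le> (\<Sum>u\<in>N. ennreal (unit_ball_vol (real n) / 2 ^ n * (2 * s) ^ n))"
    proof (rule sum_mono)
      fix u
      have "hausdorff_cost n (cball (p + u) s) \<le> ennreal (unit_ball_vol (real n) / 2 ^ n) * ennreal (2 * s) ^ n"
        unfolding hausdorff_cost_def using ediam_cball_le[of "p + u" s]
        by (auto intro!: mult_left_mono power_mono)
      also have "\<dots> = ennreal (unit_ball_vol (real n) / 2 ^ n * (2 * s) ^ n)"
      proof -
        have "ennreal (2 * s) ^ n = ennreal ((2 * s) ^ n)" using s0 by (intro ennreal_power) auto
        then show ?thesis using s0 by (simp only:) (intro ennreal_mult[symmetric]; simp)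
      qed
      finally show "hausdorff_cost n (cball (p + u) s) \<le> ennreal (unit_ball_vol (real n) / 2 ^ n * (2 * s) ^ n)" .
    qed
    also have "\<dots> = ennreal (real (card N) * (unit_ball_vol (real n) / 2 ^ n * (2 * s) ^ n))"
      using s0 by (simp add: ennreal_mult ennreal_of_nat_eq_real_of_nat)
    also have "\<dots> \<le> ennreal (unit_ball_vol (real n) / 2 ^ n * (12 * real n) ^ n * R ^ n)"
    proof (rule ennreal_leI)
      have "real (card N) \<le> real ((2 * k + 1) ^ n)" using N(3) by (rule of_nat_mono)
      also have "\<dots> = (2 * real k + 1) ^ n" by (simp add: add.commute)
      also have "\<dots> \<le> (3 * real k) ^ n" using k1 by (intro power_mono) auto
      finally have "real (card N) * (2 * s) ^ n \<le> (3 * real k) ^ n * (2 * s) ^ n"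
        using s0 by (intro mult_right_mono) auto
      also have "\<dots> = (3 * real k * (2 * s)) ^ n" by (rule power_mult_distrib[symmetric])
      also have "3 * real k * (2 * s) = 12 * real n * R" using k0 by (simp add: s_def)
      finally have "real (card N) * (2 * s) ^ n \<le> (12 * real n) ^ n * R ^ n"
        by (simp add: power_mult_distrib)
      then have "unit_ball_vol (real n) / 2 ^ n * (real (card N) * (2 * s) ^ n)
          \<le> unit_ball_vol (real n) / 2 ^ n * ((12 * real n) ^ n * R ^ n)"
        by (intro mult_left_mono) auto
      then show "real (card N) * (unit_ball_vol (real n) / 2 ^ n * (2 * s) ^ n)
          \<le> unit_ball_vol (real n) / 2 ^ n * (12 * real n) ^ n * R ^ n"
        by (simp add: ac_simps)
    qed
    finally show "hausdorff_content n \<delta> (P \<inter> cball z R)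
        \<le> ennreal (unit_ball_vol (real n) / 2 ^ n * (12 * real n) ^ n * R ^ n)" .
  qed
qed simp

lemma id_measurable_hausdorff_borel:
  "A \<in> sets (hausdorff_measure n) \<Longrightarrow>
    (\<lambda>y. y) \<in> restrict_space (hausdorff_measure n) A \<rightarrow>\<^sub>M (borel :: 'a::metric_space measure)"
proof (rule measurableI)
  fix B :: "'a set"
  assume "A \<in> sets (hausdorff_measure n)" "B \<in> sets borel"
  then show "(\<lambda>y. y) -` B \<inter> space (restrict_space (hausdorff_measure n) A) \<in> sets (restrict_space (hausdorff_measure n) A)"
    by (auto simp: sets_restrict_space space_restrict_space intro!: image_eqI[of _ _ B] borel_sets_hausdorff_measure)
qed simp

lemma sets_plane_measure [simp, measurable_cong]: "sets (plane_measure n V) = sets (restrict_space borel V)"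
  by (simp add: plane_measure_def)

lemma space_plane_measure [simp]: "space (plane_measure n V) = V"
  by (simp add: plane_measure_def space_restrict_space)

lemma emeasure_plane_measure:
  fixes V :: "'a::euclidean_space set"
  assumes "V \<in> Grassmannian n" "B \<in> sets borel" "B \<subseteq> V"
  shows "emeasure (plane_measure n V) B = hausdorff_outer n B"
proof -
  have V: "V \<in> sets borel" using assms(1) by (simp add: Grassmannian_def closed_subspace)
  have "(\<lambda>y. y) \<in> restrict_space (hausdorff_measure n) V \<rightarrow>\<^sub>M restrict_space borel V"
    by (rule measurable_restrict_space2)
      (use id_measurable_hausdorff_borel[OF borel_sets_hausdorff_measure[OF V]] in \<open>auto simp: space_restrict_space\<close>)
  moreover have "B \<in> sets (restrict_space borel V)"
    using assms(2,3) V by (simp add: sets_restrict_space_iff)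
  moreover have "(\<lambda>y. y) -` B \<inter> space (restrict_space (hausdorff_measure n) V) = B"
    using assms(3) by (auto simp: space_restrict_space)
  ultimately have "emeasure (plane_measure n V) B = emeasure (restrict_space (hausdorff_measure n) V) B"
    unfolding plane_measure_def by (simp add: emeasure_distr)
  also have "\<dots> = emeasure (hausdorff_measure n) B"
    using assms(3) V by (intro emeasure_restrict_space) (auto intro: borel_sets_hausdorff_measure)
  finally show ?thesis
    using assms(2) by (simp add: emeasure_hausdorff_measure borel_sets_hausdorff_measure)
qed

lemma emeasure_plane_measure_cball:
  fixes V :: "'a::euclidean_space set"
  assumes V: "V \<in> Grassmannian n" and "0 < R"
  shows "emeasure (plane_measure n V) (V \<inter> cball z R)
    \<le> ennreal (unit_ball_vol (real n) / 2 ^ n * (12 * real n) ^ n * R ^ n)"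
proof -
  have sV: "subspace V" "dim V = n" using V by (auto simp: Grassmannian_def)
  have "V \<inter> cball z R \<in> sets borel" using closed_subspace[OF sV(1)] by auto
  then show ?thesis
    using hausdorff_outer_plane_cball[OF sV assms(2)] by (simp add: emeasure_plane_measure[OF V])
qed

lemma sigma_finite_plane_measure:
  fixes V :: "'a::euclidean_space set"
  assumes V: "V \<in> Grassmannian n"
  shows "sigma_finite_measure (plane_measure n V)"
proof
  have cV: "closed V" using V by (simp add: Grassmannian_def closed_subspace)
  let ?F = "range (\<lambda>k::nat. V \<inter> cball 0 (real (Suc k)))"
  show "\<exists>A. countable A \<and> A \<subseteq> sets (plane_measure n V) \<and> \<Union> A = space (plane_measure n V) \<and>
      (\<forall>a\<in>A. emeasure (plane_measure n V) a \<noteq> \<infinity>)"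
  proof (intro exI[of _ ?F] conjI ballI)
    show "?F \<subseteq> sets (plane_measure n V)" using cV by (auto simp: sets_restrict_space_iff)
    show "\<Union> ?F = space (plane_measure n V)"
    proof
      show "space (plane_measure n V) \<subseteq> \<Union> ?F"
      proof
        fix x assume "x \<in> space (plane_measure n V)"
        moreover obtain k :: nat where "norm x \<le> real k" using real_arch_simple by blast
        ultimately have "x \<in> V \<inter> cball 0 (real (Suc k))" by simp
        then show "x \<in> \<Union> ?F" by blast
      qed
    qed auto
    fix a assume "a \<in> ?F"
    then obtain k where "a = V \<inter> cball 0 (real (Suc k))" by blast
    then show "emeasure (plane_measure n V) a \<noteq> \<infinity>"
      using emeasure_plane_measure_cball[OF V, of "real (Suc k)" 0] by (auto simp: top_unique simp del: of_nat_Suc)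
  qed auto
qed

section \<open>Projections with square integrable density\<close>

text \<open>Projecting one variable after the other turns the measure of pairs into the double
  integral of f z * f w over pairs in V at distance at most \<delta>. After f z * f w has been
  replaced by the sum of squares, one variable is free and ranges over a ball of V, of measure at
  most K \<delta>^n. The summand 1 in K makes K visibly positive.\<close>

lemma emeasure_pair_near_projection_le:
  fixes V :: "'a::euclidean_space set"
  assumes V: "V \<in> Grassmannian n" and fin: "finite_measure \<mu>" and s\<mu>: "sets \<mu> = sets borel"
    and \<delta>: "0 < \<delta>"
  defines "K \<equiv> unit_ball_vol (real n) / 2 ^ n * (12 * real n) ^ n + 1"
  shows "emeasure (\<mu> \<Otimes>\<^sub>M \<mu>) {p \<in> space (\<mu> \<Otimes>\<^sub>M \<mu>). norm (orth_proj V (fst p - snd p)) \<le> \<delta>}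
    \<le> ennreal (2 * K * \<delta> ^ n) * L2_norm_sq (plane_measure n V) (distr \<mu> (restrict_space borel V) (orth_proj V))"
proof -
  define \<sigma> where "\<sigma> = plane_measure n V"
  define \<nu> where "\<nu> = distr \<mu> (restrict_space borel V) (orth_proj V)"
  interpret \<mu>: finite_measure \<mu> by fact
  interpret \<sigma>: sigma_finite_measure \<sigma> unfolding \<sigma>_def by (rule sigma_finite_plane_measure[OF V])
  interpret \<sigma>\<sigma>: pair_sigma_finite \<sigma> \<sigma> ..
  have sV: "subspace V" using V by (auto simp: Grassmannian_def)
  have K: "0 < K" unfolding K_def by (intro add_nonneg_pos) auto
  have K\<delta>: "0 < 2 * K * \<delta> ^ n" using K \<delta> by simp
  show ?thesis
  proof (cases "absolutely_continuous \<sigma> \<nu>")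
    case False
    \<comment> \<open>Without absolute continuity the norm is infinite by definition, and its
      coefficient is positive.\<close>
    have "ennreal (2 * K * \<delta> ^ n) * L2_norm_sq \<sigma> \<nu> = \<infinity>"
      using False K\<delta> by (simp add: L2_norm_sq_def ennreal_mult_top) (use K \<delta> in auto)
    then show ?thesis by (simp add: \<sigma>_def \<nu>_def)
  next
    case True
    define f where "f = RN_deriv \<sigma> \<nu>"
    have s\<sigma>[measurable_cong]: "sets \<sigma> = sets (restrict_space borel V)" by (simp add: \<sigma>_def)
    have s\<nu>: "sets \<nu> = sets \<sigma>" by (simp add: \<nu>_def \<sigma>_def)
    have [measurable]: "f \<in> borel_measurable \<sigma>" by (simp add: f_def)
    have \<nu>f: "density \<sigma> f = \<nu>" unfolding f_def by (rule \<sigma>.density_RN_deriv[OF True s\<nu>])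
    have pm[measurable]: "orth_proj V \<in> \<mu> \<rightarrow>\<^sub>M restrict_space borel V"
      by (rule measurable_restrict_space2)
        (use sV in \<open>auto intro: orth_proj_in_subspace simp: measurable_cong_sets[OF s\<mu> refl]\<close>)
    have idm[measurable]: "(\<lambda>y. y) \<in> \<sigma> \<rightarrow>\<^sub>M borel"
      using measurable_restrict_space1[OF measurable_ident, of borel V] measurable_cong_sets[OF s\<sigma> refl]
      by (auto simp: id_def)
    define g :: "'a \<Rightarrow> 'a \<Rightarrow> ennreal" where "g z w = (if norm (z - w) \<le> \<delta> then 1 else 0)" for z w
    have gm: "(\<lambda>(z, w). g z w) \<in> borel_measurable (borel \<Otimes>\<^sub>M borel)"
      unfolding g_def by measurable
    have gm2[measurable]: "(\<lambda>p. g (fst p) (snd p)) \<in> borel_measurable (\<sigma> \<Otimes>\<^sub>M \<sigma>)"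
    proof -
      have "(\<lambda>p. (fst p, snd p)) \<in> \<sigma> \<Otimes>\<^sub>M \<sigma> \<rightarrow>\<^sub>M borel \<Otimes>\<^sub>M borel"
        by (intro measurable_Pair measurable_compose[OF measurable_fst idm] measurable_compose[OF measurable_snd idm])
      from measurable_compose[OF this gm] show ?thesis by simp
    qed
    have gz: "g z \<in> borel_measurable \<sigma>" if "z \<in> V" for z
      using measurable_compose[OF measurable_Pair1'[of z \<sigma> \<sigma>] gm2] that by (simp add: \<sigma>_def)
    have gcomm: "g z w = g w z" for z w by (simp add: g_def norm_minus_commute)
    have [measurable]: "(\<lambda>p. g (snd p) (fst p)) \<in> borel_measurable (\<sigma> \<Otimes>\<^sub>M \<sigma>)"
    proof -
      have "(\<lambda>p. g (snd p) (fst p)) = (\<lambda>p. g (fst p) (snd p))" by (rule ext) (rule gcomm)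
      with gm2 show ?thesis by simp
    qed
    have gint: "(\<integral>\<^sup>+ w. g z w \<partial>\<sigma>) \<le> ennreal (K * \<delta> ^ n)" for z
    proof -
      have "(\<integral>\<^sup>+ w. g z w \<partial>\<sigma>) = (\<integral>\<^sup>+ w. indicator (V \<inter> cball z \<delta>) w \<partial>\<sigma>)"
        by (rule nn_integral_cong) (auto simp: g_def \<sigma>_def indicator_def dist_norm)
      also have "\<dots> = emeasure \<sigma> (V \<inter> cball z \<delta>)"
        using closed_subspace[OF sV] by (intro nn_integral_indicator) (auto simp: \<sigma>_def sets_restrict_space_iff)
      also have "\<dots> \<le> ennreal (unit_ball_vol (real n) / 2 ^ n * (12 * real n) ^ n * \<delta> ^ n)"
        unfolding \<sigma>_def by (rule emeasure_plane_measure_cball[OF V \<delta>])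
      also have "\<dots> \<le> ennreal (K * \<delta> ^ n)"
        unfolding K_def using \<delta> by (intro ennreal_leI mult_right_mono) auto
      finally show ?thesis .
    qed
    define D where "D = {p \<in> space (\<mu> \<Otimes>\<^sub>M \<mu>). norm (orth_proj V (fst p - snd p)) \<le> \<delta>}"
    have Dm: "D \<in> sets (\<mu> \<Otimes>\<^sub>M \<mu>)"
    proof -
      have "(\<lambda>p. fst p - snd p) \<in> borel_measurable (\<mu> \<Otimes>\<^sub>M \<mu>)"
        using s\<mu> by (intro borel_measurable_diff) (auto simp: measurable_cong_sets[OF refl s\<mu>, symmetric])
      then show ?thesis unfolding D_def by measurable
    qed
    have "emeasure (\<mu> \<Otimes>\<^sub>M \<mu>) D = (\<integral>\<^sup>+ x. \<integral>\<^sup>+ y. indicator D (x, y) \<partial>\<mu> \<partial>\<mu>)"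
      using \<mu>.emeasure_pair_measure[OF Dm] .
    also have "\<dots> = (\<integral>\<^sup>+ x. \<integral>\<^sup>+ y. g (orth_proj V x) (orth_proj V y) \<partial>\<mu> \<partial>\<mu>)"
      by (intro nn_integral_cong) (auto simp: D_def g_def space_pair_measure orth_proj_diff)
    also have "\<dots> = (\<integral>\<^sup>+ x. \<integral>\<^sup>+ w. g (orth_proj V x) w \<partial>\<nu> \<partial>\<mu>)"
    proof (rule nn_integral_cong)
      fix x
      have "g (orth_proj V x) \<in> borel_measurable (restrict_space borel V)"
        using gz[OF orth_proj_in_subspace[OF sV]] measurable_cong_sets[OF s\<sigma> refl] by blast
      then show "(\<integral>\<^sup>+ y. g (orth_proj V x) (orth_proj V y) \<partial>\<mu>) = (\<integral>\<^sup>+ w. g (orth_proj V x) w \<partial>\<nu>)"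
        unfolding \<nu>_def by (subst nn_integral_distr[OF pm]) auto
    qed
    also have "\<dots> = (\<integral>\<^sup>+ x. \<integral>\<^sup>+ w. f w * g (orth_proj V x) w \<partial>\<sigma> \<partial>\<mu>)"
      unfolding \<nu>f[symmetric]
      by (intro nn_integral_cong nn_integral_density) (auto intro: gz orth_proj_in_subspace[OF sV])
    also have "\<dots> = (\<integral>\<^sup>+ z. \<integral>\<^sup>+ w. f w * g z w \<partial>\<sigma> \<partial>\<nu>)"
    proof -
      have m: "(\<lambda>z. \<integral>\<^sup>+ w. f w * g z w \<partial>\<sigma>) \<in> borel_measurable \<sigma>" by measurable
      then have "(\<lambda>z. \<integral>\<^sup>+ w. f w * g z w \<partial>\<sigma>) \<in> borel_measurable (restrict_space borel V)"
        using measurable_cong_sets[OF s\<sigma> refl] by blast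
      then show ?thesis unfolding \<nu>_def by (subst nn_integral_distr[OF pm]) auto
    qed
    also have "\<dots> = (\<integral>\<^sup>+ z. f z * (\<integral>\<^sup>+ w. f w * g z w \<partial>\<sigma>) \<partial>\<sigma>)"
      unfolding \<nu>f[symmetric] by (intro nn_integral_density) measurable
    also have "\<dots> = (\<integral>\<^sup>+ z. \<integral>\<^sup>+ w. f z * f w * g z w \<partial>\<sigma> \<partial>\<sigma>)"
    proof (rule nn_integral_cong)
      fix z assume "z \<in> space \<sigma>"
      then have "z \<in> V" by (simp add: \<sigma>_def)
      note [measurable] = gz[OF this]
      show "f z * (\<integral>\<^sup>+ w. f w * g z w \<partial>\<sigma>) = (\<integral>\<^sup>+ w. f z * f w * g z w \<partial>\<sigma>)"
        by (subst nn_integral_cmult[symmetric]) (measurable, simp add: mult.assoc)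
    qed
    also have "\<dots> \<le> (\<integral>\<^sup>+ z. \<integral>\<^sup>+ w. ((f z)\<^sup>2 * g z w + (f w)\<^sup>2 * g z w) \<partial>\<sigma> \<partial>\<sigma>)"
    proof (intro nn_integral_mono)
      fix z w
      have "f z * f w \<le> (f z)\<^sup>2 + (f w)\<^sup>2"
      proof (cases "f z \<le> f w")
        case True
        then have "f z * f w \<le> (f w)\<^sup>2" by (simp add: power2_eq_square mult_right_mono)
        then show ?thesis by (rule order_trans) simp
      next
        case False
        then have "f z * f w \<le> (f z)\<^sup>2" by (simp add: power2_eq_square mult_left_mono)
        then show ?thesis by (rule order_trans) simp
      qed
      then show "f z * f w * g z w \<le> (f z)\<^sup>2 * g z w + (f w)\<^sup>2 * g z w"
        by (metis distrib_right mult_right_mono zero_le)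
    qed
    also have "\<dots> = (\<integral>\<^sup>+ z. \<integral>\<^sup>+ w. (f z)\<^sup>2 * g z w \<partial>\<sigma> \<partial>\<sigma>) + (\<integral>\<^sup>+ z. \<integral>\<^sup>+ w. (f w)\<^sup>2 * g z w \<partial>\<sigma> \<partial>\<sigma>)"
    proof -
      have "(\<integral>\<^sup>+ w. ((f z)\<^sup>2 * g z w + (f w)\<^sup>2 * g z w) \<partial>\<sigma>)
          = (\<integral>\<^sup>+ w. (f z)\<^sup>2 * g z w \<partial>\<sigma>) + (\<integral>\<^sup>+ w. (f w)\<^sup>2 * g z w \<partial>\<sigma>)" if "z \<in> space \<sigma>" for z
      proof -
        note [measurable] = gz[of z]
        have "z \<in> V" using that by (simp add: \<sigma>_def)
        then show ?thesis by (intro nn_integral_add) measurable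
      qed
      then have "(\<integral>\<^sup>+ z. \<integral>\<^sup>+ w. ((f z)\<^sup>2 * g z w + (f w)\<^sup>2 * g z w) \<partial>\<sigma> \<partial>\<sigma>)
          = (\<integral>\<^sup>+ z. (\<integral>\<^sup>+ w. (f z)\<^sup>2 * g z w \<partial>\<sigma>) + (\<integral>\<^sup>+ w. (f w)\<^sup>2 * g z w \<partial>\<sigma>) \<partial>\<sigma>)"
        by (rule nn_integral_cong)
      also have "\<dots> = (\<integral>\<^sup>+ z. \<integral>\<^sup>+ w. (f z)\<^sup>2 * g z w \<partial>\<sigma> \<partial>\<sigma>) + (\<integral>\<^sup>+ z. \<integral>\<^sup>+ w. (f w)\<^sup>2 * g z w \<partial>\<sigma> \<partial>\<sigma>)"
        by (rule nn_integral_add) measurable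
      finally show ?thesis .
    qed
    \<comment> \<open>The two squares contribute equally: the integrals are exchanged and the kernel
      g is symmetric.\<close>
    also have "(\<integral>\<^sup>+ z. \<integral>\<^sup>+ w. (f w)\<^sup>2 * g z w \<partial>\<sigma> \<partial>\<sigma>) = (\<integral>\<^sup>+ w. \<integral>\<^sup>+ z. (f w)\<^sup>2 * g z w \<partial>\<sigma> \<partial>\<sigma>)"
      by (rule \<sigma>\<sigma>.Fubini') measurable
    also have "(\<integral>\<^sup>+ w. \<integral>\<^sup>+ z. (f w)\<^sup>2 * g z w \<partial>\<sigma> \<partial>\<sigma>) = (\<integral>\<^sup>+ z. \<integral>\<^sup>+ w. (f z)\<^sup>2 * g z w \<partial>\<sigma> \<partial>\<sigma>)"
      by (subst gcomm) (rule refl)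
    finally have le: "emeasure (\<mu> \<Otimes>\<^sub>M \<mu>) D \<le> 2 * (\<integral>\<^sup>+ z. \<integral>\<^sup>+ w. (f z)\<^sup>2 * g z w \<partial>\<sigma> \<partial>\<sigma>)"
      by (simp only: mult_2)
    have "(\<integral>\<^sup>+ z. \<integral>\<^sup>+ w. (f z)\<^sup>2 * g z w \<partial>\<sigma> \<partial>\<sigma>) \<le> (\<integral>\<^sup>+ z. ennreal (K * \<delta> ^ n) * (f z)\<^sup>2 \<partial>\<sigma>)"
    proof (rule nn_integral_mono)
      fix z assume "z \<in> space \<sigma>"
      then have "z \<in> V" by (simp add: \<sigma>_def)
      then have "(\<integral>\<^sup>+ w. (f z)\<^sup>2 * g z w \<partial>\<sigma>) = (f z)\<^sup>2 * (\<integral>\<^sup>+ w. g z w \<partial>\<sigma>)"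
        by (intro nn_integral_cmult gz)
      also have "\<dots> \<le> (f z)\<^sup>2 * ennreal (K * \<delta> ^ n)" by (intro mult_left_mono gint) auto
      finally show "(\<integral>\<^sup>+ w. (f z)\<^sup>2 * g z w \<partial>\<sigma>) \<le> ennreal (K * \<delta> ^ n) * (f z)\<^sup>2"
        by (simp add: mult.commute)
    qed
    also have "\<dots> = ennreal (K * \<delta> ^ n) * L2_norm_sq \<sigma> \<nu>"
      using True by (simp add: nn_integral_cmult L2_norm_sq_def f_def)
    finally have "emeasure (\<mu> \<Otimes>\<^sub>M \<mu>) D \<le> 2 * (ennreal (K * \<delta> ^ n) * L2_norm_sq \<sigma> \<nu>)"
      using le by (meson mult_left_mono order_trans zero_le)
    also have "2 * (ennreal (K * \<delta> ^ n) * L2_norm_sq \<sigma> \<nu>) = ennreal (2 * K * \<delta> ^ n) * L2_norm_sq \<sigma> \<nu>"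
      using K \<delta> by (simp add: ennreal_mult mult.assoc)
    finally show ?thesis unfolding D_def \<sigma>_def \<nu>_def .
  qed
qed

section \<open>Lipschitz graphs\<close>

text \<open>The infimum formula, written for a function on S that is Lipschitz as a function of the
  projected point. The hypothesis forces f to agree at points with the same image, so no inverse of
  \<pi> is needed.\<close>

lemma McShane_extension:
  fixes f :: "'b \<Rightarrow> real" and \<pi> :: "'b \<Rightarrow> 'a::metric_space"
  assumes "0 \<le> L" and f: "\<And>x y. x \<in> S \<Longrightarrow> y \<in> S \<Longrightarrow> \<bar>f x - f y\<bar> \<le> L * dist (\<pi> x) (\<pi> y)"
  obtains g where "\<And>p q. \<bar>g p - g q\<bar> \<le> L * dist p q" "\<And>x. x \<in> S \<Longrightarrow> g (\<pi> x) = f x"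
proof (cases "S = {}")
  case True
  then show ?thesis using assms(1) by (intro that[of "\<lambda>_. 0"]) auto
next
  case False
  define g where "g p = (INF x\<in>S. f x + L * dist p (\<pi> x))" for p
  have bdd: "bdd_below ((\<lambda>x. f x + L * dist p (\<pi> x)) ` S)" for p
  proof -
    obtain x0 where x0: "x0 \<in> S" using False by blast
    show ?thesis
    proof (rule bdd_belowI2)
      fix x assume x: "x \<in> S"
      have "f x0 - f x \<le> L * dist (\<pi> x0) (\<pi> x)" using f[OF x0 x] by simp
      also have "\<dots> \<le> L * (dist p (\<pi> x0) + dist p (\<pi> x))"
        using assms(1) by (intro mult_left_mono dist_triangle3)
      finally show "f x0 - L * dist p (\<pi> x0) \<le> f x + L * dist p (\<pi> x)" by (simp add: algebra_simps)
    qed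
  qed
  have le: "g p \<le> g q + L * dist p q" for p q
  proof -
    have "g p - L * dist p q \<le> g q"
      unfolding g_def[of q]
    proof (rule cINF_greatest[OF False])
      fix x assume x: "x \<in> S"
      have "g p \<le> f x + L * dist p (\<pi> x)" unfolding g_def by (rule cINF_lower[OF bdd x])
      also have "\<dots> \<le> f x + L * (dist p q + dist q (\<pi> x))"
        using assms(1) by (intro add_left_mono mult_left_mono dist_triangle)
      finally show "g p - L * dist p q \<le> f x + L * dist q (\<pi> x)" by (simp add: algebra_simps)
    qed
    then show ?thesis by simp
  qed
  show ?thesis
  proof
    show "\<bar>g p - g q\<bar> \<le> L * dist p q" for p q
      using le[of p q] le[of q p] by (simp add: dist_commute abs_le_iff)
    fix x assume x: "x \<in> S"
    have "g (\<pi> x) \<le> f x + L * dist (\<pi> x) (\<pi> x)" unfolding g_def by (rule cINF_lower[OF bdd x])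
    moreover have "f x \<le> g (\<pi> x)"
      unfolding g_def
    proof (rule cINF_greatest[OF False])
      show "f x \<le> f y + L * dist (\<pi> x) (\<pi> y)" if "y \<in> S" for y using f[OF x that] by simp
    qed
    ultimately show "g (\<pi> x) = f x" by simp
  qed
qed

text \<open>Outside the cone the projection onto V is injective on G with 1/\<beta>-Lipschitz
  inverse. The coordinates of the inverse are extended separately, which costs the factor
  \<open>DIM('a)\<close>.\<close>

lemma lipschitz_graph_of_cone_condition:
  fixes V G :: "'a::euclidean_space set"
  assumes V: "V \<in> Grassmannian n" and \<beta>: "0 < \<beta>"
    and G: "\<And>x y. x \<in> G \<Longrightarrow> y \<in> G \<Longrightarrow> \<beta> * norm (x - y) \<le> norm (orth_proj V (x - y))"
  obtains \<Gamma> where "lipschitz_graph n (real DIM('a) / \<beta>) \<Gamma>" "G \<subseteq> \<Gamma>"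
proof -
  have sV: "subspace V" "dim V = n" using V by (auto simp: Grassmannian_def)
  have "\<exists>g. (\<forall>p q. \<bar>g p - g q\<bar> \<le> 1 / \<beta> * dist p q) \<and> (\<forall>x\<in>G. g (orth_proj V x) = x \<bullet> b)"
    if b: "b \<in> Basis" for b :: 'a
  proof -
    have "\<bar>x \<bullet> b - y \<bullet> b\<bar> \<le> 1 / \<beta> * dist (orth_proj V x) (orth_proj V y)" if "x \<in> G" "y \<in> G" for x y
    proof -
      have "\<bar>x \<bullet> b - y \<bullet> b\<bar> \<le> norm (x - y)"
        using Basis_le_norm[OF b, of "x - y"] by (simp add: inner_diff_left)
      also have "\<dots> \<le> 1 / \<beta> * norm (orth_proj V (x - y))"
        using G[OF that] \<beta> by (simp add: field_simps)
      finally show ?thesis by (simp add: dist_norm orth_proj_diff)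
    qed
    then obtain g where "\<And>p q. \<bar>g p - g q\<bar> \<le> 1 / \<beta> * dist p q" "\<And>x. x \<in> G \<Longrightarrow> g (orth_proj V x) = x \<bullet> b"
      using McShane_extension[of "1 / \<beta>" G "\<lambda>x. x \<bullet> b" "orth_proj V"] \<beta> by auto
    then show ?thesis by blast
  qed
  then obtain g where g: "\<And>b p q. b \<in> Basis \<Longrightarrow> \<bar>g b p - g b q\<bar> \<le> 1 / \<beta> * dist p q"
      "\<And>b x. b \<in> Basis \<Longrightarrow> x \<in> G \<Longrightarrow> g b (orth_proj V x) = x \<bullet> (b :: 'a)"
    by metis
  define h where "h p = (\<Sum>b\<in>Basis. g b p *\<^sub>R (b :: 'a))" for p
  \<comment> \<open>The extension h reconstructs x from its projection only on the image of G.
    Removing its component in V puts every value in the complement, changes nothing essential on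
    that image, and does not increase the Lipschitz constant.\<close>
  define A where "A p = h p - orth_proj V (h p)" for p
  have "lipschitz_on (real DIM('a) / \<beta>) V A"
  proof (rule lipschitz_onI)
    fix p q
    have "A p - A q = (h p - h q) - orth_proj V (h p - h q)" by (simp add: A_def orth_proj_diff)
    then have "dist (A p) (A q) \<le> norm (h p - h q)"
      using norm_diff_orth_proj_le[of "h p - h q" V] by (simp only: dist_norm)
    also have "h p - h q = (\<Sum>b\<in>Basis. (g b p - g b q) *\<^sub>R b)"
      by (simp add: h_def scaleR_diff_left sum_subtractf)
    also have "norm \<dots> \<le> (\<Sum>b\<in>(Basis :: 'a set). 1 / \<beta> * dist p q)"
      by (rule sum_norm_le) (use g(1) in auto)
    also have "\<dots> = real DIM('a) / \<beta> * dist p q" by simp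
    finally show "dist (A p) (A q) \<le> real DIM('a) / \<beta> * dist p q" .
  qed (use \<beta> in simp)
  moreover have "A ` V \<subseteq> V\<^sup>\<bottom>"
    using orth_proj_orthogonal[of _ V] by (auto simp: A_def orthogonal_comp_def span_base orthogonal_commute)
  ultimately have "lipschitz_graph n (real DIM('a) / \<beta>) ((\<lambda>p. p + A p) ` V)"
    unfolding lipschitz_graph_def using sV by blast
  moreover have "G \<subseteq> (\<lambda>p. p + A p) ` V"
  proof
    fix x assume x: "x \<in> G"
    have "h (orth_proj V x) = (\<Sum>b\<in>Basis. (x \<bullet> b) *\<^sub>R b)"
      unfolding h_def using g(2)[OF _ x] by (intro sum.cong) auto
    then have "h (orth_proj V x) = x" by (simp only: euclidean_representation)
    then have "x = orth_proj V x + A (orth_proj V x)" by (simp add: A_def)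
    then show "x \<in> (\<lambda>p. p + A p) ` V" using orth_proj_in_subspace[OF sV(1)] by (rule image_eqI)
  qed
  ultimately show ?thesis by (rule that)
qed

text \<open>An orthonormal basis of P identifies P isometrically with \<open>n\<close>-dimensional
  space. The term 1 in 1 + M comes from the component p, the term M from A p.\<close>

lemma lipschitz_graph_parametrisation:
  fixes \<Gamma> :: "'a::euclidean_space set"
  assumes \<Gamma>: "lipschitz_graph n M \<Gamma>"
  obtains g where "\<And>u v. dist (g u) (g v) \<le> (1 + M) * Rn_dist n u v" "\<Gamma> \<inter> cball x r \<subseteq> g ` Rn_cball0 n r"
proof -
  obtain P A where P: "subspace P" "dim P = n" and A: "A ` P \<subseteq> P\<^sup>\<bottom>" "lipschitz_on M P A"
    and \<Gamma>_eq: "\<Gamma> = (\<lambda>p. p + A p) ` P"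
    using \<Gamma> unfolding lipschitz_graph_def by blast
  obtain B where B: "B \<subseteq> P" "pairwise orthogonal B" "\<And>x. x \<in> B \<Longrightarrow> norm x = 1"
      "independent B" "card B = n" "span B = P"
    using orthonormal_basis_subspace[OF P(1)] P(2) by metis
  have finB: "finite B" using B(4) independent_imp_finite by blast
  obtain b where b: "bij_betw b {..<n} B"
    using ex_bij_betw_nat_finite[OF finB] B(5) by (metis atLeast0LessThan)
  have bB: "b i \<in> B" if "i < n" for i using b that by (auto simp: bij_betw_def)
  define lin where "lin u = (\<Sum>i<n. u i *\<^sub>R b i)" for u :: "nat \<Rightarrow> real"
  have lin_norm: "(norm (lin u))\<^sup>2 = (\<Sum>i<n. (u i)\<^sup>2)" for u
  proof -
    have "(norm (lin u))\<^sup>2 = (\<Sum>i<n. (norm (u i *\<^sub>R b i))\<^sup>2)"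
      unfolding lin_def
    proof (rule norm_sum_Pythagorean)
      show "pairwise (\<lambda>i j. orthogonal (u i *\<^sub>R b i) (u j *\<^sub>R b j)) {..<n}"
      proof (rule pairwiseI)
        fix i j assume ij: "i \<in> {..<n}" "j \<in> {..<n}" "i \<noteq> j"
        then have "b i \<noteq> b j" using b by (auto simp: bij_betw_def inj_on_def)
        then have "orthogonal (b i) (b j)" using B(2) bB ij by (auto simp: pairwise_def)
        then show "orthogonal (u i *\<^sub>R b i) (u j *\<^sub>R b j)" by (simp add: orthogonal_def)
      qed
    qed simp
    also have "\<dots> = (\<Sum>i<n. (u i)\<^sup>2)"
      by (rule sum.cong) (auto simp: B(3)[OF bB])
    finally show ?thesis .
  qed
  have lin_dist: "dist (lin u) (lin v) = Rn_dist n u v" for u v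
  proof -
    have "lin u - lin v = lin (\<lambda>i. u i - v i)"
      by (simp add: lin_def scaleR_diff_left sum_subtractf)
    then have "(dist (lin u) (lin v))\<^sup>2 = (\<Sum>i<n. (u i - v i)\<^sup>2)" by (simp add: dist_norm lin_norm)
    then show ?thesis
      unfolding Rn_dist_def L2_set_def by (metis real_sqrt_abs abs_of_nonneg zero_le_dist)
  qed
  have lin_in: "lin u \<in> P" for u
    unfolding lin_def using bB B(1) by (intro subspace_sum[OF P(1)] subspace_scale[OF P(1)]) auto
  have lin_surj: "\<exists>u. (\<forall>i\<ge>n. u i = 0) \<and> lin u = p" if "p \<in> P" for p
  proof -
    have "p = (\<Sum>c\<in>B. (p \<bullet> c) *\<^sub>R c)"
      using that B by (intro orthonormal_basis_representation) auto
    also have "\<dots> = (\<Sum>i<n. (p \<bullet> b i) *\<^sub>R b i)"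
      by (rule sum.reindex_bij_betw[OF b, symmetric])
    finally have "lin (\<lambda>i. if i < n then p \<bullet> b i else 0) = p"
      by (simp add: lin_def)
    then show ?thesis by (intro exI[of _ "\<lambda>i. if i < n then p \<bullet> b i else 0"]) auto
  qed
  \<comment> \<open>Coordinates are centred at the projection of x. Projection does not increase
    distances, so the part of the graph within r of x has parameters of norm at most r, with no loss
    in the radius.\<close>
  define q where "q = orth_proj P x"
  have qP: "q \<in> P" using P(1) by (simp add: q_def orth_proj_in_subspace)
  define g where "g u = (q + lin u) + A (q + lin u)" for u
  show ?thesis
  proof
    fix u v
    have "q + lin u \<in> P" "q + lin v \<in> P" using qP lin_in P(1) by (auto intro: subspace_add)
    then have "dist (A (q + lin u)) (A (q + lin v)) \<le> M * dist (q + lin u) (q + lin v)"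
      using A(2) by (rule lipschitz_onD[rotated])
    moreover have "dist (q + lin u) (q + lin v) = Rn_dist n u v" by (simp add: lin_dist)
    moreover have "dist (g u) (g v) \<le> dist (q + lin u) (q + lin v) + dist (A (q + lin u)) (A (q + lin v))"
      unfolding g_def by (rule dist_triangle_add)
    ultimately show "dist (g u) (g v) \<le> (1 + M) * Rn_dist n u v" by (simp add: algebra_simps)
  next
    show "\<Gamma> \<inter> cball x r \<subseteq> g ` Rn_cball0 n r"
    proof
      fix y assume y: "y \<in> \<Gamma> \<inter> cball x r"
      then obtain p where p: "p \<in> P" "y = p + A p" using \<Gamma>_eq by blast
      have "p - q \<in> P" using p qP P(1) by (intro subspace_diff)
      then obtain u where u: "\<And>i. i \<ge> n \<Longrightarrow> u i = 0" "lin u = p - q" using lin_surj by blast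
      have "A p \<in> P\<^sup>\<bottom>" using A(1) p(1) by blast
      then have "orth_proj P (A p) = 0"
        by (intro orth_proj_eq_0) (use P(1) in \<open>auto simp: orthogonal_comp_def orthogonal_def span_eq_iff[THEN iffD2]\<close>)
      then have "p - q = orth_proj P (y - x)"
        using p by (simp add: q_def orth_proj_diff orth_proj_add orth_proj_ident)
      then have "norm (p - q) \<le> r"
        using norm_orth_proj_le[of P "y - x"] y by (simp add: dist_norm norm_minus_commute)
      moreover have "Rn_dist n (\<lambda>_. 0) u = norm (p - q)"
        using lin_dist[of "\<lambda>_. 0" u] u(2) by (simp add: lin_def[of "\<lambda>_. 0"])
      ultimately have "u \<in> Rn_cball0 n r" using u(1) by (simp add: Rn_cball0_def)
      moreover have "y = g u" using u(2) p by (simp add: g_def)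
      ultimately show "y \<in> g ` Rn_cball0 n r" by blast
    qed
  qed
qed

section \<open>Lower density of large subsets\<close>

text \<open>On a ball of low density about a point of E, \<mu> is small compared with the measure of
  E in a tenth of the ball. Vitali's lemma makes these small balls disjoint, and all of them lie in
  \<open>cball x0 (2 * r)\<close>, so their total E-measure is at most A.\<close>

lemma emeasure_low_density_le:
  fixes E E' :: "'a::euclidean_space set" and \<mu> :: "'a measure"
  assumes \<mu>: "\<And>B. B \<in> sets borel \<Longrightarrow> emeasure \<mu> B = hausdorff_outer n (E' \<inter> B)" and s\<mu>: "sets \<mu> = sets borel"
    and E': "E' \<subseteq> E \<inter> cball x0 r" and r: "0 < r" and c1: "0 < c1" and \<epsilon>: "0 \<le> \<epsilon>"
    and lower: "\<And>x s. x \<in> E \<Longrightarrow> 0 < s \<Longrightarrow> s \<le> r \<Longrightarrow> ennreal (c1 * s ^ n) \<le> hausdorff_outer n (E \<inter> cball x s)"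
    and upper: "hausdorff_outer n (E \<inter> cball x0 (2 * r)) \<le> ennreal A" and A: "0 \<le> A"
    and D: "D \<in> sets borel"
      "\<And>x. x \<in> D \<Longrightarrow> \<exists>s. 0 < s \<and> s \<le> r \<and> emeasure \<mu> (ball x s) \<le> ennreal (\<epsilon> * s ^ n)"
  shows "emeasure \<mu> D \<le> ennreal (\<epsilon> * 10 ^ n / c1 * A)"
proof -
  let ?H = "hausdorff_outer n :: 'a set \<Rightarrow> ennreal"
  obtain s where s: "\<And>x. x \<in> D \<Longrightarrow> 0 < s x \<and> s x \<le> r \<and> emeasure \<mu> (ball x (s x)) \<le> ennreal (\<epsilon> * s x ^ n)"
    using D(2) by metis
  have "E' \<inter> D \<subseteq> (\<Union>x\<in>E' \<inter> D. cball x (s x / 10))"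
  proof
    fix x assume "x \<in> E' \<inter> D"
    with s[of x] show "x \<in> (\<Union>x\<in>E' \<inter> D. cball x (s x / 10))" by (intro UN_I[of x]) auto
  qed
  \<comment> \<open>Radii s / 10 rather than s / 5: the fivefold closed balls, of radius s / 2, then
    lie inside the open balls of radius s. The centres are taken in E', where the lower regularity
    of E applies.\<close>
  then obtain C where C: "countable C" "C \<subseteq> E' \<inter> D"
    "pairwise (\<lambda>i j. disjnt (cball i (s i / 10)) (cball j (s j / 10))) C"
    "E' \<inter> D \<subseteq> (\<Union>i\<in>C. cball i (5 * (s i / 10)))"
    by (rule Vitali_covering_lemma_cballs[where B = r and a = "\<lambda>x. x" and r = "\<lambda>x. s x / 10"]) (use s r in force)+
  have finite_bound: "(\<Sum>i\<in>I. emeasure \<mu> (ball i (s i))) \<le> ennreal (\<epsilon> * 10 ^ n / c1 * A)"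
    if I: "finite I" "I \<subseteq> C" for I
  proof -
    have "(\<Sum>i\<in>I. emeasure \<mu> (ball i (s i))) \<le> (\<Sum>i\<in>I. ennreal (\<epsilon> * 10 ^ n / c1) * ?H (E \<inter> cball i (s i / 10)))"
    proof (rule sum_mono)
      fix i assume "i \<in> I"
      then have i: "i \<in> E'" "i \<in> D" using I C(2) by auto
      have "emeasure \<mu> (ball i (s i)) \<le> ennreal (\<epsilon> * s i ^ n)" using s[OF i(2)] by blast
      also have "\<epsilon> * s i ^ n = \<epsilon> * 10 ^ n / c1 * (c1 * (s i / 10) ^ n)"
        using c1 by (simp add: power_divide)
      also have "ennreal \<dots> = ennreal (\<epsilon> * 10 ^ n / c1) * ennreal (c1 * (s i / 10) ^ n)"
        using c1 \<epsilon> s[OF i(2)] by (intro ennreal_mult) auto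
      also have "\<dots> \<le> ennreal (\<epsilon> * 10 ^ n / c1) * ?H (E \<inter> cball i (s i / 10))"
        using i E' s[OF i(2)] by (intro mult_left_mono lower) auto
      finally show "emeasure \<mu> (ball i (s i)) \<le> ennreal (\<epsilon> * 10 ^ n / c1) * ?H (E \<inter> cball i (s i / 10))" .
    qed
    also have "\<dots> = ennreal (\<epsilon> * 10 ^ n / c1) * (\<Sum>i\<in>I. ?H (E \<inter> cball i (s i / 10)))"
      by (simp add: sum_distrib_left)
    also have "\<dots> \<le> ennreal (\<epsilon> * 10 ^ n / c1) * ?H (E \<inter> (\<Union>i\<in>I. cball i (s i / 10)))"
      using I C(3) by (intro mult_left_mono sum_hausdorff_outer_disjoint)
        (auto simp: disjoint_family_on_def pairwise_def disjnt_def subset_iff)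
    also have "\<dots> \<le> ennreal (\<epsilon> * 10 ^ n / c1) * ennreal A"
    proof (intro mult_left_mono order_trans[OF hausdorff_outer_mono upper])
      show "E \<inter> (\<Union>i\<in>I. cball i (s i / 10)) \<subseteq> E \<inter> cball x0 (2 * r)"
      proof
        fix y assume y: "y \<in> E \<inter> (\<Union>i\<in>I. cball i (s i / 10))"
        then obtain i where i: "i \<in> I" "dist i y \<le> s i / 10" by auto
        then have "i \<in> E'" "i \<in> D" using I C(2) by auto
        then have "dist x0 i \<le> r" "s i \<le> r" "0 < s i" using E' s[of i] by auto
        then show "y \<in> E \<inter> cball x0 (2 * r)"
          using y i(2) dist_triangle[of x0 y i] by simp
      qed
    qed auto
    also have "\<dots> = ennreal (\<epsilon> * 10 ^ n / c1 * A)"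
      using \<epsilon> c1 A by (intro ennreal_mult[symmetric]) auto
    finally show ?thesis .
  qed
  \<comment> \<open>The countable family C is turned into a sequence, with empty sets at indices
    that code no element.\<close>
  define U where "U k = (if k \<in> to_nat_on C ` C then ball (from_nat_into C k) (s (from_nat_into C k)) else {})" for k
  have Um: "U k \<in> sets \<mu>" for k by (auto simp: U_def s\<mu>)
  have "emeasure \<mu> D = ?H (E' \<inter> D)" by (rule \<mu>[OF D(1)])
  also have "\<dots> \<le> ?H (E' \<inter> (\<Union>k. U k))"
  proof (rule hausdorff_outer_mono, rule subsetI)
    fix x assume x: "x \<in> E' \<inter> D"
    then obtain i where i: "i \<in> C" "x \<in> cball i (5 * (s i / 10))" using C(4) by blast
    then have "0 < s i" using C(2) s by blast
    with i have "x \<in> U (to_nat_on C i)" using C(1) by (simp add: U_def)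
    with x show "x \<in> E' \<inter> (\<Union>k. U k)" by blast
  qed
  also have "\<dots> = emeasure \<mu> (\<Union>k. U k)" by (rule \<mu>[symmetric]) (use Um s\<mu> in auto)
  also have "\<dots> \<le> (\<Sum>k. emeasure \<mu> (U k))"
    using Um by (intro emeasure_subadditive_countably) auto
  also have "\<dots> \<le> ennreal (\<epsilon> * 10 ^ n / c1 * A)"
  proof (rule suminf_le_const)
    fix m
    define I where "I = {i \<in> C. to_nat_on C i < m}"
    have inj: "inj_on (to_nat_on C) I" using C(1) by (auto simp: I_def intro: inj_on_subset)
    have "finite (to_nat_on C ` I)" by (rule finite_subset[of _ "{..<m}"]) (auto simp: I_def)
    then have finI: "finite I" using inj by (rule finite_imageD)
    have "(\<Sum>k<m. emeasure \<mu> (U k)) = (\<Sum>k\<in>to_nat_on C ` I. emeasure \<mu> (U k))"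
      by (rule sum.mono_neutral_right) (auto simp: I_def U_def)
    also have "\<dots> = (\<Sum>i\<in>I. emeasure \<mu> (ball i (s i)))"
      by (subst sum.reindex[OF inj]) (auto simp: U_def I_def C(1) intro!: sum.cong)
    also have "\<dots> \<le> ennreal (\<epsilon> * 10 ^ n / c1 * A)"
      by (rule finite_bound[OF finI]) (auto simp: I_def)
    finally show "(\<Sum>k<m. emeasure \<mu> (U k)) \<le> ennreal (\<epsilon> * 10 ^ n / c1 * A)" .
  qed auto
  finally show ?thesis .
qed

lemma emeasure_ball_measurable:
  fixes \<mu> :: "'a::euclidean_space measure"
  assumes "finite_measure \<mu>" "sets \<mu> = sets borel"
  shows "(\<lambda>x. emeasure \<mu> (ball x s)) \<in> borel_measurable borel"
proof -
  interpret finite_measure \<mu> by fact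
  have "{p \<in> space (borel \<Otimes>\<^sub>M borel). dist (fst p) (snd p) < s} \<in> sets (borel \<Otimes>\<^sub>M (borel :: 'a measure))"
    by measurable
  also have "sets (borel \<Otimes>\<^sub>M (borel :: 'a measure)) = sets (borel \<Otimes>\<^sub>M \<mu>)"
    by (intro sets_pair_measure_cong) (simp_all add: assms)
  finally have "(\<lambda>x. emeasure \<mu> (Pair x -` {p \<in> space (borel \<Otimes>\<^sub>M borel). dist (fst p) (snd p) < s})) \<in> borel_measurable borel"
    by (rule measurable_emeasure_Pair)
  moreover have "Pair x -` {p \<in> space (borel \<Otimes>\<^sub>M borel). dist (fst p) (snd p) < s} = ball x s" for x :: 'a
    by (auto simp: space_pair_measure)
  ultimately show ?thesis by simp
qed

section \<open>The conical energy\<close>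

text \<open>The cone inequality holds trivially at w = 0, so that point is excluded; the diagonal
  then carries no energy.\<close>

definition cone_kernel :: "nat \<Rightarrow> 'a::euclidean_space set \<Rightarrow> real \<Rightarrow> 'a \<Rightarrow> ennreal" where
  "cone_kernel n V \<beta> w =
     (if w \<noteq> 0 \<and> norm (orth_proj V w) \<le> \<beta> * norm w then ennreal (1 / norm w ^ n) else 0)"

lemma cone_kernel_measurable [measurable]: "cone_kernel n V \<beta> \<in> borel_measurable borel"
  unfolding cone_kernel_def by measurable

lemma borel_measurable_pair_diff:
  fixes \<mu> \<nu> :: "'a::euclidean_space measure"
  assumes "sets \<mu> = sets borel" "sets \<nu> = sets borel"
  shows "(\<lambda>p. fst p - snd p) \<in> borel_measurable (\<mu> \<Otimes>\<^sub>M \<nu>)"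
proof -
  have "(\<lambda>x. x) \<in> \<mu> \<rightarrow>\<^sub>M borel" "(\<lambda>x. x) \<in> \<nu> \<rightarrow>\<^sub>M borel"
    using assms by (auto simp: measurable_cong_sets[OF assms(1) refl] measurable_cong_sets[OF assms(2) refl])
  then show ?thesis
    by (intro borel_measurable_diff measurable_compose[OF measurable_fst] measurable_compose[OF measurable_snd])
qed

text \<open>Double counting of planes V near V0 and pairs whose projections to V are \<delta>-close.
  With the planes integrated first, a pair in the cone receives at least c \<delta>^n times its
  kernel; with the pairs integrated first, V receives at most 2 K \<delta>^n times the squared norm.
  The powers of \<delta> cancel. The slice bound requires \<delta> \<le> |w|, hence the
  truncation.\<close>

lemma truncated_cone_energy_le:
  fixes \<gamma> :: "'a::euclidean_space set measure" and \<mu> :: "'a measure"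
  assumes g: "is_grassmann_measure n \<gamma>" and V0: "V0 \<in> Grassmannian n"
    and fin: "finite_measure \<mu>" and s\<mu>: "sets \<mu> = sets borel"
    and c: "0 < c" and \<delta>: "0 < \<delta>"
    and lower: "\<And>w. norm (orth_proj V0 w) \<le> \<beta> * norm w \<Longrightarrow> \<delta> \<le> norm w
      \<Longrightarrow> c * (\<delta> / norm w) ^ n \<le> measure \<gamma> (slice n V0 w \<kappa> \<delta>)"
  defines "K \<equiv> unit_ball_vol (real n) / 2 ^ n * (12 * real n) ^ n + 1"
  shows "(\<integral>\<^sup>+ p. (if \<delta> \<le> norm (fst p - snd p) then cone_kernel n V0 \<beta> (fst p - snd p) else 0) \<partial>(\<mu> \<Otimes>\<^sub>M \<mu>))
    \<le> ennreal (2 * K / c) * (\<integral>\<^sup>+ V \<in> grassmann_cball n V0 \<kappa>.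
        L2_norm_sq (plane_measure n V) (distr \<mu> (restrict_space borel V) (orth_proj V)) \<partial>\<gamma>)"
    (is "?A \<le> ennreal (2 * K / c) * ?I")
proof -
  interpret \<gamma>: prob_space \<gamma> using g by (simp add: is_grassmann_measure_def)
  have sg: "space \<gamma> = Grassmannian n" "sets \<gamma> = sets (grassmann_borel n)"
    using g by (auto simp: is_grassmann_measure_def)
  interpret \<mu>: finite_measure \<mu> by fact
  define P where "P = \<mu> \<Otimes>\<^sub>M \<mu>"
  interpret P: finite_measure P unfolding P_def by (rule finite_measure_pair_measure) fact+
  interpret \<gamma>P: pair_sigma_finite \<gamma> P ..
  have K: "0 < K" unfolding K_def by (intro add_nonneg_pos) auto
  have K\<delta>: "0 < 2 * K * \<delta> ^ n" using K \<delta> by simp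
  have c\<delta>: "0 < c * \<delta> ^ n" using c \<delta> by simp
  have dm[measurable]: "(\<lambda>p. fst p - snd p) \<in> borel_measurable P"
    unfolding P_def by (rule borel_measurable_pair_diff[OF s\<mu> s\<mu>])
  have [measurable]: "grassmann_cball n V0 \<kappa> \<in> sets \<gamma>" unfolding sg by (rule grassmann_cball_sets)
  have om[measurable]: "(\<lambda>q. orth_proj (fst q) (fst (snd q) - snd (snd q))) \<in> borel_measurable (\<gamma> \<Otimes>\<^sub>M P)"
  proof -
    have "(\<lambda>q. (fst q, fst (snd q) - snd (snd q))) \<in> \<gamma> \<Otimes>\<^sub>M P \<rightarrow>\<^sub>M \<gamma> \<Otimes>\<^sub>M borel"
      by (intro measurable_Pair measurable_fst measurable_compose[OF measurable_snd dm])
    from measurable_compose[OF this orth_proj_pair_measurable[OF sg(2)]] show ?thesis by simp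
  qed
  define k :: "'a set \<Rightarrow> 'a \<times> 'a \<Rightarrow> ennreal"
    where "k V p = (if norm (orth_proj V (fst p - snd p)) \<le> \<delta> then indicator (grassmann_cball n V0 \<kappa>) V else 0)" for V p
  have km[measurable]: "(\<lambda>q. k (fst q) (snd q)) \<in> borel_measurable (\<gamma> \<Otimes>\<^sub>M P)"
    unfolding k_def by measurable
  define m where "m V = (\<integral>\<^sup>+ p. k V p \<partial>P)" for V
  have mm[measurable]: "m \<in> borel_measurable \<gamma>" unfolding m_def by measurable
  have "ennreal (c * \<delta> ^ n) * ?A = (\<integral>\<^sup>+ p. ennreal (c * \<delta> ^ n) * (if \<delta> \<le> norm (fst p - snd p) then cone_kernel n V0 \<beta> (fst p - snd p) else 0) \<partial>P)"
    unfolding P_def[symmetric] by (rule nn_integral_cmult[symmetric]) measurable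
  also have "\<dots> \<le> (\<integral>\<^sup>+ p. \<integral>\<^sup>+ V. k V p \<partial>\<gamma> \<partial>P)"
  proof (rule nn_integral_mono)
    fix p :: "'a \<times> 'a"
    define w where "w = fst p - snd p"
    have sl: "slice n V0 w \<kappa> \<delta> \<in> sets \<gamma>" unfolding sg by (rule slice_sets)
    have "(\<integral>\<^sup>+ V. k V p \<partial>\<gamma>) = (\<integral>\<^sup>+ V. indicator (slice n V0 w \<kappa> \<delta>) V \<partial>\<gamma>)"
      by (rule nn_integral_cong) (auto simp: k_def slice_def w_def indicator_def)
    also have "\<dots> = ennreal (measure \<gamma> (slice n V0 w \<kappa> \<delta>))"
      using sl by (simp add: \<gamma>.emeasure_eq_measure)
    finally have eq: "(\<integral>\<^sup>+ V. k V p \<partial>\<gamma>) = ennreal (measure \<gamma> (slice n V0 w \<kappa> \<delta>))" .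
    show "ennreal (c * \<delta> ^ n) * (if \<delta> \<le> norm (fst p - snd p) then cone_kernel n V0 \<beta> (fst p - snd p) else 0)
      \<le> (\<integral>\<^sup>+ V. k V p \<partial>\<gamma>)"
    proof (cases "\<delta> \<le> norm w \<and> norm (orth_proj V0 w) \<le> \<beta> * norm w")
      case True
      then have "w \<noteq> 0" using \<delta> by auto
      have "ennreal (c * \<delta> ^ n) * cone_kernel n V0 \<beta> w = ennreal (c * (\<delta> / norm w) ^ n)"
        using True \<open>w \<noteq> 0\<close> c\<delta> by (simp add: cone_kernel_def ennreal_mult[symmetric] power_divide)
      also have "\<dots> \<le> ennreal (measure \<gamma> (slice n V0 w \<kappa> \<delta>))"
        using True by (intro ennreal_leI lower) auto
      finally show ?thesis using True by (simp add: eq w_def[symmetric])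
    next
      case False
      then show ?thesis by (auto simp: cone_kernel_def w_def[symmetric])
    qed
  qed
  also have "\<dots> = (\<integral>\<^sup>+ V. m V \<partial>\<gamma>)"
    unfolding m_def by (rule \<gamma>P.Fubini') (use km in \<open>simp add: case_prod_beta'\<close>)
  finally have 1: "ennreal (c * \<delta> ^ n) * ?A \<le> (\<integral>\<^sup>+ V. m V \<partial>\<gamma>)" .
  \<comment> \<open>The constant is moved to the side of \<open>m\<close>, which is measurable. The
    squared norm, not shown to depend measurably on V, then enters only through a pointwise
    comparison.\<close>
  have "ennreal (1 / (2 * K * \<delta> ^ n)) * (\<integral>\<^sup>+ V. m V \<partial>\<gamma>) = (\<integral>\<^sup>+ V. ennreal (1 / (2 * K * \<delta> ^ n)) * m V \<partial>\<gamma>)"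
    by (rule nn_integral_cmult[symmetric]) measurable
  also have "\<dots> \<le> ?I"
  proof (rule nn_integral_mono)
    fix V assume "V \<in> space \<gamma>"
    then have V: "V \<in> Grassmannian n" by (simp add: sg)
    let ?L = "L2_norm_sq (plane_measure n V) (distr \<mu> (restrict_space borel V) (orth_proj V))"
    show "ennreal (1 / (2 * K * \<delta> ^ n)) * m V \<le> ?L * indicator (grassmann_cball n V0 \<kappa>) V"
    proof (cases "V \<in> grassmann_cball n V0 \<kappa>")
      case True
      let ?D = "{p \<in> space P. norm (orth_proj V (fst p - snd p)) \<le> \<delta>}"
      have "m V = (\<integral>\<^sup>+ p. indicator ?D p \<partial>P)"
        unfolding m_def using True by (intro nn_integral_cong) (auto simp: k_def indicator_def)
      also have "\<dots> = emeasure P ?D" by (rule nn_integral_indicator) measurable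
      also have "\<dots> \<le> ennreal (2 * K * \<delta> ^ n) * ?L"
        unfolding P_def K_def by (rule emeasure_pair_near_projection_le[OF V fin s\<mu> \<delta>])
      finally have "ennreal (1 / (2 * K * \<delta> ^ n)) * m V \<le> ennreal (1 / (2 * K * \<delta> ^ n)) * (ennreal (2 * K * \<delta> ^ n) * ?L)"
        by (rule mult_left_mono) simp
      also have "\<dots> = ennreal (1 / (2 * K * \<delta> ^ n) * (2 * K * \<delta> ^ n)) * ?L"
        using K\<delta> by (subst ennreal_mult) (auto simp: mult.assoc)
      also have "1 / (2 * K * \<delta> ^ n) * (2 * K * \<delta> ^ n) = 1"
        using K\<delta> by (metis less_irrefl nonzero_eq_divide_eq)
      finally show ?thesis using True by simp
    next
      case False
      then have "k V p = 0" for p by (simp add: k_def)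
      then show ?thesis by (simp add: m_def)
    qed
  qed
  finally have 2: "ennreal (1 / (2 * K * \<delta> ^ n)) * (\<integral>\<^sup>+ V. m V \<partial>\<gamma>) \<le> ?I" .
  have "?A = ennreal (1 / (c * \<delta> ^ n) * (c * \<delta> ^ n)) * ?A"
  proof -
    have "1 / (c * \<delta> ^ n) * (c * \<delta> ^ n) = 1" using c\<delta> by (metis less_irrefl nonzero_eq_divide_eq)
    then show ?thesis by (simp only: ennreal_1 mult_1)
  qed
  also have "\<dots> = ennreal (1 / (c * \<delta> ^ n)) * (ennreal (c * \<delta> ^ n) * ?A)"
    using c\<delta> by (subst ennreal_mult) (auto simp: mult.assoc)
  also have "\<dots> \<le> ennreal (1 / (c * \<delta> ^ n)) * (\<integral>\<^sup>+ V. m V \<partial>\<gamma>)"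
    by (intro mult_left_mono 1) simp
  also have "ennreal (1 / (c * \<delta> ^ n)) = ennreal (2 * K / c * (1 / (2 * K * \<delta> ^ n)))"
    using K c \<delta> by (simp add: field_simps)
  also have "\<dots> = ennreal (2 * K / c) * ennreal (1 / (2 * K * \<delta> ^ n))"
    using K c K\<delta> by (intro ennreal_mult) auto
  also have "\<dots> * (\<integral>\<^sup>+ V. m V \<partial>\<gamma>) = ennreal (2 * K / c) * (ennreal (1 / (2 * K * \<delta> ^ n)) * (\<integral>\<^sup>+ V. m V \<partial>\<gamma>))"
    by (rule mult.assoc)
  also have "\<dots> \<le> ennreal (2 * K / c) * ?I" by (intro mult_left_mono 2) simp
  finally show ?thesis .
qed

text \<open>The truncated bound is uniform in \<delta>, so monotone convergence along \<delta> = 1 /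
  (k + 1) removes the truncation.\<close>

lemma cone_energy_le:
  fixes \<gamma> :: "'a::euclidean_space set measure" and \<mu> :: "'a measure"
  assumes g: "is_grassmann_measure n \<gamma>" and V0: "V0 \<in> Grassmannian n"
    and fin: "finite_measure \<mu>" and s\<mu>: "sets \<mu> = sets borel" and c: "0 < c"
    and lower: "\<And>w \<delta>. norm (orth_proj V0 w) \<le> \<beta> * norm w \<Longrightarrow> 0 < \<delta> \<Longrightarrow> \<delta> \<le> norm w
      \<Longrightarrow> c * (\<delta> / norm w) ^ n \<le> measure \<gamma> (slice n V0 w \<kappa> \<delta>)"
  defines "K \<equiv> unit_ball_vol (real n) / 2 ^ n * (12 * real n) ^ n + 1"
  shows "(\<integral>\<^sup>+ x. \<integral>\<^sup>+ y. cone_kernel n V0 \<beta> (x - y) \<partial>\<mu> \<partial>\<mu>)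
    \<le> ennreal (2 * K / c) * (\<integral>\<^sup>+ V \<in> grassmann_cball n V0 \<kappa>.
        L2_norm_sq (plane_measure n V) (distr \<mu> (restrict_space borel V) (orth_proj V)) \<partial>\<gamma>)"
    (is "_ \<le> ?R")
proof -
  interpret \<mu>: finite_measure \<mu> by fact
  interpret \<mu>\<mu>: pair_sigma_finite \<mu> \<mu> ..
  have dm[measurable]: "(\<lambda>p. fst p - snd p) \<in> borel_measurable (\<mu> \<Otimes>\<^sub>M \<mu>)"
    by (rule borel_measurable_pair_diff[OF s\<mu> s\<mu>])
  define f where "f k p = (if 1 / real (Suc k) \<le> norm (fst p - snd p) then cone_kernel n V0 \<beta> (fst p - snd p) else 0)"
    for k and p :: "'a \<times> 'a"
  have fm: "f k \<in> borel_measurable (\<mu> \<Otimes>\<^sub>M \<mu>)" for k unfolding f_def by measurable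
  have inc: "incseq f"
  proof (intro incseq_SucI le_funI)
    fix k and p :: "'a \<times> 'a"
    have "1 / real (Suc (Suc k)) \<le> 1 / real (Suc k)" by (intro divide_left_mono) auto
    then show "f k p \<le> f (Suc k) p" by (auto simp: f_def)
  qed
  have sup: "(SUP k. f k p) = cone_kernel n V0 \<beta> (fst p - snd p)" for p
  proof (rule antisym)
    show "(SUP k. f k p) \<le> cone_kernel n V0 \<beta> (fst p - snd p)" by (rule SUP_least) (simp add: f_def)
    show "cone_kernel n V0 \<beta> (fst p - snd p) \<le> (SUP k. f k p)"
    proof (cases "fst p - snd p = 0")
      case False
      then obtain k where "1 / real (Suc k) < norm (fst p - snd p)"
        using nat_approx_posE[of "norm (fst p - snd p)"] by auto
      then have "f k p = cone_kernel n V0 \<beta> (fst p - snd p)" by (simp add: f_def)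
      then show ?thesis by (metis SUP_upper UNIV_I)
    qed (simp add: cone_kernel_def)
  qed
  have "(\<integral>\<^sup>+ x. \<integral>\<^sup>+ y. cone_kernel n V0 \<beta> (x - y) \<partial>\<mu> \<partial>\<mu>) = (\<integral>\<^sup>+ p. cone_kernel n V0 \<beta> (fst p - snd p) \<partial>(\<mu> \<Otimes>\<^sub>M \<mu>))"
    by (subst \<mu>.nn_integral_fst[symmetric])
      (use measurable_compose[OF dm cone_kernel_measurable] in auto)
  also have "\<dots> = (SUP k. \<integral>\<^sup>+ p. f k p \<partial>(\<mu> \<Otimes>\<^sub>M \<mu>))"
    unfolding sup[symmetric] by (rule nn_integral_monotone_convergence_SUP[OF inc fm])
  also have "\<dots> \<le> ?R"
    unfolding f_def K_def
    by (intro SUP_least truncated_cone_energy_le[OF g V0 fin s\<mu> c] lower) auto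
  finally show ?thesis .
qed

section \<open>Bad scales\<close>

text \<open>The windows of distances overlap, so that although open they cover all distances in (0,
  2 r]. Their ratio 4 matches the gap between points of one colour.\<close>

definition bad_scale :: "'a::euclidean_space set \<Rightarrow> real \<Rightarrow> real \<Rightarrow> 'a set \<Rightarrow> nat \<Rightarrow> 'a set" where
  "bad_scale V \<beta> r F j = {x \<in> F. \<exists>y\<in>F. norm (orth_proj V (x - y)) < \<beta> / 2 * norm (x - y) \<and>
     r / 2 ^ j < norm (x - y) \<and> norm (x - y) < 4 * (r / 2 ^ j)}"

text \<open>All inequalities are strict, hence open in x for each y, so the uncountable union over y
  in F is open.\<close>

lemma bad_scale_sets:
  assumes "F \<in> sets borel"
  shows "bad_scale V \<beta> r F j \<in> sets borel"
proof -
  let ?O = "\<lambda>y. {x. norm (orth_proj V (x - y)) < \<beta> / 2 * norm (x - y) \<and>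
     r / 2 ^ j < norm (x - y) \<and> norm (x - y) < 4 * (r / 2 ^ j)}"
  have "open (?O y)" for y
    by (intro open_Collect_conj open_Collect_less continuous_intros)
  then have "open (\<Union>y\<in>F. ?O y)" by blast
  moreover have "bad_scale V \<beta> r F j = F \<inter> (\<Union>y\<in>F. ?O y)" by (auto simp: bad_scale_def)
  ultimately show ?thesis using assms by auto
qed

text \<open>Comparison with the least index i of J gives 2^(j - i) \<le> 12 < 2^4.\<close>

lemma card_dyadic_annuli_le:
  fixes r a :: real
  assumes "0 < r" "finite J" "\<And>j. j \<in> J \<Longrightarrow> r / 2 ^ j \<le> 2 * a \<and> a \<le> 6 * (r / 2 ^ j)"
  shows "card J \<le> 4"
proof (cases "J = {}")
  case False
  define i where "i = Min J"
  have i: "i \<in> J" "\<And>j. j \<in> J \<Longrightarrow> i \<le> j" using assms(2) False by (auto simp: i_def)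
  have "J \<subseteq> {i..<i + 4}"
  proof
    fix j assume j: "j \<in> J"
    have "r / 2 ^ i \<le> 2 * a" "a \<le> 6 * (r / 2 ^ j)" using assms(3) i(1) j by auto
    then have "r / 2 ^ i \<le> 12 * (r / 2 ^ j)" by simp
    moreover have "r / 2 ^ i = 2 ^ (j - i) * (r / 2 ^ j)"
      using i(2)[OF j] by (simp add: power_diff)
    ultimately have "2 ^ (j - i) * (r / 2 ^ j) \<le> 12 * (r / 2 ^ j)" by simp
    then have "(2::real) ^ (j - i) \<le> 12" using assms(1) by (subst (asm) mult_le_cancel_right) auto
    moreover have "(2::real) ^ 4 \<le> 2 ^ (j - i)" if "4 \<le> j - i" using that by (intro power_increasing) auto
    ultimately have "j - i < 4" by (cases "4 \<le> j - i") auto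
    then show "j \<in> {i..<i + 4}" using i(2)[OF j] by auto
  qed
  then have "card J \<le> card {i..<i + 4}" by (intro card_mono) auto
  then show ?thesis by simp
qed simp

text \<open>If y is a witness at scale R, the ball about y of radius s = R / 2^m \<le> \<beta> R /
  16 lies in the wider cone and in an annulus of size about R around x. Its mass forces energy at
  least e there. A point lies in at most 4 of the annuli, so e times the number of bad scales is at
  most 4 L.\<close>

lemma card_bad_scales_le:
  fixes V F :: "'a::euclidean_space set" and \<mu> :: "'a measure"
  assumes s\<mu>: "sets \<mu> = sets borel" and r: "0 < r" and \<beta>: "0 < \<beta>" "\<beta> \<le> 1" and m: "1 / 2 ^ m \<le> \<beta> / 16"
    and \<epsilon>: "0 < \<epsilon>" and L: "0 \<le> L" and x: "x \<in> F"
    and dens: "\<And>y k. y \<in> F \<Longrightarrow> ennreal (\<epsilon> * (r / 2 ^ k) ^ n) \<le> emeasure \<mu> (ball y (r / 2 ^ k))"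
    and energy: "(\<integral>\<^sup>+ y. cone_kernel n V \<beta> (x - y) \<partial>\<mu>) \<le> ennreal L"
  shows "finite {j. x \<in> bad_scale V \<beta> r F j} \<and>
    real (card {j. x \<in> bad_scale V \<beta> r F j}) \<le> 4 * L * (6 * 2 ^ m) ^ n / \<epsilon>"
proof -
  \<comment> \<open>This is the mass \<epsilon> s^n times the least kernel value 1 / (6 R)^n; the
    scale R cancels.\<close>
  define e where "e = \<epsilon> / (6 * 2 ^ m) ^ n"
  have e: "0 < e" using \<epsilon> by (simp add: e_def)
  define ann where "ann j = {z. r / 2 ^ j \<le> 2 * norm (x - z) \<and> norm (x - z) \<le> 6 * (r / 2 ^ j)}" for j
  have ann: "ann j \<in> sets \<mu>" for j
    unfolding s\<mu> ann_def by measurable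
  have km: "(\<lambda>y. cone_kernel n V \<beta> (x - y)) \<in> borel_measurable \<mu>"
    unfolding measurable_cong_sets[OF s\<mu> refl] by measurable
  have each: "ennreal e \<le> (\<integral>\<^sup>+ z. cone_kernel n V \<beta> (x - z) * indicator (ann j) z \<partial>\<mu>)"
    if j: "x \<in> bad_scale V \<beta> r F j" for j
  proof -
    define R where "R = r / 2 ^ j"
    have R: "0 < R" using r by (simp add: R_def)
    obtain y where y: "y \<in> F" "norm (orth_proj V (x - y)) < \<beta> / 2 * norm (x - y)"
      "R < norm (x - y)" "norm (x - y) < 4 * R"
      using j by (auto simp: bad_scale_def R_def)
    define s where "s = r / 2 ^ (j + m)"
    have sR: "s = R * (1 / 2 ^ m)" by (simp add: s_def R_def power_add)
    have s0: "0 < s" using r by (simp add: s_def)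
    have s1: "16 * s \<le> \<beta> * R" using mult_left_mono[OF m, of R] R by (simp add: sR mult.commute)
    also have "\<beta> * R \<le> 1 * R" using \<beta> R by (intro mult_right_mono) auto
    finally have s2: "16 * s \<le> R" by simp
    \<comment> \<open>Moving from y to z changes the difference by less than s. This keeps |x - z|
      between R / 2 and 6 R and raises the projection by an amount that the passage from aperture
      \<beta>/2 to \<beta> absorbs.\<close>
    have ball: "ennreal (1 / (6 * R) ^ n) * indicator (ball y s) z \<le> cone_kernel n V \<beta> (x - z) * indicator (ann j) z" for z
    proof (cases "z \<in> ball y s")
      case True
      then have zy: "norm (y - z) < s" by (simp add: dist_norm)
      have xyz: "x - z = (x - y) + (y - z)" by simp
      have 1: "norm (x - z) \<le> norm (x - y) + s" "norm (x - y) \<le> norm (x - z) + s"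
        using norm_triangle_ineq[of "x - y" "y - z"] norm_triangle_ineq4[of "x - z" "y - z"] zy by auto
      have lo: "R \<le> 2 * norm (x - z)" and hi: "norm (x - z) \<le> 6 * R" using 1 y(3,4) s2 R by linarith+
      have "norm (orth_proj V (x - z)) \<le> norm (orth_proj V (x - y)) + norm (orth_proj V (y - z))"
        unfolding xyz orth_proj_add by (rule norm_triangle_ineq)
      also have "\<dots> \<le> \<beta> / 2 * norm (x - y) + s"
        using y(2) norm_orth_proj_le[of V "y - z"] zy by linarith
      also have "\<dots> \<le> \<beta> / 2 * (norm (x - z) + s) + s"
        using 1(2) \<beta>(1) by (intro add_right_mono mult_left_mono) auto
      also have "\<dots> \<le> \<beta> / 2 * norm (x - z) + 2 * s"
        using mult_right_mono[OF \<beta>(2), of s] s0 by (simp add: algebra_simps)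
      also have "2 * s \<le> \<beta> / 2 * norm (x - z)"
      proof -
        have "\<beta> * R \<le> \<beta> * (2 * norm (x - z))" using lo \<beta>(1) by (intro mult_left_mono) auto
        also have "\<dots> = 2 * (\<beta> * norm (x - z))" by (rule mult.left_commute)
        finally show ?thesis using s1 s0 by linarith
      qed
      finally have "norm (orth_proj V (x - z)) \<le> \<beta> * norm (x - z)" by simp
      moreover have "0 < norm (x - z)" using lo R by linarith
      ultimately have "cone_kernel n V \<beta> (x - z) = ennreal (1 / norm (x - z) ^ n)"
        by (auto simp: cone_kernel_def)
      moreover have "1 / (6 * R) ^ n \<le> 1 / norm (x - z) ^ n"
        using hi \<open>0 < norm (x - z)\<close> by (intro divide_left_mono power_mono mult_pos_pos zero_less_power) (auto intro: R)
      ultimately show ?thesis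
        using lo hi True by (auto simp: ann_def R_def intro!: ennreal_leI)
    qed simp
    have "e = 1 / (6 * R) ^ n * (\<epsilon> * s ^ n)"
      using R by (simp add: e_def sR power_mult_distrib power_divide field_simps)
    then have "ennreal e = ennreal (1 / (6 * R) ^ n) * ennreal (\<epsilon> * s ^ n)"
      using R \<epsilon> s0 by (simp only:) (intro ennreal_mult; simp)
    also have "\<dots> \<le> ennreal (1 / (6 * R) ^ n) * emeasure \<mu> (ball y s)"
      unfolding s_def by (intro mult_left_mono dens y) simp
    also have "\<dots> = (\<integral>\<^sup>+ z. ennreal (1 / (6 * R) ^ n) * indicator (ball y s) z \<partial>\<mu>)"
      by (rule nn_integral_cmult_indicator[symmetric]) (simp add: s\<mu>)
    also have "\<dots> \<le> (\<integral>\<^sup>+ z. cone_kernel n V \<beta> (x - z) * indicator (ann j) z \<partial>\<mu>)"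
      by (rule nn_integral_mono) (rule ball)
    finally show ?thesis .
  qed
  let ?S = "{j. x \<in> bad_scale V \<beta> r F j}"
  have bound: "real (card J) \<le> 4 * L * (6 * 2 ^ m) ^ n / \<epsilon>" if J: "finite J" "J \<subseteq> ?S" for J
  proof -
    have "ennreal (real (card J) * e) = (\<Sum>j\<in>J. ennreal e)"
      using e by (simp add: ennreal_mult ennreal_of_nat_eq_real_of_nat)
    also have "\<dots> \<le> (\<Sum>j\<in>J. \<integral>\<^sup>+ z. cone_kernel n V \<beta> (x - z) * indicator (ann j) z \<partial>\<mu>)"
      using J(2) by (intro sum_mono each) auto
    also have "\<dots> = (\<integral>\<^sup>+ z. (\<Sum>j\<in>J. cone_kernel n V \<beta> (x - z) * indicator (ann j) z) \<partial>\<mu>)"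
      by (intro nn_integral_sum[symmetric] borel_measurable_times_ennreal borel_measurable_indicator ann km)
    also have "\<dots> \<le> (\<integral>\<^sup>+ z. 4 * cone_kernel n V \<beta> (x - z) \<partial>\<mu>)"
    proof (rule nn_integral_mono)
      fix z
      have "(\<Sum>j\<in>J. indicator (ann j) z :: ennreal) = of_nat (card {j \<in> J. z \<in> ann j})"
        using J(1) by (simp add: indicator_def sum.If_cases Int_def)
      also have "\<dots> \<le> of_nat 4"
      proof (intro of_nat_mono card_dyadic_annuli_le[OF r, of _ "norm (x - z)"])
      qed (use J(1) in \<open>auto simp: ann_def\<close>)
      finally have count: "(\<Sum>j\<in>J. indicator (ann j) z :: ennreal) \<le> 4" by simp
      have "(\<Sum>j\<in>J. cone_kernel n V \<beta> (x - z) * indicator (ann j) z)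
          = cone_kernel n V \<beta> (x - z) * (\<Sum>j\<in>J. indicator (ann j) z)"
        by (rule sum_distrib_left[symmetric])
      also have "\<dots> \<le> cone_kernel n V \<beta> (x - z) * 4" by (intro mult_left_mono count) simp
      also have "\<dots> = 4 * cone_kernel n V \<beta> (x - z)" by (rule mult.commute)
      finally show "(\<Sum>j\<in>J. cone_kernel n V \<beta> (x - z) * indicator (ann j) z) \<le> 4 * cone_kernel n V \<beta> (x - z)" .
    qed
    also have "\<dots> = 4 * (\<integral>\<^sup>+ z. cone_kernel n V \<beta> (x - z) \<partial>\<mu>)" by (rule nn_integral_cmult[OF km])
    also have "\<dots> \<le> 4 * ennreal L" by (intro mult_left_mono energy) auto
    also have "\<dots> = ennreal (4 * L)" using L by (simp add: ennreal_mult)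
    finally have "real (card J) * e \<le> 4 * L" using L by (simp add: ennreal_le_iff)
    then have "real (card J) \<le> 4 * L / e" using e by (simp add: pos_le_divide_eq)
    then show ?thesis by (simp add: e_def)
  qed
  \<comment> \<open>The bound holds for every finite subset, so an infinite set of bad scales is
    impossible.\<close>
  have "finite ?S"
  proof (rule ccontr)
    assume inf: "infinite ?S"
    obtain N :: nat where N: "4 * L * (6 * 2 ^ m) ^ n / \<epsilon> < real N" using reals_Archimedean2 by blast
    obtain J where "finite J" "card J = N" "J \<subseteq> ?S" using infinite_arbitrarily_large[OF inf] by blast
    with bound[of J] N show False by simp
  qed
  with bound[of ?S] show ?thesis by simp
qed

section \<open>Colouring by cubes\<close>

text \<open>The index of the grid cube of side q containing x, reduced coordinatewise. The modulus
  makes distinct cube indices of one colour differ by at least 4 d + 1 in some coordinate, d the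
  dimension; one unit is lost to the position within the cubes.\<close>

definition cube_colour :: "real \<Rightarrow> 'a::euclidean_space \<Rightarrow> 'a \<Rightarrow> int" where
  "cube_colour q x = (\<lambda>b\<in>Basis. \<lfloor>x \<bullet> b / q\<rfloor> mod (4 * int DIM('a) + 1))"

lemma cube_colour_in:
  "cube_colour q (x :: 'a::euclidean_space) \<in> Basis \<rightarrow>\<^sub>E {0..<4 * int DIM('a) + 1}"
  unfolding cube_colour_def
  by (intro restrict_PiE_iff[THEN iffD2] ballI, unfold atLeastLessThan_iff, intro conjI pos_mod_sign pos_mod_bound) auto

lemma cube_colour_sets: "{x. cube_colour q (x :: 'a::euclidean_space) = \<omega>} \<in> sets borel"
proof (cases "\<omega> \<in> extensional (Basis :: 'a set)")
  case True
  have "{x. cube_colour q (x :: 'a) = \<omega>} = (\<Inter>b\<in>Basis. {x. \<lfloor>x \<bullet> b / q\<rfloor> mod (4 * int DIM('a) + 1) = \<omega> b})"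
    using True by (auto simp: cube_colour_def fun_eq_iff extensional_def restrict_def)
  also have "\<dots> \<in> sets borel"
  proof (intro sets.finite_INT)
    fix b :: 'a
    have "(\<lambda>x. \<lfloor>x \<bullet> b / q\<rfloor>) \<in> borel \<rightarrow>\<^sub>M count_space UNIV"
      by measurable
    from measurable_sets[OF this, of "{i. i mod (4 * int DIM('a) + 1) = \<omega> b}"]
    show "{x. \<lfloor>x \<bullet> b / q\<rfloor> mod (4 * int DIM('a) + 1) = \<omega> b} \<in> sets borel"
      by (simp add: vimage_def)
  qed auto
  finally show ?thesis .
next
  case False
  then have "{x. cube_colour q (x :: 'a) = \<omega>} = {}" by (auto simp: cube_colour_def)
  then show ?thesis by simp
qed

text \<open>Two points of one colour lie in the same cube or in cubes far apart in some coordinate,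
  so no distance strictly between d q and 4 d q occurs, with d the dimension.\<close>

lemma cube_colour_separates:
  fixes x y :: "'a::euclidean_space"
  assumes q: "0 < q" and eq: "cube_colour q x = cube_colour q y"
  shows "norm (x - y) \<le> real DIM('a) * q \<or> 4 * real DIM('a) * q \<le> norm (x - y)"
proof (cases "\<forall>b\<in>Basis. \<lfloor>x \<bullet> b / q\<rfloor> = \<lfloor>y \<bullet> b / q\<rfloor>")
  case True
  have "norm (x - y) \<le> (\<Sum>b\<in>Basis. \<bar>(x - y) \<bullet> b\<bar>)" by (rule norm_le_l1)
  also have "\<dots> \<le> (\<Sum>b\<in>(Basis :: 'a set). q)"
  proof (rule sum_mono)
    fix b :: 'a assume "b \<in> Basis"
    then have "\<bar>x \<bullet> b / q - y \<bullet> b / q\<bar> \<le> 1" using True by (smt (verit) floor_eq_iff)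
    then have "\<bar>(x \<bullet> b - y \<bullet> b) / q\<bar> \<le> 1" by (simp add: diff_divide_distrib)
    then show "\<bar>(x - y) \<bullet> b\<bar> \<le> q" using q by (simp add: inner_diff_left abs_divide divide_le_eq)
  qed
  also have "\<dots> = real DIM('a) * q" by simp
  finally show ?thesis ..
next
  case False
  then obtain b where b: "b \<in> Basis" "\<lfloor>x \<bullet> b / q\<rfloor> \<noteq> \<lfloor>y \<bullet> b / q\<rfloor>" by blast
  have "\<lfloor>x \<bullet> b / q\<rfloor> mod (4 * int DIM('a) + 1) = \<lfloor>y \<bullet> b / q\<rfloor> mod (4 * int DIM('a) + 1)"
    using fun_cong[OF eq, of b] b(1) by (simp add: cube_colour_def)
  then have "4 * int DIM('a) + 1 dvd \<lfloor>x \<bullet> b / q\<rfloor> - \<lfloor>y \<bullet> b / q\<rfloor>" by (simp add: mod_eq_dvd_iff)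
  then have "\<bar>4 * int DIM('a) + 1\<bar> \<le> \<bar>\<lfloor>x \<bullet> b / q\<rfloor> - \<lfloor>y \<bullet> b / q\<rfloor>\<bar>"
    using b(2) by (intro dvd_imp_le_int) auto
  then have "4 * real DIM('a) \<le> \<bar>x \<bullet> b / q - y \<bullet> b / q\<bar>" by linarith
  then have "4 * real DIM('a) \<le> \<bar>(x \<bullet> b - y \<bullet> b) / q\<bar>" by (simp add: diff_divide_distrib)
  then have "4 * real DIM('a) * q \<le> \<bar>(x - y) \<bullet> b\<bar>"
    using q by (simp add: inner_diff_left abs_divide le_divide_eq)
  also have "\<dots> \<le> norm (x - y)" by (rule Basis_le_norm[OF b(1)])
  finally show ?thesis ..
qed

section \<open>Selecting one colour per scale\<close>

text \<open>Summed over all colours, the new weighted integrals equal \<open>card C\<close> times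
  the old one: a bad point survives for one colour with its weight multiplied by
  \<open>card C\<close>, any other point survives for all colours with unchanged weight. The best
  colour is at least the average.\<close>

lemma (in finite_measure) select_one_colour_step:
  assumes G: "G \<in> sets M" and B: "B \<in> sets M"
    and C: "finite C" "C \<noteq> {}"
    and col: "\<And>x. x \<in> space M \<Longrightarrow> col x \<in> C" "\<And>\<omega>. \<omega> \<in> C \<Longrightarrow> {x \<in> space M. col x = \<omega>} \<in> sets M"
    and h: "h \<in> borel_measurable M" and h': "h' \<in> borel_measurable M"
    and hB: "\<And>x. x \<in> G \<Longrightarrow> x \<in> B \<Longrightarrow> h' x = of_nat (card C) * h x"
    and hnB: "\<And>x. x \<in> G \<Longrightarrow> x \<notin> B \<Longrightarrow> h' x = h x"
  obtains \<omega> where "\<omega> \<in> C" "(\<integral>\<^sup>+ x \<in> G. h x \<partial>M) \<le> (\<integral>\<^sup>+ x \<in> {x \<in> G. x \<in> B \<longrightarrow> col x = \<omega>}. h' x \<partial>M)"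
proof -
  note [measurable] = G h h'
  define W where "W \<omega> = (\<integral>\<^sup>+ x \<in> {x \<in> G. x \<in> B \<longrightarrow> col x = \<omega>}. h' x \<partial>M)" for \<omega>
  have GB: "{x \<in> G. x \<in> B \<longrightarrow> col x = \<omega>} \<in> sets M" if "\<omega> \<in> C" for \<omega>
  proof -
    have "(G - B) \<union> (G \<inter> {x \<in> space M. col x = \<omega>}) \<in> sets M"
      using G B col(2)[OF that] by auto
    moreover have "(G - B) \<union> (G \<inter> {x \<in> space M. col x = \<omega>}) = {x \<in> G. x \<in> B \<longrightarrow> col x = \<omega>}"
      using sets.sets_into_space[OF G] by auto
    ultimately show ?thesis by simp
  qed
  have "Max (W ` C) \<in> W ` C" using C by (intro Max_in) auto
  then obtain \<omega> where \<omega>: "\<omega> \<in> C" "Max (W ` C) = W \<omega>" by (rule imageE) simp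
  then have max: "W \<eta> \<le> W \<omega>" if "\<eta> \<in> C" for \<eta>
    using Max_ge[of "W ` C" "W \<eta>"] C that by simp
  have "of_nat (card C) * (\<integral>\<^sup>+ x \<in> G. h x \<partial>M) = (\<integral>\<^sup>+ x. of_nat (card C) * (h x * indicator G x) \<partial>M)"
    by (rule nn_integral_cmult[symmetric]) measurable
  also have "\<dots> = (\<integral>\<^sup>+ x. (\<Sum>\<eta>\<in>C. h' x * indicator {x \<in> G. x \<in> B \<longrightarrow> col x = \<eta>} x) \<partial>M)"
  proof (rule nn_integral_cong)
    fix x assume x: "x \<in> space M"
    show "of_nat (card C) * (h x * indicator G x)
      = (\<Sum>\<eta>\<in>C. h' x * indicator {x \<in> G. x \<in> B \<longrightarrow> col x = \<eta>} x)"
    proof (cases "x \<in> G")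
      case True
      show ?thesis
      proof (cases "x \<in> B")
        case xB: True
        have "(\<Sum>\<eta>\<in>C. h' x * indicator {x \<in> G. x \<in> B \<longrightarrow> col x = \<eta>} x) = (\<Sum>\<eta>\<in>C. if \<eta> = col x then h' x else 0)"
          using True xB by (intro sum.cong) (auto simp: indicator_def)
        also have "\<dots> = h' x" using C(1) col(1)[OF x] by simp
        finally show ?thesis using hB[OF True xB] True by simp
      next
        case xB: False
        then show ?thesis using hnB[OF True xB] True by simp
      qed
    qed simp
  qed
  also have "\<dots> = (\<Sum>\<eta>\<in>C. W \<eta>)"
    unfolding W_def
    by (intro nn_integral_sum borel_measurable_times_ennreal borel_measurable_indicator h' GB)
  also have "\<dots> \<le> of_nat (card C) * W \<omega>" by (rule sum_bounded_above) (rule max)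
  finally have "(\<integral>\<^sup>+ x \<in> G. h x \<partial>M) \<le> W \<omega>"
    using C by (subst (asm) ennreal_mult_le_mult_iff) (auto simp: ennreal_of_nat_eq_real_of_nat card_eq_0_iff)
  with \<omega>(1) show ?thesis unfolding W_def by (rule that)
qed

text \<open>
  If at each scale a colour is drawn uniformly at random from \<open>C\<close> and only the bad points of that
  colour are kept, a point with at most \<open>N\<close> bad scales survives all scales with probability at least
  \<open>1 / card C ^ N\<close>.  The random draws are replaced by greedy choices that do not decrease the
  conditional expectation of the measure that remains.
\<close>

lemma (in finite_measure) select_one_colour_per_scale:
  fixes B :: "nat \<Rightarrow> 'a set" and col :: "nat \<Rightarrow> 'a \<Rightarrow> 'c"
  assumes F: "F \<in> sets M" and B: "\<And>j. B j \<in> sets M" and C: "finite C" "C \<noteq> {}"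
    and col: "\<And>j x. x \<in> space M \<Longrightarrow> col j x \<in> C" "\<And>j \<omega>. \<omega> \<in> C \<Longrightarrow> {x \<in> space M. col j x = \<omega>} \<in> sets M"
    and N: "\<And>x. x \<in> F \<Longrightarrow> finite {j. x \<in> B j} \<and> card {j. x \<in> B j} \<le> N"
  obtains G where "G \<in> sets M" "G \<subseteq> F" "measure M F / real (card C) ^ N \<le> measure M G"
    "\<And>j x y. x \<in> G \<Longrightarrow> y \<in> G \<Longrightarrow> x \<in> B j \<Longrightarrow> y \<in> B j \<Longrightarrow> col j x = col j y"
proof -
  define K where "K = real (card C)"
  have K: "1 \<le> K" using C by (simp add: K_def Suc_le_eq card_gt_0_iff)
  \<comment> \<open>S counts the bad scales of x from j on, so h j x is the conditional probability
    that x survives all of them under random draws.\<close>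
  define S where "S j x = (\<Sum>i. indicator (B (i + j)) x :: real)" for j x
  define h where "h j x = ennreal (K powr (- S j x))" for j x
  have hm[measurable]: "h j \<in> borel_measurable M" for j
    unfolding h_def S_def using B by measurable
  \<comment> \<open>Off F the series may diverge; there only the measurability of h is used.\<close>
  have Sfin: "finite {i. indicator (B (i + j)) x \<noteq> (0::real)}" if "x \<in> F" for x j
  proof (rule finite_subset)
    show "{i. indicator (B (i + j)) x \<noteq> (0::real)} \<subseteq> (\<lambda>i. i - j) ` {i. x \<in> B i}"
    proof
      fix i assume "i \<in> {i. indicator (B (i + j)) x \<noteq> (0::real)}"
      then have "x \<in> B (i + j)" by (simp add: indicator_def split: if_splits)
      then show "i \<in> (\<lambda>i. i - j) ` {i. x \<in> B i}" by (intro image_eqI[of _ _ "i + j"]) auto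
    qed
    show "finite ((\<lambda>i. i - j) ` {i. x \<in> B i})" using N[OF that] by simp
  qed
  have Ssum: "summable (\<lambda>i. indicator (B (i + j)) x :: real)" if "x \<in> F" for x j
    using Sfin[OF that, of j] by (intro summable_finite) auto
  have SSuc: "S j x = indicator (B j) x + S (Suc j) x" if "x \<in> F" for x j
    unfolding S_def using suminf_split_head[OF Ssum[OF that, of j]] by simp
  have S0: "S 0 x \<le> real N" if "x \<in> F" for x
  proof -
    have "S 0 x = (\<Sum>i\<in>{i. x \<in> B i}. indicator (B i) x)"
      unfolding S_def add_0_right using N[OF that] by (intro suminf_finite) auto
    also have "\<dots> = real (card {i. x \<in> B i})" by simp
    finally show ?thesis using N[OF that] by simp
  qed
  have Spos: "0 \<le> S j x" if "x \<in> F" for x j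
    unfolding S_def by (rule suminf_nonneg[OF Ssum[OF that]]) simp
  have hB: "h (Suc j) x = of_nat (card C) * h j x" if "x \<in> F" "x \<in> B j" for j x
  proof -
    have "K powr (- S (Suc j) x) = K powr (1 + - S j x)" using SSuc[OF that(1), of j] that(2) by simp
    also have "\<dots> = K * K powr (- S j x)" using K by (subst powr_add) simp
    finally show ?thesis using K by (simp add: h_def K_def ennreal_mult ennreal_of_nat_eq_real_of_nat)
  qed
  have hnB: "h (Suc j) x = h j x" if "x \<in> F" "x \<notin> B j" for j x
    using SSuc[OF that(1), of j] that(2) by (simp add: h_def)
  define W where "W j G = (\<integral>\<^sup>+ x \<in> G. h j x \<partial>M)" for j G
  define keep where "keep j \<omega> G = {x \<in> G. x \<in> B j \<longrightarrow> col j x = \<omega>}" for j \<omega> G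
  have keep_sets: "keep j \<omega> G \<in> sets M" if "G \<in> sets M" "\<omega> \<in> C" for j \<omega> G
  proof -
    have "(G - B j) \<union> (G \<inter> {x \<in> space M. col j x = \<omega>}) \<in> sets M"
      using that B col(2)[OF that(2)] by auto
    moreover have "(G - B j) \<union> (G \<inter> {x \<in> space M. col j x = \<omega>}) = keep j \<omega> G"
      using sets.sets_into_space[OF that(1)] by (auto simp: keep_def)
    ultimately show ?thesis by simp
  qed
  \<comment> \<open>Invariant of the greedy choice: the expected surviving measure
    \<open>W j (G j)\<close> never falls below its initial value.\<close>
  have "\<exists>G. \<forall>j. (G j \<in> sets M \<and> G j \<subseteq> F \<and> W 0 F \<le> W j (G j)) \<and> (\<exists>\<omega>\<in>C. G (Suc j) = keep j \<omega> (G j))"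
  proof (rule dependent_nat_choice)
    show "\<exists>G. G \<in> sets M \<and> G \<subseteq> F \<and> W 0 F \<le> W 0 G" using F by blast
    fix G j assume G: "G \<in> sets M \<and> G \<subseteq> F \<and> W 0 F \<le> W j G"
    have "\<exists>\<omega>. \<omega> \<in> C \<and> W j G \<le> W (Suc j) (keep j \<omega> G)"
    proof (rule select_one_colour_step[of G "B j" C "col j" "h j" "h (Suc j)"])
      show "G \<in> sets M" using G by blast
      show "B j \<in> sets M" "finite C" "C \<noteq> {}" "h j \<in> borel_measurable M" "h (Suc j) \<in> borel_measurable M"
        by (fact B C hm)+
      show "col j x \<in> C" if "x \<in> space M" for x by (rule col(1)[OF that])
      show "{x \<in> space M. col j x = \<omega>} \<in> sets M" if "\<omega> \<in> C" for \<omega> by (rule col(2)[OF that])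
      show "h (Suc j) x = of_nat (card C) * h j x" if "x \<in> G" "x \<in> B j" for x
        using G that by (intro hB) auto
      show "h (Suc j) x = h j x" if "x \<in> G" "x \<notin> B j" for x
        using G that by (intro hnB) auto
      show "\<exists>\<omega>. \<omega> \<in> C \<and> W j G \<le> W (Suc j) (keep j \<omega> G)"
        if "\<omega> \<in> C" "(\<integral>\<^sup>+ x \<in> G. h j x \<partial>M) \<le> (\<integral>\<^sup>+ x \<in> {x \<in> G. x \<in> B j \<longrightarrow> col j x = \<omega>}. h (Suc j) x \<partial>M)" for \<omega>
        using that unfolding W_def keep_def by blast
    qed
    then obtain \<omega> where \<omega>: "\<omega> \<in> C" "W j G \<le> W (Suc j) (keep j \<omega> G)" by blast
    then show "\<exists>G'. (G' \<in> sets M \<and> G' \<subseteq> F \<and> W 0 F \<le> W (Suc j) G') \<and> (\<exists>\<omega>\<in>C. G' = keep j \<omega> G)"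
    proof (intro exI[of _ "keep j \<omega> G"] conjI bexI[of _ \<omega>])
      show "keep j \<omega> G \<in> sets M" using G \<omega>(1) by (intro keep_sets) auto
      show "keep j \<omega> G \<subseteq> F" using G by (auto simp: keep_def)
      show "W 0 F \<le> W (Suc j) (keep j \<omega> G)" using G \<omega>(2) by (meson order_trans)
    qed (use \<omega>(1) in auto)
  qed
  then obtain G where all: "\<forall>j. (G j \<in> sets M \<and> G j \<subseteq> F \<and> W 0 F \<le> W j (G j)) \<and> (\<exists>\<omega>\<in>C. G (Suc j) = keep j \<omega> (G j))"
    by (rule exE)
  have G: "\<And>j. G j \<in> sets M" "\<And>j. G j \<subseteq> F" "\<And>j. W 0 F \<le> W j (G j)"
      "\<And>j. \<exists>\<omega>\<in>C. G (Suc j) = keep j \<omega> (G j)"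
    using all by blast+
  have dec: "decseq G"
  proof (rule decseq_SucI)
    fix j
    obtain \<omega> where "G (Suc j) = keep j \<omega> (G j)" using G(4)[of j] by blast
    then show "G (Suc j) \<subseteq> G j" by (auto simp: keep_def)
  qed
  have "emeasure M F * ennreal (1 / K ^ N) \<le> emeasure M (G j)" for j
  proof -
    have "emeasure M F * ennreal (1 / K ^ N) = (\<integral>\<^sup>+ x \<in> F. ennreal (1 / K ^ N) \<partial>M)"
      by (subst nn_integral_cmult_indicator[OF F]) (rule mult.commute)
    also have "\<dots> \<le> W 0 F"
      unfolding W_def
    proof (rule nn_integral_mono)
      fix x
      have "1 / K ^ N \<le> K powr (- S 0 x)" if "x \<in> F"
      proof -
        have "1 / K ^ N = K powr (- real N)" 
        proof -
          have "K powr (- real N) = inverse (K powr real N)" by (rule powr_minus)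
          also have "K powr real N = K ^ N" using K by (intro powr_realpow) auto
          finally show ?thesis by (simp only: inverse_eq_divide)
        qed
        also have "\<dots> \<le> K powr (- S 0 x)" using S0[OF that] K by (intro powr_mono) auto
        finally show ?thesis .
      qed
      then show "ennreal (1 / K ^ N) * indicator F x \<le> h 0 x * indicator F x"
        unfolding h_def by (cases "x \<in> F") (simp_all add: ennreal_leI)
    qed
    also have "\<dots> \<le> W j (G j)" by (rule G(3))
    \<comment> \<open>Survival probabilities are at most 1, so the weighted integral is at most the
      measure of what is currently kept.\<close>
    also have "\<dots> \<le> (\<integral>\<^sup>+ x. indicator (G j) x \<partial>M)"
      unfolding W_def
    proof (rule nn_integral_mono)
      fix x
      have "h j x \<le> 1" if "x \<in> F"
      proof -
        have "K powr (- S j x) \<le> K powr 0" using Spos[OF that, of j] K by (intro powr_mono) auto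
        then show ?thesis using K by (simp add: h_def)
      qed
      then show "h j x * indicator (G j) x \<le> indicator (G j) x"
        using G(2)[of j] by (cases "x \<in> G j") auto
    qed
    also have "\<dots> = emeasure M (G j)" using G(1) by simp
    finally show ?thesis .
  qed
  \<comment> \<open>The bound is uniform in j and the measure is finite, so continuity from above
    passes it to the intersection over all scales.\<close>
  then have "emeasure M F * ennreal (1 / K ^ N) \<le> (INF j. emeasure M (G j))" by (rule INF_greatest)
  also have "\<dots> = emeasure M (\<Inter>j. G j)"
  proof (rule INF_emeasure_decseq)
    show "range G \<subseteq> sets M" using G(1) by blast
    show "decseq G" by (rule dec)
    show "emeasure M (G i) \<noteq> \<infinity>" for i by simp
  qed
  finally have le: "emeasure M F * ennreal (1 / K ^ N) \<le> emeasure M (\<Inter>j. G j)" .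
  show ?thesis
  proof (rule that[of "\<Inter>j. G j"])
    show "(\<Inter>j. G j) \<in> sets M" using G(1) by (intro sets.countable_INT) auto
    show "(\<Inter>j. G j) \<subseteq> F" using G(2) by blast
    have "ennreal (measure M F * (1 / K ^ N)) = emeasure M F * ennreal (1 / K ^ N)"
      unfolding emeasure_eq_measure using K by (intro ennreal_mult) auto
    also have "\<dots> \<le> ennreal (measure M (\<Inter>j. G j))" using le unfolding emeasure_eq_measure .
    finally show "measure M F / real (card C) ^ N \<le> measure M (\<Inter>j. G j)"
      by (simp add: K_def)
    fix j x y
    assume xy: "x \<in> (\<Inter>j. G j)" "y \<in> (\<Inter>j. G j)" "x \<in> B j" "y \<in> B j"
    obtain \<omega> where "G (Suc j) = keep j \<omega> (G j)" using G(4)[of j] by blast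
    moreover have "x \<in> G (Suc j)" "y \<in> G (Suc j)" using xy(1,2) by blast+
    ultimately show "col j x = col j y" using xy(3,4) by (simp add: keep_def)
  qed
qed

section \<open>Big pieces of Lipschitz graphs\<close>

text \<open>
  The Caratheodory measurable sets form too fine a sigma-algebra for Fubini arguments; only the
  Borel trace of the restriction of Hausdorff measure matters for the projections.
\<close>

definition restricted_measure :: "nat \<Rightarrow> 'a::euclidean_space set \<Rightarrow> 'a measure" where
  "restricted_measure n A = distr (restrict_space (hausdorff_measure n) A) borel (\<lambda>y. y)"

lemma sets_restricted_measure [simp, measurable_cong]: "sets (restricted_measure n A) = sets borel"
  by (simp add: restricted_measure_def)

lemma emeasure_restricted_measure:
  assumes A: "A \<in> sets (hausdorff_measure n)" and B: "B \<in> sets borel"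
  shows "emeasure (restricted_measure n A) B = hausdorff_outer n (A \<inter> B)"
proof -
  have AB: "A \<inter> B \<in> sets (hausdorff_measure n)" using A B borel_sets_hausdorff_measure by blast
  have "emeasure (restricted_measure n A) B = emeasure (restrict_space (hausdorff_measure n) A) ((\<lambda>y. y) -` B \<inter> space (restrict_space (hausdorff_measure n) A))"
    unfolding restricted_measure_def using id_measurable_hausdorff_borel[OF A] B by (rule emeasure_distr)
  also have "(\<lambda>y. y) -` B \<inter> space (restrict_space (hausdorff_measure n) A) = A \<inter> B"
    by (auto simp: space_restrict_space)
  also have "emeasure (restrict_space (hausdorff_measure n) A) (A \<inter> B) = emeasure (hausdorff_measure n) (A \<inter> B)"
    using A by (intro emeasure_restrict_space) auto
  also have "\<dots> = hausdorff_outer n (A \<inter> B)" by (rule emeasure_hausdorff_measure[OF AB])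
  finally show ?thesis .
qed

text \<open>The projection is Borel, so the push-forward may pass through the Borel trace. This
  identifies the projected measures of the theorem with those to which the energy estimate
  applies.\<close>

lemma proj_measure_eq_distr:
  assumes A: "A \<in> sets (hausdorff_measure n)" and V: "subspace V"
  shows "proj_measure n A V = distr (restricted_measure n A) (restrict_space borel V) (orth_proj V)"
proof -
  have pm: "orth_proj V \<in> borel \<rightarrow>\<^sub>M restrict_space borel V"
    by (rule measurable_restrict_space2) (use V in \<open>auto intro: orth_proj_in_subspace\<close>)
  show ?thesis
    unfolding restricted_measure_def proj_measure_def
    by (subst distr_distr[OF pm id_measurable_hausdorff_borel[OF A]]) (simp add: comp_def)
qed

text \<open>A pair of G inside the narrower cone would make both of its points bad at one common
  scale. They would then share a colour, which is incompatible with their distance at that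
  scale.\<close>

lemma big_piece_without_cone_pairs:
  fixes V :: "'a::euclidean_space set" and \<mu> :: "'a measure"
  assumes fin: "finite_measure \<mu>" and s\<mu>: "sets \<mu> = sets borel" and r: "0 < r" and \<beta>: "0 < \<beta>" "\<beta> \<le> 1"
    and m: "1 / 2 ^ m \<le> \<beta> / 16" and \<epsilon>: "0 < \<epsilon>" and L: "0 \<le> L"
    and F: "F \<in> sets borel" "F \<subseteq> cball x0 r"
    and dens: "\<And>y k. y \<in> F \<Longrightarrow> ennreal (\<epsilon> * (r / 2 ^ k) ^ n) \<le> emeasure \<mu> (ball y (r / 2 ^ k))"
    and energy: "\<And>x. x \<in> F \<Longrightarrow> (\<integral>\<^sup>+ y. cone_kernel n V \<beta> (x - y) \<partial>\<mu>) \<le> ennreal L"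
    and N: "4 * L * (6 * 2 ^ m) ^ n / \<epsilon> \<le> real N"
  obtains G where "G \<in> sets borel" "G \<subseteq> F"
    "measure \<mu> F / real ((4 * DIM('a) + 1) ^ DIM('a)) ^ N \<le> measure \<mu> G"
    "\<And>x y. x \<in> G \<Longrightarrow> y \<in> G \<Longrightarrow> \<beta> / 2 * norm (x - y) \<le> norm (orth_proj V (x - y))"
proof -
  interpret finite_measure \<mu> by fact
  \<comment> \<open>With this side the forbidden distances for one colour are exactly the window (r
    / 2^j, 4 r / 2^j) of bad scale j.\<close>
  define q where "q j = r / 2 ^ j / real DIM('a)" for j
  have q: "0 < q j" for j using r by (simp add: q_def)
  define C where "C = (Basis :: 'a set) \<rightarrow>\<^sub>E {0..<4 * int DIM('a) + 1}"
  have C: "finite C" "C \<noteq> {}" unfolding C_def by (auto intro!: finite_PiE simp: PiE_eq_empty_iff)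
  have cardC: "card C = (4 * DIM('a) + 1) ^ DIM('a)"
    unfolding C_def by (simp add: card_PiE nat_add_distrib nat_mult_distrib)
  obtain G where G: "G \<in> sets \<mu>" "G \<subseteq> F" "measure \<mu> F / real (card C) ^ N \<le> measure \<mu> G"
    "\<And>j x y. x \<in> G \<Longrightarrow> y \<in> G \<Longrightarrow> x \<in> bad_scale V \<beta> r F j \<Longrightarrow> y \<in> bad_scale V \<beta> r F j
      \<Longrightarrow> cube_colour (q j) x = cube_colour (q j) y"
  proof (rule select_one_colour_per_scale[of F "bad_scale V \<beta> r F" C "\<lambda>j. cube_colour (q j)" N])
    show "F \<in> sets \<mu>" "\<And>j. bad_scale V \<beta> r F j \<in> sets \<mu>" using F(1) bad_scale_sets s\<mu> by auto
    show "finite C" "C \<noteq> {}" by fact+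
    show "cube_colour (q j) x \<in> C" for j x unfolding C_def by (rule cube_colour_in)
    show "{x \<in> space \<mu>. cube_colour (q j) x = \<omega>} \<in> sets \<mu>" for j \<omega>
      using cube_colour_sets[of "q j" \<omega>] sets_eq_imp_space_eq[OF s\<mu>] s\<mu> by simp
    show "finite {j. x \<in> bad_scale V \<beta> r F j} \<and> card {j. x \<in> bad_scale V \<beta> r F j} \<le> N" if x: "x \<in> F" for x
      using card_bad_scales_le[OF s\<mu> r \<beta> m \<epsilon> L x dens energy[OF x]] N by (auto simp: order_trans)
  qed blast
  show ?thesis
  proof
    show "G \<in> sets borel" using G(1) s\<mu> by simp
    show "G \<subseteq> F" by fact
    show "measure \<mu> F / real ((4 * DIM('a) + 1) ^ DIM('a)) ^ N \<le> measure \<mu> G" using G(3) by (simp only: cardC)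
    fix x y assume xy: "x \<in> G" "y \<in> G"
    show "\<beta> / 2 * norm (x - y) \<le> norm (orth_proj V (x - y))"
    proof (rule ccontr)
      assume "\<not> \<beta> / 2 * norm (x - y) \<le> norm (orth_proj V (x - y))"
      then have cone: "norm (orth_proj V (x - y)) < \<beta> / 2 * norm (x - y)" by simp
      have d0: "0 < norm (x - y)" using cone by (cases "x = y") (auto simp: linear_0[OF linear_orth_proj])
      have "dist x0 x \<le> r" "dist x0 y \<le> r" using xy G(2) F(2) by auto
      then have d2: "norm (x - y) \<le> 2 * r" using dist_triangle3[of x y x0] by (simp add: dist_norm)
      let ?P = "\<lambda>j. r / 2 ^ j < norm (x - y)"
      obtain j0 where "r / norm (x - y) < 2 ^ j0" using real_arch_pow[of 2 "r / norm (x - y)"] by auto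
      then have "?P j0" using d0 by (simp add: field_simps)
      \<comment> \<open>Minimality gives |x - y| \<le> 2 r / 2^j when j > 0. For j = 0 the same
        bound holds because both points lie in a ball of radius r.\<close>
      define j where "j = (LEAST j. ?P j)"
      have j: "?P j" unfolding j_def by (rule LeastI[of ?P, OF \<open>?P j0\<close>])
      have "norm (x - y) < 4 * (r / 2 ^ j)"
      proof (cases j)
        case 0
        then show ?thesis using d2 r by simp
      next
        case (Suc i)
        then have "\<not> ?P i" unfolding j_def by (metis lessI not_less_Least)
        then have "norm (x - y) \<le> r / 2 ^ i" by simp
        also have "r / 2 ^ i = 2 * (r / 2 ^ j)" using Suc by simp
        also have "\<dots> < 4 * (r / 2 ^ j)"
        proof -
          have "0 < r / 2 ^ j" using r by simp
          then show ?thesis by linarith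
        qed
        finally show ?thesis .
      qed
      with j cone have w: "norm (orth_proj V (x - y)) < \<beta> / 2 * norm (x - y) \<and>
          r / 2 ^ j < norm (x - y) \<and> norm (x - y) < 4 * (r / 2 ^ j)"
        by blast
      \<comment> \<open>The cone and the window are symmetric in the pair. Both points must be bad,
        since the selection constrains only bad points.\<close>
      have "orth_proj V (y - x) = - orth_proj V (x - y)" by (simp add: orth_proj_diff)
      then have "norm (orth_proj V (y - x)) = norm (orth_proj V (x - y))" "norm (y - x) = norm (x - y)"
        by (simp_all only: norm_minus_cancel norm_minus_commute)
      with w have w': "norm (orth_proj V (y - x)) < \<beta> / 2 * norm (y - x) \<and>
          r / 2 ^ j < norm (y - x) \<and> norm (y - x) < 4 * (r / 2 ^ j)"
        by (simp only:)
      have "x \<in> F" "y \<in> F" using xy G(2) by auto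
      then have "x \<in> bad_scale V \<beta> r F j" "y \<in> bad_scale V \<beta> r F j"
        unfolding bad_scale_def using w w' by blast+
      then have "cube_colour (q j) x = cube_colour (q j) y" by (rule G(4)[OF xy])
      then have "norm (x - y) \<le> real DIM('a) * q j \<or> 4 * real DIM('a) * q j \<le> norm (x - y)"
        by (rule cube_colour_separates[OF q])
      moreover have "real DIM('a) * q j = r / 2 ^ j" by (simp add: q_def)
      ultimately show False using j \<open>norm (x - y) < 4 * (r / 2 ^ j)\<close> by (simp add: mult.assoc)
    qed
  qed
qed

text \<open>All constants are fixed before the sets, the plane and the ball, so M and \<delta> are
  uniform over locations and scales. The doubled ball accommodates the Vitali balls, which may leave
  the ball of radius r.\<close>

lemma big_lipschitz_graph_piece:
  fixes \<gamma> :: "'a::euclidean_space set measure"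
  assumes g: "is_grassmann_measure n \<gamma>" and \<kappa>: "0 < \<kappa>" and c1: "0 < c1" and c2: "0 \<le> c2"
  obtains M \<delta> where "0 < \<delta>"
    "\<And>E E' V0 x0 r. 0 < r \<Longrightarrow> E' \<in> sets (hausdorff_measure n) \<Longrightarrow> E' \<subseteq> E \<inter> cball x0 r \<Longrightarrow> V0 \<in> Grassmannian n \<Longrightarrow>
      ennreal (\<kappa> * r ^ n) \<le> hausdorff_outer n E' \<Longrightarrow>
      (\<integral>\<^sup>+ V \<in> grassmann_cball n V0 \<kappa>. L2_norm_sq (plane_measure n V) (proj_measure n E' V) \<partial>\<gamma>) \<le> ennreal (C * r ^ n) \<Longrightarrow>
      (\<And>x s. x \<in> E \<Longrightarrow> 0 < s \<Longrightarrow> s \<le> r \<Longrightarrow> ennreal (c1 * s ^ n) \<le> hausdorff_outer n (E \<inter> cball x s)) \<Longrightarrow>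
      hausdorff_outer n (E \<inter> cball x0 (2 * r)) \<le> ennreal (c2 * r ^ n) \<Longrightarrow>
      \<exists>\<Gamma>. lipschitz_graph n M \<Gamma> \<and> ennreal (\<delta> * r ^ n) \<le> hausdorff_outer n (E' \<inter> \<Gamma>)"
proof -
  have sg: "space \<gamma> = Grassmannian n" using g by (simp add: is_grassmann_measure_def)
  obtain \<beta> c where \<beta>: "0 < \<beta>" "\<beta> \<le> 1" and c: "0 < c" and
    slice: "\<And>V w \<delta>. V \<in> Grassmannian n \<Longrightarrow> norm (orth_proj V w) \<le> \<beta> * norm w \<Longrightarrow> 0 < \<delta> \<Longrightarrow> \<delta> \<le> norm w
      \<Longrightarrow> c * (\<delta> / norm w) ^ n \<le> measure \<gamma> (slice n V w \<kappa> \<delta>)"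
    using slice_lower[OF g \<kappa>] by blast
  define K where "K = unit_ball_vol (real n) / 2 ^ n * (12 * real n) ^ n + 1"
  have K: "0 < K" unfolding K_def by (intro add_nonneg_pos) auto
  \<comment> \<open>C may have any sign; this C1 is positive and still bounds the energy.\<close>
  define C1 where "C1 = 2 * K / c * (max C 0 + 1)"
  have C1: "0 < C1" using K c by (simp add: C1_def)
  \<comment> \<open>By Markov's inequality the points of energy above L have measure at most C1 r^n
    / L = \<kappa> r^n / 4.\<close>
  define L where "L = 4 * C1 / \<kappa>"
  have L: "0 < L" using C1 \<kappa> by (simp add: L_def)
  \<comment> \<open>The low-density bound \<epsilon> 10^n c2 r^n / c1 then is at most \<kappa> r^n /
    4; c2 + 1 avoids division by zero.\<close>
  define \<epsilon> where "\<epsilon> = \<kappa> * c1 / (4 * 10 ^ n * (c2 + 1))"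
  have \<epsilon>: "0 < \<epsilon>" using \<kappa> c1 c2 by (simp add: \<epsilon>_def)
  obtain m where "16 / \<beta> < 2 ^ m" using real_arch_pow[of 2 "16 / \<beta>"] by auto
  then have m: "1 / 2 ^ m \<le> \<beta> / 16" using \<beta>(1) by (simp add: field_simps)
  obtain N :: nat where N: "4 * L * (6 * 2 ^ m) ^ n / \<epsilon> \<le> real N" using real_arch_simple by blast
  define Q where "Q = real ((4 * DIM('a) + 1) ^ DIM('a)) ^ N"
  have Q: "0 < Q" by (simp add: Q_def)
  show ?thesis
  proof (rule that[of "\<kappa> / 2 / Q" "real DIM('a) / (\<beta> / 2)"])
    show "0 < \<kappa> / 2 / Q" using \<kappa> Q by simp
    fix E E' V0 :: "'a set" and x0 :: 'a and r :: real
    assume r: "0 < r" and E'm: "E' \<in> sets (hausdorff_measure n)" and E'E: "E' \<subseteq> E \<inter> cball x0 r"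
      and V0: "V0 \<in> Grassmannian n" and big: "ennreal (\<kappa> * r ^ n) \<le> hausdorff_outer n E'"
      and L2: "(\<integral>\<^sup>+ V \<in> grassmann_cball n V0 \<kappa>. L2_norm_sq (plane_measure n V) (proj_measure n E' V) \<partial>\<gamma>) \<le> ennreal (C * r ^ n)"
      and lower: "\<And>x s. x \<in> E \<Longrightarrow> 0 < s \<Longrightarrow> s \<le> r \<Longrightarrow> ennreal (c1 * s ^ n) \<le> hausdorff_outer n (E \<inter> cball x s)"
      and upper: "hausdorff_outer n (E \<inter> cball x0 (2 * r)) \<le> ennreal (c2 * r ^ n)"
    define \<mu> where "\<mu> = restricted_measure n E'"
    have s\<mu>[measurable_cong]: "sets \<mu> = sets borel" by (simp add: \<mu>_def)
    have sp\<mu>: "space \<mu> = UNIV" using sets_eq_imp_space_eq[OF s\<mu>] by simp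
    have \<mu>: "emeasure \<mu> B = hausdorff_outer n (E' \<inter> B)" if "B \<in> sets borel" for B
      unfolding \<mu>_def by (rule emeasure_restricted_measure[OF E'm that])
    have fin: "finite_measure \<mu>"
    proof
      have "emeasure \<mu> (space \<mu>) \<le> hausdorff_outer n (E \<inter> cball x0 (2 * r))"
        unfolding sp\<mu> using E'E r by (subst \<mu>) (auto intro!: hausdorff_outer_mono)
      also have "\<dots> \<le> ennreal (c2 * r ^ n)" by (rule upper)
      finally show "emeasure \<mu> (space \<mu>) \<noteq> \<infinity>" by (auto simp: top_unique)
    qed
    interpret finite_measure \<mu> by fact
    define U where "U x = (\<integral>\<^sup>+ y. cone_kernel n V0 \<beta> (x - y) \<partial>\<mu>)" for x
    have Um[measurable]: "U \<in> borel_measurable borel"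
      unfolding U_def by measurable
    have "(\<integral>\<^sup>+ x. U x \<partial>\<mu>) \<le> ennreal (2 * K / c) * (\<integral>\<^sup>+ V \<in> grassmann_cball n V0 \<kappa>.
        L2_norm_sq (plane_measure n V) (distr \<mu> (restrict_space borel V) (orth_proj V)) \<partial>\<gamma>)"
      unfolding U_def K_def by (rule cone_energy_le[OF g V0 fin s\<mu> c]) (rule slice[OF V0])
    also have "(\<integral>\<^sup>+ V \<in> grassmann_cball n V0 \<kappa>. L2_norm_sq (plane_measure n V) (distr \<mu> (restrict_space borel V) (orth_proj V)) \<partial>\<gamma>)
        = (\<integral>\<^sup>+ V \<in> grassmann_cball n V0 \<kappa>. L2_norm_sq (plane_measure n V) (proj_measure n E' V) \<partial>\<gamma>)"
      unfolding \<mu>_def by (rule nn_integral_cong) (simp add: sg Grassmannian_def proj_measure_eq_distr[OF E'm])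
    also have "ennreal (2 * K / c) * \<dots> \<le> ennreal (2 * K / c) * ennreal ((max C 0 + 1) * r ^ n)"
      using r by (intro mult_left_mono order_trans[OF L2] ennreal_leI mult_right_mono) auto
    also have "\<dots> = ennreal (C1 * r ^ n)"
      unfolding C1_def using K c r by (subst ennreal_mult[symmetric]) (auto simp: mult.assoc)
    finally have energy: "(\<integral>\<^sup>+ x. U x \<partial>\<mu>) \<le> ennreal (C1 * r ^ n)" .
    define D1 where "D1 = {x. ennreal L < U x}"
    \<comment> \<open>Dyadic radii make this a countable union, hence Borel, and are the only ones
      used in counting bad scales.\<close>
    define D2 where "D2 = {x. \<exists>k. emeasure \<mu> (ball x (r / 2 ^ k)) < ennreal (\<epsilon> * (r / 2 ^ k) ^ n)}"
    have D1m: "D1 \<in> sets borel" unfolding D1_def by measurable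
    have D2m: "D2 \<in> sets borel"
    proof -
      note [measurable] = emeasure_ball_measurable[OF fin s\<mu>]
      show ?thesis unfolding D2_def by measurable
    qed
    have "emeasure \<mu> D1 \<le> emeasure \<mu> {x \<in> UNIV. 1 \<le> ennreal (1 / L) * U x}"
    proof (rule emeasure_mono)
      show "D1 \<subseteq> {x \<in> UNIV. 1 \<le> ennreal (1 / L) * U x}"
      proof
        fix x assume "x \<in> D1"
        then have "ennreal (1 / L) * ennreal L \<le> ennreal (1 / L) * U x"
          unfolding D1_def by (intro mult_left_mono) auto
        moreover have "ennreal (1 / L) * ennreal L = 1" using L by (simp add: ennreal_mult[symmetric])
        ultimately show "x \<in> {x \<in> UNIV. 1 \<le> ennreal (1 / L) * U x}" by simp
      qed
      show "{x \<in> UNIV. 1 \<le> ennreal (1 / L) * U x} \<in> sets \<mu>" unfolding s\<mu> by measurable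
    qed
    also have "\<dots> \<le> ennreal (1 / L) * (\<integral>\<^sup>+ x. U x * indicator UNIV x \<partial>\<mu>)"
      by (rule nn_integral_Markov_inequality) (auto simp: s\<mu> measurable_cong_sets[OF s\<mu> refl])
    also have "\<dots> \<le> ennreal (1 / L) * ennreal (C1 * r ^ n)"
      using energy by (intro mult_left_mono) auto
    also have "\<dots> = ennreal (\<kappa> * r ^ n / 4)"
    proof -
      have "1 / L * (C1 * r ^ n) = \<kappa> * r ^ n / 4" using C1 by (simp add: L_def)
      moreover have "ennreal (1 / L) * ennreal (C1 * r ^ n) = ennreal (1 / L * (C1 * r ^ n))"
        using L C1 r by (intro ennreal_mult[symmetric]) auto
      ultimately show ?thesis by (simp only:)
    qed
    finally have D1: "measure \<mu> D1 \<le> \<kappa> * r ^ n / 4"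
      using \<kappa> r by (simp add: emeasure_eq_measure ennreal_le_iff)
    have "emeasure \<mu> D2 \<le> ennreal (\<epsilon> * 10 ^ n / c1 * (c2 * r ^ n))"
    proof (rule emeasure_low_density_le[OF \<mu> s\<mu> E'E r c1 _ lower upper _ D2m])
      fix x assume "x \<in> D2"
      then obtain k where "emeasure \<mu> (ball x (r / 2 ^ k)) < ennreal (\<epsilon> * (r / 2 ^ k) ^ n)"
        by (auto simp: D2_def)
      moreover have "r / 2 ^ k \<le> r / 1" using r by (intro divide_left_mono) auto
      ultimately show "\<exists>s. 0 < s \<and> s \<le> r \<and> emeasure \<mu> (ball x s) \<le> ennreal (\<epsilon> * s ^ n)"
        using r by (intro exI[of _ "r / 2 ^ k"]) auto
    qed (use \<epsilon> c2 r in auto)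
    also have "\<dots> \<le> ennreal (\<kappa> * r ^ n / 4)"
    proof (rule ennreal_leI)
      have "\<epsilon> * 10 ^ n / c1 * (c2 * r ^ n) = \<kappa> * r ^ n / 4 * (c2 / (c2 + 1))"
      proof -
        define a where "a = c2 + 1"
        have "0 < a" using c2 by (simp add: a_def)
        then show ?thesis unfolding \<epsilon>_def a_def[symmetric] using c1 by (simp add: field_simps)
      qed
      also have "\<dots> \<le> \<kappa> * r ^ n / 4 * 1"
        using \<kappa> r c2 by (intro mult_left_mono) (auto simp: divide_le_eq)
      finally show "\<epsilon> * 10 ^ n / c1 * (c2 * r ^ n) \<le> \<kappa> * r ^ n / 4" by simp
    qed
    finally have D2: "measure \<mu> D2 \<le> \<kappa> * r ^ n / 4"
      using \<kappa> r by (simp add: emeasure_eq_measure ennreal_le_iff)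
    \<comment> \<open>Two exceptional sets of measure at most \<kappa> r^n / 4 leave half of the
      mass. F need not lie in E', but \<mu> charges only E', which returns in the last
      intersection.\<close>
    define F where "F = cball x0 r - (D1 \<union> D2)"
    have Fm: "F \<in> sets borel" using D1m D2m by (auto simp: F_def)
    have "E' \<inter> cball x0 r = E'" using E'E by blast
    then have "ennreal (\<kappa> * r ^ n) \<le> ennreal (measure \<mu> (cball x0 r))"
      using big \<mu>[of "cball x0 r"] by (simp add: emeasure_eq_measure)
    then have "\<kappa> * r ^ n \<le> measure \<mu> (cball x0 r)" by (simp add: ennreal_le_iff)
    also have "\<dots> \<le> measure \<mu> (F \<union> (D1 \<union> D2))"
      using Fm D1m D2m by (intro finite_measure_mono) (auto simp: F_def s\<mu>)
    also have "\<dots> \<le> measure \<mu> F + measure \<mu> (D1 \<union> D2)"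
      using Fm D1m D2m by (intro measure_Un_le) (auto simp: s\<mu>)
    also have "measure \<mu> (D1 \<union> D2) \<le> measure \<mu> D1 + measure \<mu> D2"
      using D1m D2m by (intro measure_Un_le) (auto simp: s\<mu>)
    finally have F: "\<kappa> / 2 * r ^ n \<le> measure \<mu> F" using D1 D2 by simp
    obtain G where G: "G \<in> sets borel" "G \<subseteq> F" "measure \<mu> F / Q \<le> measure \<mu> G"
      "\<And>x y. x \<in> G \<Longrightarrow> y \<in> G \<Longrightarrow> \<beta> / 2 * norm (x - y) \<le> norm (orth_proj V0 (x - y))"
      unfolding Q_def
    proof (rule big_piece_without_cone_pairs[OF fin s\<mu> r \<beta> m \<epsilon> _ Fm _ _ _ N])
      show "ennreal (\<epsilon> * (r / 2 ^ k) ^ n) \<le> emeasure \<mu> (ball y (r / 2 ^ k))" if "y \<in> F" for y k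
        using that by (auto simp: F_def D2_def not_less)
      show "(\<integral>\<^sup>+ y. cone_kernel n V0 \<beta> (x - y) \<partial>\<mu>) \<le> ennreal L" if "x \<in> F" for x
        using that by (auto simp: F_def D1_def U_def not_less)
    qed (use L in \<open>auto simp: F_def\<close>)
    obtain \<Gamma> where \<Gamma>: "lipschitz_graph n (real DIM('a) / (\<beta> / 2)) \<Gamma>" "G \<subseteq> \<Gamma>"
      using lipschitz_graph_of_cone_condition[OF V0 _ G(4)] \<beta>(1) by auto
    have "\<kappa> / 2 / Q * r ^ n = \<kappa> / 2 * r ^ n / Q" by simp
    also have "\<dots> \<le> measure \<mu> F / Q" using F Q by (intro divide_right_mono) auto
    also have "\<dots> \<le> measure \<mu> G" by (rule G(3))
    finally have "ennreal (\<kappa> / 2 / Q * r ^ n) \<le> emeasure \<mu> G"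
      unfolding emeasure_eq_measure by (rule ennreal_leI)
    also have "\<dots> = hausdorff_outer n (E' \<inter> G)" by (rule \<mu>[OF G(1)])
    also have "\<dots> \<le> hausdorff_outer n (E' \<inter> \<Gamma>)" using \<Gamma>(2) by (intro hausdorff_outer_mono) auto
    finally show "\<exists>\<Gamma>. lipschitz_graph n (real DIM('a) / (\<beta> / 2)) \<Gamma> \<and> ennreal (\<kappa> / 2 / Q * r ^ n) \<le> hausdorff_outer n (E' \<inter> \<Gamma>)"
      using \<Gamma>(1) by blast
  qed
qed

text \<open>Regularity is available only up to the diameter. If 2 r exceeds it, the ball of radius
  \<open>d\<close>, the diameter, about x already contains E, and r \<le> d < 2 r.\<close>

lemma ADR_upper_double:
  fixes E :: "'a::euclidean_space set"
  assumes C2: "0 \<le> C2" and upper: "\<And>s. 0 < s \<Longrightarrow> ennreal s \<le> ediam E \<Longrightarrow> hausdorff_outer n (E \<inter> cball x s) \<le> ennreal (C2 * s ^ n)"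
    and x: "x \<in> E" and r: "0 < r" "ennreal r \<le> ediam E"
  shows "hausdorff_outer n (E \<inter> cball x (2 * r)) \<le> ennreal (C2 * 2 ^ n * r ^ n)"
proof (cases "ennreal (2 * r) \<le> ediam E")
  case True
  then show ?thesis using upper[of "2 * r"] r(1) by (simp add: power_mult_distrib mult.assoc)
next
  case False
  then obtain d where d: "ediam E = ennreal d" "0 \<le> d" by (cases "ediam E") auto
  have "ennreal d < ennreal (2 * r)" using False by (simp add: d(1))
  then have dr: "d < 2 * r" using r(1) by (simp add: ennreal_less_iff d(2))
  have "ennreal r \<le> ennreal d" using r(2) by (simp add: d(1))
  then have rd: "r \<le> d" using d(2) by (simp add: ennreal_le_iff)
  have "E \<inter> cball x (2 * r) \<subseteq> E \<inter> cball x d"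
  proof
    fix y assume y: "y \<in> E \<inter> cball x (2 * r)"
    then have "ennreal (dist x y) \<le> ediam E"
      unfolding ediam_def using x by (intro SUP_upper2[of x] SUP_upper2[of y]) auto
    then have "dist x y \<le> d" using d(2) by (simp add: d(1) ennreal_le_iff)
    with y show "y \<in> E \<inter> cball x d" by simp
  qed
  then have "hausdorff_outer n (E \<inter> cball x (2 * r)) \<le> hausdorff_outer n (E \<inter> cball x d)"
    by (rule hausdorff_outer_mono)
  also have "\<dots> \<le> ennreal (C2 * d ^ n)" using rd r(1) d(1) by (intro upper) auto
  also have "\<dots> \<le> ennreal (C2 * (2 * r) ^ n)"
    using C2 d(2) dr by (intro ennreal_leI mult_left_mono power_mono) auto
  finally show ?thesis by (simp add: power_mult_distrib mult.assoc)
qed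

text \<open>Each graph is replaced by its parametrisation centred at the projection of x, which
  captures the part of the graph in the ball with a parameter ball of the same radius.\<close>

lemma BPLG_imp_uniformly_rectifiable:
  fixes E :: "'a::euclidean_space set"
  assumes "BPLG n E" "closed E"
  shows "uniformly_rectifiable n E"
proof -
  obtain M \<delta> where \<delta>: "0 < \<delta>" and graph: "\<And>x r. x \<in> E \<Longrightarrow> 0 < r \<Longrightarrow> ennreal r \<le> ediam E \<Longrightarrow>
      \<exists>\<Gamma>. lipschitz_graph n M \<Gamma> \<and> ennreal (\<delta> * r ^ n) \<le> hausdorff_outer n (E \<inter> \<Gamma> \<inter> cball x r)"
    using assms(1) unfolding BPLG_def by blast
  have "\<exists>g. (\<forall>u\<in>Rn_cball0 n r. \<forall>v\<in>Rn_cball0 n r. dist (g u) (g v) \<le> (1 + M) * Rn_dist n u v) \<and>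
      ennreal (\<delta> * r ^ n) \<le> hausdorff_outer n (E \<inter> cball x r \<inter> g ` Rn_cball0 n r)"
    if x: "x \<in> E" and r: "0 < r" "ennreal r \<le> ediam E" for x r
  proof -
    obtain \<Gamma> where \<Gamma>: "lipschitz_graph n M \<Gamma>" "ennreal (\<delta> * r ^ n) \<le> hausdorff_outer n (E \<inter> \<Gamma> \<inter> cball x r)"
      using graph[OF x r] by blast
    obtain g where g: "\<And>u v. dist (g u) (g v) \<le> (1 + M) * Rn_dist n u v" "\<Gamma> \<inter> cball x r \<subseteq> g ` Rn_cball0 n r"
      using lipschitz_graph_parametrisation[OF \<Gamma>(1)] by blast
    have "hausdorff_outer n (E \<inter> \<Gamma> \<inter> cball x r) \<le> hausdorff_outer n (E \<inter> cball x r \<inter> g ` Rn_cball0 n r)"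
      using g(2) by (intro hausdorff_outer_mono) auto
    with \<Gamma>(2) g(1) show ?thesis by (intro exI[of _ g]) (auto intro: order_trans)
  qed
  then have "\<exists>\<delta> M. 0 < \<delta> \<and> (\<forall>x\<in>E. \<forall>r. 0 < r \<and> ennreal r \<le> ediam E \<longrightarrow>
      (\<exists>g. (\<forall>u\<in>Rn_cball0 n r. \<forall>v\<in>Rn_cball0 n r. dist (g u) (g v) \<le> M * Rn_dist n u v) \<and>
        ennreal (\<delta> * r ^ n) \<le> hausdorff_outer n (E \<inter> cball x r \<inter> g ` Rn_cball0 n r)))"
    by (intro exI[of _ \<delta>] exI[of _ "1 + M"] conjI \<delta> ballI allI impI) simp
  with assms show ?thesis
    by (simp only: uniformly_rectifiable_def BPLG_def simp_thms)
qed

theorem theorem1p6: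
  fixes n :: nat
    and E :: "'a::euclidean_space set"
    and \<gamma> :: "'a set measure"
    and \<kappa> C :: real
  assumes "1 \<le> n" and "n < DIM('a)"
    and "is_grassmann_measure n \<gamma>"
    and "ADR n E"
    and "0 < \<kappa>"
    and "\<forall>x\<in>E. \<forall>r. 0 < r \<and> ennreal r \<le> ediam E \<longrightarrow>
           (\<exists>E' V0. E' \<in> sets (hausdorff_measure n) \<and> E' \<subseteq> E \<inter> cball x r \<and>
                    V0 \<in> Grassmannian n \<and>
                    ennreal (\<kappa> * r ^ n) \<le> emeasure (hausdorff_measure n) E' \<and>
                    (AE V in \<gamma>. V \<in> grassmann_cball n V0 \<kappa> \<longrightarrow>
                       in_L2 (plane_measure n V) (proj_measure n E' V)) \<and>
                    (\<integral>\<^sup>+ V \<in> grassmann_cball n V0 \<kappa>.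
                       L2_norm_sq (plane_measure n V) (proj_measure n E' V) \<partial>\<gamma>)
                      \<le> ennreal (C * r ^ n))"
  shows "BPLG n E \<and> (closed E \<longrightarrow> uniformly_rectifiable n E)"
proof -
  obtain C1 C2 where C: "0 < C1" "C1 \<le> C2"
    and adr: "\<And>x r. x \<in> E \<Longrightarrow> 0 < r \<Longrightarrow> ennreal r \<le> ediam E \<Longrightarrow>
      ennreal (C1 * r ^ n) \<le> hausdorff_outer n (E \<inter> cball x r) \<and>
      hausdorff_outer n (E \<inter> cball x r) \<le> ennreal (C2 * r ^ n)"
  proof -
    have "\<exists>C1 C2. 0 < C1 \<and> C1 \<le> C2 \<and> (\<forall>x\<in>E. \<forall>r. 0 < r \<and> ennreal r \<le> ediam E \<longrightarrow>
          ennreal (C1 * r ^ n) \<le> hausdorff_outer n (E \<inter> cball x r) \<and>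
          hausdorff_outer n (E \<inter> cball x r) \<le> ennreal (C2 * r ^ n))"
      using assms(4) by (simp only: ADR_def)
    then show ?thesis using that by (elim exE conjE) simp
  qed
  have C2: "0 \<le> C2" "0 \<le> C2 * 2 ^ n" using C by auto
  have "BPLG n E"
  \<comment> \<open>M and \<delta> are obtained before any x and r is chosen, in the order of
    quantifiers in \<open>BPLG\<close>. The factor 2^n comes from the doubled ball.\<close>
  proof (rule big_lipschitz_graph_piece[OF assms(3,5) C(1) C2(2), where C = C], goal_cases)
    case (1 M \<delta>)
    note \<delta> = 1(1) and piece = 1(2)
    have "\<exists>\<Gamma>. lipschitz_graph n M \<Gamma> \<and> ennreal (\<delta> * r ^ n) \<le> hausdorff_outer n (E \<inter> \<Gamma> \<inter> cball x r)"
      if x: "x \<in> E" and r: "0 < r" "ennreal r \<le> ediam E" for x r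
    proof -
      obtain E' V0 where E': "E' \<in> sets (hausdorff_measure n)" "E' \<subseteq> E \<inter> cball x r" and V0: "V0 \<in> Grassmannian n"
        and big: "ennreal (\<kappa> * r ^ n) \<le> emeasure (hausdorff_measure n) E'"
        and L2: "(\<integral>\<^sup>+ V \<in> grassmann_cball n V0 \<kappa>. L2_norm_sq (plane_measure n V) (proj_measure n E' V) \<partial>\<gamma>) \<le> ennreal (C * r ^ n)"
        using assms(6)[rule_format, OF x conjI[OF r]] by blast
      have "\<exists>\<Gamma>. lipschitz_graph n M \<Gamma> \<and> ennreal (\<delta> * r ^ n) \<le> hausdorff_outer n (E' \<inter> \<Gamma>)"
      proof (rule piece[OF r(1) E' V0 _ L2])
        show "ennreal (\<kappa> * r ^ n) \<le> hausdorff_outer n E'" using big E'(1) by (simp add: emeasure_hausdorff_measure)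
        show "ennreal (C1 * s ^ n) \<le> hausdorff_outer n (E \<inter> cball y s)" if "y \<in> E" "0 < s" "s \<le> r" for y s
        proof -
          have "ennreal s \<le> ediam E" using ennreal_leI[OF that(3)] r(2) by (rule order_trans)
          with adr[OF that(1,2)] show ?thesis by simp
        qed
        show "hausdorff_outer n (E \<inter> cball x (2 * r)) \<le> ennreal (C2 * 2 ^ n * r ^ n)"
          using adr[OF x] by (intro ADR_upper_double[OF C2(1) _ x r]) simp
      qed
      then obtain \<Gamma> where \<Gamma>: "lipschitz_graph n M \<Gamma>" "ennreal (\<delta> * r ^ n) \<le> hausdorff_outer n (E' \<inter> \<Gamma>)" by blast
      have "hausdorff_outer n (E' \<inter> \<Gamma>) \<le> hausdorff_outer n (E \<inter> \<Gamma> \<inter> cball x r)"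
        using E'(2) by (intro hausdorff_outer_mono) auto
      with \<Gamma>(2) have "ennreal (\<delta> * r ^ n) \<le> hausdorff_outer n (E \<inter> \<Gamma> \<inter> cball x r)" by (rule order_trans)
      with \<Gamma>(1) show ?thesis by blast
    qed
    then show ?case
      unfolding BPLG_def
      by (intro conjI assms(4) exI[of _ M] exI[of _ \<delta>] \<delta> ballI allI impI) simp
  qed
  then show ?thesis using BPLG_imp_uniformly_rectifiable[of n E] by simp
qed

end
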